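(* Let $\Delta=\mathbb{R}$ or $\Delta=\mathbb{C}$, let $\beta>0$, and let $V:\Delta\to\mathbb{R}$ be a continuous function such that $Z_N<+\infty$ for all $N\geq 1$. Assume that there exists $\beta'>1$ with $\beta'\geq\beta$ such that $$\liminf_{|x|\to\infty,\;x\in\Delta}\big\{V(x)-\beta'\log|x|\big\}>-\infty .$$ Let $\mu_V^*$ be the unique minimizer of $I_V$ on $\mathcal{M}_1(\Delta)$, and let $\mathbb{P}$ be the probability measure of the product probability space $\bigotimes_{N\geq1}(\Delta^N,\mathbb{P}_N)$. Then $$\mathbb{P}\big(\mu^N\text{ converges weakly to }\mu_V^*\text{ as }N\to\infty\big)=1 .$$
   Context: $\mathcal{M}_1(\Delta)$ is the space of Borel probability measures on $\Delta$ with the weak topology. For $N\geq 1$, $$Z_N=\int_{\Delta^N}\prod_{1\leq i<j\leq N}|x_i-x_j|^\beta\prod_{i=1}^N e^{-NV(x_i)}\,dx_i ,$$ where $dx$ is Lebesgue measure on $\Delta$ (on $\mathbb{R}$, or on $\mathbb{C}\simeq\mathbb{R}^2$). $\mathbb{P}_N$ is the probability measure on $\Delta^N$ with density $$\frac{1}{Z_N}\prod_{1\leq i<j\leq N}|x_i-x_j|^\beta\prod_{i=1}^N e^{-NV(x_i)}$$ with respect to Lebesgue measure on $\Delta^N$, and $\mu^N=\frac1N\sum_{i=1}^N\delta_{x_i}$, where $(x_1,\dots,x_N)$ is the $N$-th coordinate (in $\Delta^N$) of a point of the product space. Set $$F_V(x,y)=\frac{\beta}{2}\log\frac{1}{|x-y|}+\frac12V(x)+\frac12V(y),\qquad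 x,y\in\Delta,$$ with value $+\infty$ when $x=y$. Under the growth assumption $F_V$ is bounded from below, so $$I_V(\mu)=\iint F_V(x,y)\,d\mu(x)\,d\mu(y)\in\mathbb{R}\cup\{+\infty\},\qquad\mu\in\mathcal{M}_1(\Delta),$$ is well defined. Under the stated hypotheses $I_V$ has a unique minimizer on $\mathcal{M}_1(\Delta)$. *)

theory Defs
  imports "HOL-Probability.Probability"
begin

text \<open>Everything is defined over a Euclidean space \<^typ>\<open>'a\<close>; the cases of interest are
  \<^typ>\<open>real\<close> and \<^typ>\<open>complex\<close>. A configuration of \<open>N\<close> points is a function on the index set
  \<open>{1..N}\<close>, and \<^term>\<open>lborel\<close> is Lebesgue measure on the Borel sets.\<close>

definition gibbs_weight :: "real \<Rightarrow> ('a::euclidean_space \<Rightarrow> real) \<Rightarrow> nat \<Rightarrow> (nat \<Rightarrow> 'a) \<Rightarrow> real" where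
  "gibbs_weight \<beta> V N x =
     (\<Prod>i=1..N. \<Prod>j=i+1..N. norm (x i - x j) powr \<beta>) * (\<Prod>i=1..N. exp (- real N * V (x i)))"

definition partition_function :: "real \<Rightarrow> ('a::euclidean_space \<Rightarrow> real) \<Rightarrow> nat \<Rightarrow> ennreal" where
  "partition_function \<beta> V N =
     (\<integral>\<^sup>+ x. ennreal (gibbs_weight \<beta> V N x) \<partial>(\<Pi>\<^sub>M i\<in>{1..N}. lborel))"

definition gibbs_measure :: "real \<Rightarrow> ('a::euclidean_space \<Rightarrow> real) \<Rightarrow> nat \<Rightarrow> (nat \<Rightarrow> 'a) measure" where
  "gibbs_measure \<beta> V N =
     density (\<Pi>\<^sub>M i\<in>{1..N}. lborel)
       (\<lambda>x. ennreal (gibbs_weight \<beta> V N x) / partition_function \<beta> V N)"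

text \<open>The sample space of all point configurations: \<open>\<omega> N\<close> is the configuration of \<open>N\<close> points,
  drawn independently for distinct \<open>N \<ge> 1\<close>.\<close>

definition product_gibbs_measure ::
    "real \<Rightarrow> ('a::euclidean_space \<Rightarrow> real) \<Rightarrow> (nat \<Rightarrow> nat \<Rightarrow> 'a) measure" where
  "product_gibbs_measure \<beta> V = (\<Pi>\<^sub>M N\<in>{1..}. gibbs_measure \<beta> V N)"

definition empirical_measure :: "nat \<Rightarrow> (nat \<Rightarrow> 'a::topological_space) \<Rightarrow> 'a measure" where
  "empirical_measure N x =
     measure_of UNIV (sets borel)
       (\<lambda>A. (\<Sum>i=1..N. emeasure (return borel (x i)) A) / of_nat N)"

text \<open>\<^const>\<open>measure_of\<close> yields the null measure unless its argument is countably additive; the next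
  lemma confirms that it is.\<close>

lemma emeasure_empirical_measure:
  assumes "A \<in> sets borel"
  shows "emeasure (empirical_measure N x) A =
           (\<Sum>i=1..N. emeasure (return borel (x i)) A) / of_nat N"
proof (rule emeasure_measure_of[OF empirical_measure_def])
  show "countably_additive (sets (empirical_measure N x))
          (\<lambda>A. (\<Sum>i=1..N. emeasure (return borel (x i)) A) / of_nat N)"
  proof (rule countably_additiveI)
    fix B :: "nat \<Rightarrow> 'a set"
    assume "range B \<subseteq> sets (empirical_measure N x)" and disj: "disjoint_family B"
    then have B: "range B \<subseteq> sets borel"
      by (simp add: empirical_measure_def sets.sigma_sets_eq[of borel, simplified])
    have "(\<Sum>k. (\<Sum>i=1..N. emeasure (return borel (x i)) (B k)) / of_nat N)
        = (\<Sum>i=1..N. \<Sum>k. emeasure (return borel (x i)) (B k)) / of_nat N"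
      by (simp add: suminf_sum divide_ennreal_def)
    also have "\<dots> = (\<Sum>i=1..N. emeasure (return borel (x i)) (\<Union>k. B k)) / of_nat N"
      by (intro arg_cong[where f = "\<lambda>s. s / of_nat N"] sum.cong refl suminf_emeasure)
         (use B disj in auto)
    finally show "(\<Sum>k. (\<Sum>i=1..N. emeasure (return borel (x i)) (B k)) / of_nat N)
        = (\<Sum>i=1..N. emeasure (return borel (x i)) (\<Union>k. B k)) / of_nat N" .
  qed
qed (use assms in \<open>auto simp: positive_def empirical_measure_def\<close>)

definition borel_prob_measures :: "'a::topological_space measure set" where
  "borel_prob_measures = {\<mu>. prob_space \<mu> \<and> sets \<mu> = sets borel}"

text \<open>Convergence tested against bounded continuous functions. The library's \<^const>\<open>weak_conv_m\<close>
  goes through distribution functions and so is confined to the real line.\<close>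

definition weakly_converges ::
    "(nat \<Rightarrow> 'a::topological_space measure) \<Rightarrow> 'a measure \<Rightarrow> bool" where
  "weakly_converges \<mu> \<nu> \<longleftrightarrow>
     (\<forall>f::'a \<Rightarrow> real. continuous_on UNIV f \<and> bounded (range f) \<longrightarrow>
        (\<lambda>n. integral\<^sup>L (\<mu> n) f) \<longlonglongrightarrow> integral\<^sup>L \<nu> f)"

definition energy_kernel :: "real \<Rightarrow> ('a::euclidean_space \<Rightarrow> real) \<Rightarrow> 'a \<Rightarrow> 'a \<Rightarrow> ereal" where
  "energy_kernel \<beta> V x y =
     (if x = y then \<infinity>
      else ereal (\<beta> / 2 * ln (1 / norm (x - y)) + 1 / 2 * V x + 1 / 2 * V y))"

text \<open>Integral of an extended-real function as positive minus negative part: \<^const>\<open>e2ennreal\<close>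
  sends negative values to \<open>0\<close>. For a function bounded from below and a finite measure the
  subtrahend is finite, so the convention \<open>\<infinity> - \<infinity> = \<infinity>\<close> of \<^typ>\<open>ereal\<close> never matters.\<close>

definition ereal_integral :: "'b measure \<Rightarrow> ('b \<Rightarrow> ereal) \<Rightarrow> ereal" where
  "ereal_integral M f =
     enn2ereal (\<integral>\<^sup>+ x. e2ennreal (f x) \<partial>M) - enn2ereal (\<integral>\<^sup>+ x. e2ennreal (- f x) \<partial>M)"

definition energy :: "real \<Rightarrow> ('a::euclidean_space \<Rightarrow> real) \<Rightarrow> 'a measure \<Rightarrow> ereal" where
  "energy \<beta> V \<mu> = ereal_integral (\<mu> \<Otimes>\<^sub>M \<mu>) (\<lambda>(x, y). energy_kernel \<beta> V x y)"

definition equilibrium_measure :: "real \<Rightarrow> ('a::euclidean_space \<Rightarrow> real) \<Rightarrow> 'a measure" where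
  "equilibrium_measure \<beta> V =
     (THE \<mu>. \<mu> \<in> borel_prob_measures \<and>
        (\<forall>\<nu>\<in>borel_prob_measures. energy \<beta> V \<mu> \<le> energy \<beta> V \<nu>))"

end

theory Submission
  imports Defs "HOL-Real_Asymp.Real_Asymp"
begin

text \<open>
  Write \<open>u \<in> S\<close> for the image of a point under inverse stereographic projection to the unit sphere
  \<open>S\<close>. The chordal distance factorises, \<open>|x - y| = |u(x) - u(y)| a(x) a(y) / 2\<close> with
  \<open>a(x)^2 = 1 + |x|^2\<close>, so that

    \<open>F_V(x,y) = (\<beta>/2) k(x,y) + W(x)/2 + W(y)/2\<close>,  \<open>k = 1/2 log (2 / (1 - u(x) \<bullet> u(y))) \<ge> 0\<close>,
    \<open>W(x) = V(x) - (\<beta>/2) log (1 + |x|^2)\<close>,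

  and the growth condition on \<open>V\<close> makes \<open>W\<close> bounded below. The
  weakly confining case, in which \<open>F_V\<close> stays bounded at infinity, thereby becomes a problem with a
  nonnegative kernel on a compact sphere; mass cannot escape to infinity because a point mass at the
  north pole would have infinite energy.

  Two features of \<open>k\<close> carry the argument. First, for \<open>0 \<le> r < 1\<close> the kernels
  \<open>k_r = 1/2 log ((1 + r) / (1 - r s))\<close>, \<open>s = u(x) \<bullet> u(y)\<close>, are bounded, lie below \<open>k\<close>, tend to
  \<open>k\<close> as \<open>r \<rightarrow> 1\<close> even along moving points, and have a power series in \<open>s\<close> with nonnegative
  coefficients. Secondly, \<open>s^j\<close> is a sum of squares: it is the sum over words \<open>\<alpha>\<close> of length \<open>j\<close> in
  the basis vectors of \<open>u(x)^\<alpha> u(y)^\<alpha>\<close>. Consequently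
  the energy of a difference \<open>\<mu> - \<nu>\<close> of probability measures with respect to \<open>k_r\<close> is a weighted sum
  of squared moment differences (the discrepancy). The discrepancy is nonnegative, which makes the
  energy convex; it vanishes only for \<open>\<mu> = \<nu>\<close>, because the moments determine the integrals of all
  continuous functions on \<open>S\<close>; and if it tends to \<open>0\<close> then the measures converge weakly.

  Three consequences give the theorem.

  \<^item> Compactness (\<open>energy_lsc_compactness\<close>): measures whose regularised energies stay below a
    bound have a limit point with energy below that bound. So a minimiser exists, and the
    minima of the regularised energies tend to the minimum of the energy
    (\<open>min_energy_regularized\<close>). With the parallelogram identity for the midpoint of two measures this
    yields uniqueness and the quantitative \<open>energy_gap\<close>: a measure at discrepancy \<open>\<delta>\<close> from the
    minimiser \<open>\<mu>\<close> has regularised energy at least \<open>I(\<mu>) + (\<beta>/4) \<delta>\<close>, up to an error that is as small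
    as desired.
  \<^item> A lower bound \<open>Z_N \<ge> exp (- N (N - 1) (I(\<mu>) + \<epsilon>) - K N)\<close> (\<open>partition_function_lower\<close>): truncate
    \<open>\<mu>\<close> to a ball and smear it out over small translations, which by convexity and translation
    invariance of \<open>log |x - y|\<close> hardly raises the energy and makes the measure bounded by a multiple of
    Lebesgue measure; then apply Jensen's inequality to the product of this measure.
  \<^item> An upper bound for the weight of a configuration in terms of the regularised energy of its
    empirical measure. The regularised kernel is finite on the diagonal, so the diagonal terms cost only
    \<open>O(N)\<close>, and the remaining factor \<open>\<Prod> exp (- V(x_i))\<close> has integral \<open>Z_1^N\<close>.

  Together they show that the empirical measure is at discrepancy at least \<open>\<delta>\<close> from \<open>\<mu>\<close> with
  probability at most \<open>exp (- \<gamma> N (N - 1) + C N)\<close>, which is summable; the Borel--Cantelli lemma concludes.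
  Weak convergence to \<open>\<mu>\<close> amounts to convergence of countably many moments, so it is a measurable event.
\<close>

section \<open>Stereographic projection\<close>

definition stereo :: "'a::euclidean_space \<Rightarrow> 'a \<times> real" where
  "stereo x = (1 / (1 + (norm x)\<^sup>2)) *\<^sub>R (2 *\<^sub>R x, (norm x)\<^sup>2 - 1)"

definition unstereo :: "'a::euclidean_space \<times> real \<Rightarrow> 'a" where
  "unstereo p = (1 / (1 - snd p)) *\<^sub>R fst p"

lemma one_plus_norm_sq_pos: "1 + (norm x)\<^sup>2 > 0" "1 + (norm x)\<^sup>2 \<noteq> 0"
  by (smt (verit) zero_le_power2)+

lemma snd_stereo: "1 - snd (stereo x) = 2 / (1 + (norm x)\<^sup>2)"
  using one_plus_norm_sq_pos[of x] by (simp add: stereo_def divide_simps)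

lemma unstereo_stereo [simp]: "unstereo (stereo x) = x"
proof -
  define a where "a = 1 + (norm x)\<^sup>2"
  have "a \<noteq> 0" using one_plus_norm_sq_pos[of x] by (simp add: a_def)
  have "fst (stereo x) = (2 / a) *\<^sub>R x" by (simp add: stereo_def a_def)
  then show ?thesis
    unfolding unstereo_def snd_stereo a_def[symmetric] using \<open>a \<noteq> 0\<close> by simp
qed

text \<open>The chordal distance is conformal to the flat one; this identity is the only geometric input, and
  it also shows that the image lies on the unit sphere (take \<open>y = x\<close>).\<close>

lemma stereo_inner:
  "1 - stereo x \<bullet> stereo y = 2 * (norm (x - y))\<^sup>2 / ((1 + (norm x)\<^sup>2) * (1 + (norm y)\<^sup>2))"
proof -
  have *: "(norm (x - y))\<^sup>2 = (norm x)\<^sup>2 + (norm y)\<^sup>2 - 2 * (x \<bullet> y)"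
    by (simp add: power2_norm_eq_inner inner_diff inner_commute algebra_simps)
  have "stereo x \<bullet> stereo y =
      (4 * (x \<bullet> y) + ((norm x)\<^sup>2 - 1) * ((norm y)\<^sup>2 - 1)) / ((1 + (norm x)\<^sup>2) * (1 + (norm y)\<^sup>2))"
    by (simp add: stereo_def inner_Pair algebra_simps add_divide_distrib diff_divide_distrib)
  moreover define D where "D = (1 + (norm x)\<^sup>2) * (1 + (norm y)\<^sup>2)"
  ultimately have "1 - stereo x \<bullet> stereo y =
      (D - (4 * (x \<bullet> y) + ((norm x)\<^sup>2 - 1) * ((norm y)\<^sup>2 - 1))) / D"
    using one_plus_norm_sq_pos(2)[of x] one_plus_norm_sq_pos(2)[of y] by (simp add: diff_divide_distrib)
  also have "D - (4 * (x \<bullet> y) + ((norm x)\<^sup>2 - 1) * ((norm y)\<^sup>2 - 1)) = 2 * (norm (x - y))\<^sup>2"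
    unfolding * D_def by (simp add: algebra_simps)
  finally show ?thesis by (simp add: D_def)
qed

lemma norm_stereo [simp]: "norm (stereo x) = 1"
  using stereo_inner[of x x] by (simp add: norm_eq_1)

lemma abs_stereo_inner_le: "\<bar>stereo x \<bullet> stereo y\<bar> \<le> 1"
  using Cauchy_Schwarz_ineq2[of "stereo x" "stereo y"] by simp

lemma stereo_inner_le: "stereo x \<bullet> stereo y \<le> 1"
  using abs_stereo_inner_le[of x y] by linarith

lemma continuous_on_stereo: "continuous_on UNIV stereo"
  unfolding stereo_def
  by (intro continuous_intros) (use one_plus_norm_sq_pos in auto)

lemma measurable_stereo [measurable]: "stereo \<in> borel_measurable borel"
  by (rule borel_measurable_continuous_onI[OF continuous_on_stereo])

lemma measurable_unstereo [measurable]: "unstereo \<in> borel_measurable borel"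
  unfolding unstereo_def borel_prod[symmetric] by measurable

section \<open>The chordal logarithmic kernel and its regularisation\<close>

text \<open>For unit vectors with inner product \<open>s\<close>, the value at \<open>r = 1\<close> is \<open>- log (|p - q| / 2)\<close>. With the
  factor \<open>1 + r\<close>, rather than \<open>2\<close>, in the numerator the kernels for \<open>r < 1\<close> stay below the one for \<open>r = 1\<close>
  also at negative \<open>s\<close>, and they are still nonnegative.\<close>

definition chord_kernel :: "real \<Rightarrow> real \<Rightarrow> ennreal" where
  "chord_kernel r s = (if r * s = 1 then \<infinity> else ennreal (1 / 2 * ln ((1 + r) / (1 - r * s))))"

lemma measurable_chord_kernel [measurable]: "chord_kernel r \<in> borel_measurable borel"
  unfolding chord_kernel_def by measurable

lemma mult_less_one_of_le:
  fixes r s :: real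
  assumes "0 \<le> r" "r < 1" "s \<le> 1"
  shows "r * s < 1"
  using assms by (smt (verit) mult_left_le)

text \<open>Clearing denominators, the inequality between the arguments of the logarithms is
  \<open>(1 - r) (1 + s) \<ge> 0\<close>.\<close>

lemma chord_kernel_le:
  assumes "0 \<le> r" "r < 1" "\<bar>s\<bar> \<le> 1"
  shows "chord_kernel r s \<le> chord_kernel 1 s"
proof (cases "s = 1")
  case False
  with assms have s: "s < 1" by auto
  have rs: "r * s < 1" using mult_less_one_of_le assms by auto
  have "(1 - r) * (1 + s) \<ge> 0" using assms by auto
  then have "(1 + r) * (1 - s) \<le> 2 * (1 - r * s)" by (simp add: algebra_simps)
  then have "(1 + r) / (1 - r * s) \<le> 2 / (1 - s)"
    using rs s by (simp add: divide_simps mult.commute)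
  then have "ln ((1 + r) / (1 - r * s)) \<le> ln (2 / (1 - s))"
    using assms rs s by (intro ln_mono) auto
  with False rs show ?thesis by (auto simp: chord_kernel_def intro!: ennreal_leI)
qed (auto simp: chord_kernel_def)

lemma ln_chord_nonneg:
  assumes "0 \<le> r" "r \<le> 1" "\<bar>s\<bar> \<le> 1" "r * s < 1"
  shows "ln ((1 + r) / (1 - r * s)) \<ge> (0::real)"
proof -
  have "0 \<le> r * (1 + s)" using assms by auto
  then have "1 - r * s \<le> 1 + r" by (simp add: algebra_simps)
  then show ?thesis using assms by (intro ln_ge_zero) auto
qed

lemma summable_chord_series:
  fixes r :: real
  assumes "0 \<le> r" "r < 1" "\<And>j. \<bar>q j\<bar> \<le> C"
  shows "summable (\<lambda>j. r ^ Suc j / Suc j * q j)"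
proof (rule summable_comparison_test'[where N = 0 and g = "\<lambda>j. C * r ^ j"])
  show "summable (\<lambda>j. C * r ^ j)"
    using assms by (intro summable_mult summable_geometric) auto
  fix j :: nat
  have "r ^ Suc j \<le> r ^ j"
    using assms by (intro power_decreasing) auto
  moreover have "r ^ Suc j / Suc j \<le> r ^ Suc j / 1"
    using assms by (intro divide_left_mono) auto
  ultimately have "r ^ Suc j / Suc j \<le> r ^ j" by simp
  then have "r ^ Suc j / Suc j * \<bar>q j\<bar> \<le> r ^ j * C"
    using assms by (intro mult_mono) auto
  then show "norm (r ^ Suc j / Suc j * q j) \<le> C * r ^ j"
    using assms by (simp add: abs_mult mult.commute)
qed

lemma ln_one_minus_series:
  fixes z :: real
  assumes "\<bar>z\<bar> < 1"
  shows "- ln (1 - z) = (\<Sum>j. z ^ Suc j / Suc j)"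
proof -
  have "ln (1 - z) = (\<Sum>n. (-1)^n * (1 / real (n + 1)) * (- z)^(Suc n))"
    using ln_series[of "1 - z"] assms by auto
  also have "(\<lambda>n. (-1)^n * (1 / real (n + 1)) * (- z)^(Suc n)) = (\<lambda>n. - (z ^ Suc n / Suc n))"
  proof
    fix n
    have "(-1::real)^n * (- z)^(Suc n) = - (z ^ Suc n)"
      by (subst power_minus) (simp add: power_mult_distrib[symmetric])
    then show "(-1)^n * (1 / real (n + 1)) * (- z)^(Suc n) = - (z ^ Suc n / Suc n)"
      by (simp add: field_simps)
  qed
  also have "(\<Sum>n. - (z ^ Suc n / Suc n)) = - (\<Sum>n. z ^ Suc n / Suc n)"
  proof (rule suminf_minus)
    have "summable (\<lambda>n. \<bar>z\<bar> ^ Suc n / Suc n * (sgn z) ^ Suc n)"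
      using assms by (intro summable_chord_series[where C = 1])
        (auto simp: power_abs[symmetric] sgn_if)
    moreover have "(\<lambda>n. \<bar>z\<bar> ^ Suc n / Suc n * (sgn z) ^ Suc n) = (\<lambda>n. z ^ Suc n / Suc n)"
      by (intro ext) (simp add: power_mult_distrib[symmetric] abs_mult_sgn del: power_Suc)
    ultimately show "summable (\<lambda>n. z ^ Suc n / Suc n)" by simp
  qed
  finally show ?thesis by simp
qed

lemma ln_chord_series:
  fixes r s :: real
  assumes "0 \<le> r" "r < 1" "\<bar>s\<bar> \<le> 1"
  shows "1 / 2 * ln ((1 + r) / (1 - r * s)) =
         1 / 2 * ln (1 + r) + 1 / 2 * (\<Sum>j. r ^ Suc j / Suc j * s ^ Suc j)"
proof -
  have "\<bar>r * s\<bar> < 1" 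
    using assms by (metis abs_mult abs_of_nonneg abs_ge_zero mult_less_one_of_le)
  then have "- ln (1 - r * s) = (\<Sum>j. (r * s) ^ Suc j / Suc j)" by (rule ln_one_minus_series)
  moreover have "r * s < 1" using mult_less_one_of_le assms by auto
  ultimately show ?thesis using assms 
    by (simp add: ln_div power_mult_distrib field_simps del: power_Suc)
qed

section \<open>Moments on the sphere and positive definiteness\<close>

text \<open>Words in the basis vectors index the entries of the \<open>j\<close>-fold tensor power of a vector, so the same
  monomial occurs once for every ordering of its factors. With this redundancy
  \<open>(p \<bullet> q)^j\<close> is the plain inner product of tensor powers, without multinomial coefficients.\<close>

definition words :: "nat \<Rightarrow> 'b::euclidean_space list set" where
  "words j = {\<alpha>. set \<alpha> \<subseteq> Basis \<and> length \<alpha> = j}"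

definition monomial :: "'b::euclidean_space list \<Rightarrow> 'b \<Rightarrow> real" where
  "monomial \<alpha> p = (\<Prod>b\<leftarrow>\<alpha>. p \<bullet> b)"

lemma finite_words [simp]: "finite (words j :: 'b::euclidean_space list set)"
  unfolding words_def using finite_lists_length_eq[of "Basis :: 'b set" j] by simp

lemma words_0: "words 0 = {[]}" by (auto simp: words_def)

lemma sum_words_Suc:
  fixes g :: "'b::euclidean_space list \<Rightarrow> real"
  shows "(\<Sum>\<alpha>\<in>words (Suc j). g \<alpha>) = (\<Sum>b\<in>(Basis :: 'b set). \<Sum>\<alpha>\<in>words j. g (b # \<alpha>))"
proof -
  have eq: "words (Suc j) = (\<lambda>(b, \<alpha>). b # \<alpha>) ` ((Basis :: 'b set) \<times> words j)"
    by (auto simp: words_def length_Suc_conv image_iff)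
  have "(\<Sum>\<alpha>\<in>words (Suc j). g \<alpha>) = (\<Sum>(b, \<alpha>)\<in>(Basis :: 'b set) \<times> words j. g (b # \<alpha>))"
    unfolding eq by (subst sum.reindex) (auto simp: inj_on_def case_prod_beta)
  then show ?thesis by (simp add: sum.cartesian_product)
qed

lemma inner_power_eq_sum_words:
  fixes p q :: "'b::euclidean_space"
  shows "(p \<bullet> q) ^ j = (\<Sum>\<alpha>\<in>words j. monomial \<alpha> p * monomial \<alpha> q)"
proof (induction j)
  case (Suc j)
  have "(p \<bullet> q) ^ Suc j = (\<Sum>b\<in>Basis. (p \<bullet> b) * (q \<bullet> b)) * (\<Sum>\<alpha>\<in>words j. monomial \<alpha> p * monomial \<alpha> q)"
    by (simp add: Suc euclidean_inner[symmetric])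
  also have "\<dots> = (\<Sum>\<alpha>\<in>words (Suc j). monomial \<alpha> p * monomial \<alpha> q)"
    by (subst sum_words_Suc) (simp add: sum_product monomial_def algebra_simps)
  finally show ?case .
qed (simp add: words_0 monomial_def)

lemma continuous_on_monomial: "continuous_on S (monomial \<alpha>)"
  unfolding monomial_def by (induction \<alpha>) (auto intro!: continuous_intros)

lemma measurable_monomial [measurable]: "monomial \<alpha> \<in> borel_measurable borel"
  by (rule borel_measurable_continuous_onI[OF continuous_on_monomial])

lemma abs_monomial_le:
  assumes "norm p \<le> 1" "\<alpha> \<in> words j"
  shows "\<bar>monomial \<alpha> p\<bar> \<le> 1"
  using assms(2)
proof (induction \<alpha> arbitrary: j)
  case (Cons b \<alpha>)
  then have "b \<in> Basis" "\<bar>monomial \<alpha> p\<bar> \<le> 1" by (auto simp: words_def)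
  moreover have "\<bar>p \<bullet> b\<bar> \<le> 1"
    using Basis_le_norm[OF \<open>b \<in> Basis\<close>, of p] assms(1) by linarith
  ultimately show ?case 
    unfolding monomial_def by (auto simp: abs_mult intro: mult_le_one)
qed (simp add: monomial_def)

definition moment :: "'a::euclidean_space measure \<Rightarrow> ('a \<times> real) list \<Rightarrow> real" where
  "moment \<mu> \<alpha> = (\<integral>x. monomial \<alpha> (stereo x) \<partial>\<mu>)"

definition tensor_inner :: "nat \<Rightarrow> 'a::euclidean_space measure \<Rightarrow> 'a measure \<Rightarrow> real" where
  "tensor_inner j \<mu> \<nu> = (\<Sum>\<alpha>\<in>words j. moment \<mu> \<alpha> * moment \<nu> \<alpha>)"

lemma borel_prob_measuresD:
  assumes "\<mu> \<in> borel_prob_measures"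
  shows "prob_space \<mu>" "sets \<mu> = sets borel"
  using assms by (auto simp: borel_prob_measures_def)

lemma integral_product_fun:
  fixes f g :: "'a::euclidean_space \<Rightarrow> real"
  assumes "prob_space \<mu>" "prob_space \<nu>" 
    and "integrable \<mu> f" "integrable \<nu> g"
  shows "integrable (\<mu> \<Otimes>\<^sub>M \<nu>) (\<lambda>z. f (fst z) * g (snd z))"
    and "(\<integral>z. f (fst z) * g (snd z) \<partial>(\<mu> \<Otimes>\<^sub>M \<nu>)) = (\<integral>x. f x \<partial>\<mu>) * (\<integral>x. g x \<partial>\<nu>)"
proof -
  interpret \<mu>: prob_space \<mu> by fact
  interpret \<nu>: prob_space \<nu> by fact
  interpret pair_sigma_finite \<mu> \<nu> ..
  have [measurable]: "f \<in> borel_measurable \<mu>" "g \<in> borel_measurable \<nu>" using assms by auto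
  show int: "integrable (\<mu> \<Otimes>\<^sub>M \<nu>) (\<lambda>z. f (fst z) * g (snd z))"
    by (rule Fubini_integrable) (use assms in \<open>auto simp: abs_mult\<close>)
  show "(\<integral>z. f (fst z) * g (snd z) \<partial>(\<mu> \<Otimes>\<^sub>M \<nu>)) = (\<integral>x. f x \<partial>\<mu>) * (\<integral>x. g x \<partial>\<nu>)"
    using integral_fst'[OF int] by simp
qed

lemma integrable_monomial_stereo:
  assumes "\<mu> \<in> borel_prob_measures" "\<alpha> \<in> words j"
  shows "integrable \<mu> (\<lambda>x. monomial \<alpha> (stereo x))"
proof -
  note [measurable_cong] = borel_prob_measuresD(2)[OF assms(1)]
  interpret prob_space \<mu> using borel_prob_measuresD[OF assms(1)] by simp
  show ?thesis
    by (rule integrable_const_bound[where B = 1]) (use assms(2) in \<open>auto intro!: abs_monomial_le AE_I2\<close>)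
qed

lemma tensor_inner_eq_integral:
  fixes \<mu> \<nu> :: "'a::euclidean_space measure"
  assumes "\<mu> \<in> borel_prob_measures" "\<nu> \<in> borel_prob_measures"
  shows "tensor_inner j \<mu> \<nu> = (\<integral>z. (stereo (fst z) \<bullet> stereo (snd z)) ^ j \<partial>(\<mu> \<Otimes>\<^sub>M \<nu>))"
proof -
  note prod = integral_product_fun[OF borel_prob_measuresD(1)[OF assms(1)] borel_prob_measuresD(1)[OF assms(2)]]
  have "(\<integral>z. (stereo (fst z) \<bullet> stereo (snd z)) ^ j \<partial>(\<mu> \<Otimes>\<^sub>M \<nu>)) =
        (\<Sum>\<alpha>\<in>words j. \<integral>z. monomial \<alpha> (stereo (fst z)) * monomial \<alpha> (stereo (snd z)) \<partial>(\<mu> \<Otimes>\<^sub>M \<nu>))"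
    unfolding inner_power_eq_sum_words
    by (rule Bochner_Integration.integral_sum) (intro prod integrable_monomial_stereo assms, assumption+)
  also have "\<dots> = tensor_inner j \<mu> \<nu>"
    unfolding tensor_inner_def moment_def
    by (intro sum.cong refl prod integrable_monomial_stereo assms)
  finally show ?thesis ..
qed

lemma abs_tensor_inner_le:
  fixes \<mu> \<nu> :: "'a::euclidean_space measure"
  assumes "\<mu> \<in> borel_prob_measures" "\<nu> \<in> borel_prob_measures"
  shows "\<bar>tensor_inner j \<mu> \<nu>\<bar> \<le> 1"
proof -
  note [measurable_cong] = borel_prob_measuresD(2)[OF assms(1)] borel_prob_measuresD(2)[OF assms(2)]
  interpret \<mu>: prob_space \<mu> using borel_prob_measuresD[OF assms(1)] by simp
  interpret \<nu>: prob_space \<nu> using borel_prob_measuresD[OF assms(2)] by simp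
  interpret pair_prob_space \<mu> \<nu> ..
  have le: "\<bar>(stereo (fst z) \<bullet> stereo (snd z)) ^ j\<bar> \<le> 1" for z :: "'a \<times> 'a"
    unfolding power_abs by (intro power_le_one abs_stereo_inner_le) auto
  have "\<bar>\<integral>z. (stereo (fst z) \<bullet> stereo (snd z)) ^ j \<partial>(\<mu> \<Otimes>\<^sub>M \<nu>)\<bar>
     \<le> (\<integral>z. \<bar>(stereo (fst z) \<bullet> stereo (snd z)) ^ j\<bar> \<partial>(\<mu> \<Otimes>\<^sub>M \<nu>))"
    by (rule integral_abs_bound)
  also have "\<dots> \<le> 1" 
    by (rule P.integral_le_const) (use le in \<open>auto intro!: P.integrable_const_bound[where B=1]\<close>)
  finally show ?thesis using tensor_inner_eq_integral[OF assms] by simp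
qed

text \<open>The double integral of the regularised kernel, written through its power series; the lemma
  \<open>log_energy_eq_integral\<close> identifies the two.\<close>

definition log_energy :: "real \<Rightarrow> 'a::euclidean_space measure \<Rightarrow> 'a measure \<Rightarrow> real" where
  "log_energy r \<mu> \<nu> =
     1 / 2 * ln (1 + r) + 1 / 2 * (\<Sum>j. r ^ Suc j / Suc j * tensor_inner (Suc j) \<mu> \<nu>)"

text \<open>The squared distance of the kernel mean embeddings of the two measures, for the regularised
  kernel without its constant term.\<close>

definition discrepancy :: "real \<Rightarrow> 'a::euclidean_space measure \<Rightarrow> 'a measure \<Rightarrow> real" where
  "discrepancy r \<mu> \<nu> =
     1 / 2 * (\<Sum>j. r ^ Suc j / Suc j * (\<Sum>\<alpha>\<in>words (Suc j). (moment \<mu> \<alpha> - moment \<nu> \<alpha>)\<^sup>2))"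

text \<open>The power series converges uniformly for \<open>r < 1\<close>, since its terms are bounded by \<open>r^(j+1)\<close>, so it
  may be integrated term by term.\<close>

lemma log_energy_eq_integral:
  fixes \<mu> \<nu> :: "'a::euclidean_space measure"
  assumes \<mu>: "\<mu> \<in> borel_prob_measures" and \<nu>: "\<nu> \<in> borel_prob_measures" and r: "0 \<le> r" "r < 1"
  shows "(\<integral>\<^sup>+z. chord_kernel r (stereo (fst z) \<bullet> stereo (snd z)) \<partial>(\<mu> \<Otimes>\<^sub>M \<nu>)) = ennreal (log_energy r \<mu> \<nu>)"
    and "log_energy r \<mu> \<nu> \<ge> 0"
proof -
  note [measurable_cong] = borel_prob_measuresD(2)[OF \<mu>] borel_prob_measuresD(2)[OF \<nu>]
  interpret \<mu>: prob_space \<mu> using borel_prob_measuresD[OF \<mu>] by simp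
  interpret \<nu>: prob_space \<nu> using borel_prob_measuresD[OF \<nu>] by simp
  interpret pair_prob_space \<mu> \<nu> ..
  define S where "S z = stereo (fst z) \<bullet> stereo (snd z)" for z :: "'a \<times> 'a"
  have [measurable]: "S \<in> borel_measurable (borel \<Otimes>\<^sub>M borel)" unfolding S_def by measurable
  have S1: "\<bar>S z\<bar> \<le> 1" for z unfolding S_def by (rule abs_stereo_inner_le)
  then have Sp: "\<bar>S z ^ j\<bar> \<le> 1" for z j unfolding power_abs by (intro power_le_one) auto
  have int_p: "integrable (\<mu> \<Otimes>\<^sub>M \<nu>) (\<lambda>z. S z ^ j)" for j
    by (rule P.integrable_const_bound[where B=1]) (use Sp in auto)
  define f where "f j z = r ^ Suc j / Suc j * S z ^ Suc j" for j z
  have int_f: "integrable (\<mu> \<Otimes>\<^sub>M \<nu>) (f j)" for j unfolding f_def using int_p by (auto simp del: power_Suc)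
  have sum_f: "summable (\<lambda>j. \<integral>z. norm (f j z) \<partial>(\<mu> \<Otimes>\<^sub>M \<nu>))"
  proof -
    have "(\<integral>z. norm (f j z) \<partial>(\<mu> \<Otimes>\<^sub>M \<nu>)) = r ^ Suc j / Suc j * (\<integral>z. \<bar>S z ^ Suc j\<bar> \<partial>(\<mu> \<Otimes>\<^sub>M \<nu>))" for j
      unfolding f_def using r by (simp add: abs_mult del: power_Suc)
    moreover have "\<bar>\<integral>z. \<bar>S z ^ Suc j\<bar> \<partial>(\<mu> \<Otimes>\<^sub>M \<nu>)\<bar> \<le> 1" for j
    proof -
      have "0 \<le> (\<integral>z. \<bar>S z ^ Suc j\<bar> \<partial>(\<mu> \<Otimes>\<^sub>M \<nu>))" by simp
      moreover have "(\<integral>z. \<bar>S z ^ Suc j\<bar> \<partial>(\<mu> \<Otimes>\<^sub>M \<nu>)) \<le> 1"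
        by (rule P.integral_le_const) (use Sp int_p in \<open>auto simp del: power_Suc\<close>)
      ultimately show ?thesis by linarith
    qed
    ultimately show ?thesis
      using summable_chord_series[OF r, of "\<lambda>j. \<integral>z. \<bar>S z ^ Suc j\<bar> \<partial>(\<mu> \<Otimes>\<^sub>M \<nu>)" 1] by (simp del: power_Suc)
  qed
  have AEsum: "AE z in \<mu> \<Otimes>\<^sub>M \<nu>. summable (\<lambda>j. norm (f j z))"
  proof (rule AE_I2)
    fix z
    show "summable (\<lambda>j. norm (f j z))" unfolding f_def
      using summable_chord_series[OF r, of "\<lambda>j. \<bar>S z ^ Suc j\<bar>" 1] Sp r by (simp add: abs_mult del: power_Suc)
  qed
  note suminf = integral_suminf[OF int_f AEsum sum_f] integrable_suminf[OF int_f AEsum sum_f]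
  define g where "g z = 1 / 2 * ln ((1 + r) / (1 - r * S z))" for z
  have g_eq: "g = (\<lambda>z. 1 / 2 * ln (1 + r) + 1 / 2 * (\<Sum>j. f j z))"
    unfolding g_def f_def using ln_chord_series[OF r S1] by auto
  have int_g: "integrable (\<mu> \<Otimes>\<^sub>M \<nu>) g"
    unfolding g_eq using suminf by simp
  have rS: "r * S z < 1" for z using mult_less_one_of_le[OF r] S1[of z] by auto
  have g0: "g z \<ge> 0" for z
    unfolding g_def using ln_chord_nonneg[OF r(1) _ S1 rS] r by simp
  have "integral\<^sup>L (\<mu> \<Otimes>\<^sub>M \<nu>) g = log_energy r \<mu> \<nu>"
    unfolding g_eq log_energy_def tensor_inner_eq_integral[OF \<mu> \<nu>] using suminf
    by (simp add: P.prob_space f_def S_def del: power_Suc)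
  moreover have "chord_kernel r (S z) = ennreal (g z)" for z
    using rS[of z] by (simp add: chord_kernel_def g_def)
  ultimately show "(\<integral>\<^sup>+z. chord_kernel r (stereo (fst z) \<bullet> stereo (snd z)) \<partial>(\<mu> \<Otimes>\<^sub>M \<nu>)) = ennreal (log_energy r \<mu> \<nu>)"
    using nn_integral_eq_integral[OF int_g] g0 by (simp add: S_def)
  show "log_energy r \<mu> \<nu> \<ge> 0"
    using \<open>integral\<^sup>L _ g = _\<close> g0 by (metis Bochner_Integration.integral_nonneg)
qed

lemma sum_sq_moment_diff:
  "(\<Sum>\<alpha>\<in>words j. (moment \<mu> \<alpha> - moment \<nu> \<alpha>)\<^sup>2) =
     tensor_inner j \<mu> \<mu> + tensor_inner j \<nu> \<nu> - 2 * tensor_inner j \<mu> \<nu>"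
  unfolding tensor_inner_def
  by (simp add: power2_diff sum.distrib sum_subtractf sum_distrib_left power2_eq_square algebra_simps)

lemma discrepancy_series_summable:
  fixes \<mu> \<nu> :: "'a::euclidean_space measure"
  assumes \<mu>: "\<mu> \<in> borel_prob_measures" and \<nu>: "\<nu> \<in> borel_prob_measures" and r: "0 \<le> r" "r < 1"
  shows "summable (\<lambda>j. r ^ Suc j / Suc j * (\<Sum>\<alpha>\<in>words (Suc j). (moment \<mu> \<alpha> - moment \<nu> \<alpha>)\<^sup>2))"
proof (rule summable_chord_series[OF r, where C = 4])
  fix j
  show "\<bar>\<Sum>\<alpha>\<in>words (Suc j). (moment \<mu> \<alpha> - moment \<nu> \<alpha>)\<^sup>2\<bar> \<le> 4"
    unfolding sum_sq_moment_diff
    using abs_tensor_inner_le[OF \<mu> \<mu>, of "Suc j"] abs_tensor_inner_le[OF \<nu> \<nu>, of "Suc j"]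
      abs_tensor_inner_le[OF \<mu> \<nu>, of "Suc j"] by linarith
qed

text \<open>The constant terms of the three energies cancel because both measures have mass one.\<close>

lemma discrepancy_eq:
  fixes \<mu> \<nu> :: "'a::euclidean_space measure"
  assumes \<mu>: "\<mu> \<in> borel_prob_measures" and \<nu>: "\<nu> \<in> borel_prob_measures" and r: "0 \<le> r" "r < 1"
  shows "discrepancy r \<mu> \<nu> = log_energy r \<mu> \<mu> + log_energy r \<nu> \<nu> - 2 * log_energy r \<mu> \<nu>"
proof -
  let ?t = "\<lambda>\<mu> \<nu> j. r ^ Suc j / Suc j * tensor_inner (Suc j) \<mu> \<nu>"
  have s: "?t \<mu>' \<nu>' sums suminf (?t \<mu>' \<nu>')" if "\<mu>' \<in> borel_prob_measures" "\<nu>' \<in> borel_prob_measures"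
    for \<mu>' \<nu>' :: "'a measure"
    by (rule summable_sums[OF summable_chord_series[OF r abs_tensor_inner_le[OF that]]])
  have "(\<Sum>j. r ^ Suc j / Suc j * (\<Sum>\<alpha>\<in>words (Suc j). (moment \<mu> \<alpha> - moment \<nu> \<alpha>)\<^sup>2))
      = (\<Sum>j. ?t \<mu> \<mu> j + ?t \<nu> \<nu> j - 2 * ?t \<mu> \<nu> j)"
    unfolding sum_sq_moment_diff by (intro suminf_cong) (simp only: ring_distribs mult.left_commute)
  also have "\<dots> = suminf (?t \<mu> \<mu>) + suminf (?t \<nu> \<nu>) - 2 * suminf (?t \<mu> \<nu>)"
    using sums_diff[OF sums_add[OF s[OF \<mu> \<mu>] s[OF \<nu> \<nu>]] sums_mult[OF s[OF \<mu> \<nu>]]]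
    by (rule sums_unique[symmetric])
  finally show ?thesis unfolding discrepancy_def log_energy_def by (simp add: algebra_simps)
qed

lemma discrepancy_nonneg:
  assumes "\<mu> \<in> borel_prob_measures" "\<nu> \<in> borel_prob_measures" "0 \<le> r" "r < 1"
  shows "discrepancy r \<mu> \<nu> \<ge> 0"
  unfolding discrepancy_def using discrepancy_series_summable[OF assms] assms(3)
  by (intro mult_nonneg_nonneg suminf_nonneg sum_nonneg) auto

lemma discrepancy_mono:
  assumes \<mu>: "\<mu> \<in> borel_prob_measures" and \<nu>: "\<nu> \<in> borel_prob_measures" and r: "0 \<le> r" "r \<le> s" "s < 1"
  shows "discrepancy r \<mu> \<nu> \<le> discrepancy s \<mu> \<nu>"
  unfolding discrepancy_def
  by (intro mult_left_mono suminf_le discrepancy_series_summable[OF \<mu> \<nu>] mult_right_mono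
      divide_right_mono power_mono sum_nonneg) (use r in auto)

text \<open>Every coefficient of the series is positive, so a single squared moment difference is controlled
  by the whole discrepancy.\<close>

lemma moment_diff_le_discrepancy:
  assumes \<mu>: "\<mu> \<in> borel_prob_measures" and \<nu>: "\<nu> \<in> borel_prob_measures" and r: "0 < r" "r < 1"
    and \<alpha>: "\<alpha> \<in> words (Suc j)"
  shows "(moment \<mu> \<alpha> - moment \<nu> \<alpha>)\<^sup>2 \<le> 2 * real (Suc j) / r ^ Suc j * discrepancy r \<mu> \<nu>"
proof -
  let ?f = "\<lambda>j. r ^ Suc j / Suc j * (\<Sum>\<alpha>\<in>words (Suc j). (moment \<mu> \<alpha> - moment \<nu> \<alpha>)\<^sup>2)"
  have "?f j \<le> suminf ?f"
    using sum_le_suminf[of ?f "{j}"] discrepancy_series_summable[OF \<mu> \<nu>, of r] r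
    by (simp add: sum_nonneg del: power_Suc)
  also have "\<dots> = 2 * discrepancy r \<mu> \<nu>" by (simp add: discrepancy_def)
  finally have "(\<Sum>\<alpha>\<in>words (Suc j). (moment \<mu> \<alpha> - moment \<nu> \<alpha>)\<^sup>2) \<le> 2 * real (Suc j) / r ^ Suc j * discrepancy r \<mu> \<nu>"
    using r by (simp add: divide_simps mult_ac del: power_Suc of_nat_Suc)
  moreover have "(moment \<mu> \<alpha> - moment \<nu> \<alpha>)\<^sup>2 \<le> (\<Sum>\<alpha>\<in>words (Suc j). (moment \<mu> \<alpha> - moment \<nu> \<alpha>)\<^sup>2)"
    by (rule member_le_sum) (use \<alpha> in auto)
  ultimately show ?thesis by simp
qed

section \<open>Discrepancy and weak convergence\<close>

text \<open>The algebra spanned by the monomials; convergence of moments passes to it by induction, and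
  it contains all polynomial functions.\<close>

inductive monomial_combination :: "('b::euclidean_space \<Rightarrow> real) \<Rightarrow> bool" where
  "set \<alpha> \<subseteq> Basis \<Longrightarrow> monomial_combination (\<lambda>p. c * monomial \<alpha> p)"
| "monomial_combination f \<Longrightarrow> monomial_combination g \<Longrightarrow> monomial_combination (\<lambda>p. f p + g p)"

lemma monomial_combination_mult:
  assumes "monomial_combination f" "monomial_combination g"
  shows "monomial_combination (\<lambda>p. f p * g p)"
  using assms(1)
proof induction
  case (1 \<alpha> c)
  from assms(2) show ?case
  proof induction
    case (1 \<beta> d)
    have eq: "(\<lambda>p. c * monomial \<alpha> p * (d * monomial \<beta> p)) = (\<lambda>p. (c * d) * monomial (\<alpha> @ \<beta>) p)"
      by (auto simp: monomial_def)
    show ?case unfolding eq using 1 \<open>set \<alpha> \<subseteq> Basis\<close> by (intro monomial_combination.intros) auto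
  next
    case (2 f g)
    then show ?case using monomial_combination.intros(2) by (simp add: distrib_left)
  qed
next
  case (2 f g)
  then show ?case using monomial_combination.intros(2) by (simp add: distrib_right)
qed

lemma monomial_combination_const: "monomial_combination (\<lambda>p. c)"
  using monomial_combination.intros(1)[of "[]" c] by (simp add: monomial_def)

lemma monomial_combination_linear:
  fixes f :: "'b::euclidean_space \<Rightarrow> real"
  assumes "bounded_linear f"
  shows "monomial_combination f"
proof -
  have "monomial_combination (\<lambda>p. \<Sum>b\<in>B. f b * (p \<bullet> b))" if "finite B" "B \<subseteq> Basis" for B :: "'b set"
    using that
  proof (induction B)
    case (insert b B)
    have "monomial_combination (\<lambda>p. f b * monomial [b] p)"
      using insert by (intro monomial_combination.intros) auto
    then have "monomial_combination (\<lambda>p. f b * monomial [b] p + (\<Sum>b\<in>B. f b * (p \<bullet> b)))"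
      using insert by (intro monomial_combination.intros) auto
    then show ?case using insert by (simp add: monomial_def)
  qed (simp add: monomial_combination_const)
  from this[of Basis] have "monomial_combination (\<lambda>p. \<Sum>b\<in>Basis. f b * (p \<bullet> b))" by simp
  also have "(\<lambda>p. \<Sum>b\<in>Basis. f b * (p \<bullet> b)) = f"
  proof
    fix p
    have "f p = f (\<Sum>b\<in>Basis. (p \<bullet> b) *\<^sub>R b)" by (simp add: euclidean_representation)
    also have "\<dots> = (\<Sum>b\<in>Basis. f b * (p \<bullet> b))"
      using assms by (simp add: linear_sum bounded_linear.linear linear_cmul mult.commute)
    finally show "(\<Sum>b\<in>Basis. f b * (p \<bullet> b)) = f p" ..
  qed
  finally show ?thesis .
qed

lemma monomial_combination_polynomial:
  "real_polynomial_function f \<Longrightarrow> monomial_combination f"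
  by (induction rule: real_polynomial_function.induct)
     (auto intro: monomial_combination_linear monomial_combination_const monomial_combination_mult monomial_combination.intros)

definition moments_converge :: "(nat \<Rightarrow> 'a::euclidean_space measure) \<Rightarrow> 'a measure \<Rightarrow> bool" where
  "moments_converge \<nu> \<mu> \<longleftrightarrow> (\<forall>\<alpha>. set \<alpha> \<subseteq> Basis \<longrightarrow> (\<lambda>n. moment (\<nu> n) \<alpha>) \<longlonglongrightarrow> moment \<mu> \<alpha>)"

lemma integrable_continuous_stereo:
  fixes g :: "'a::euclidean_space \<times> real \<Rightarrow> real"
  assumes \<mu>: "\<mu> \<in> borel_prob_measures" and g: "continuous_on UNIV g"
  shows "integrable \<mu> (\<lambda>x. g (stereo x))"
proof -
  note [measurable_cong] = borel_prob_measuresD(2)[OF \<mu>]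
  interpret prob_space \<mu> using borel_prob_measuresD[OF \<mu>] by simp
  have [measurable]: "g \<in> borel_measurable borel" by (rule borel_measurable_continuous_onI[OF g])
  have "compact (g ` sphere 0 1)" by (intro compact_continuous_image continuous_on_subset[OF g]) auto
  then obtain B where "\<forall>y\<in>g ` sphere 0 1. norm y \<le> B"
    using compact_imp_bounded[THEN bounded_pos[THEN iffD1]] by blast
  then have "norm (g (stereo x)) \<le> B" for x by simp
  then show ?thesis by (intro integrable_const_bound[where B = B] AE_I2) auto
qed

lemma monomial_combination_continuous:
  "monomial_combination f \<Longrightarrow> continuous_on UNIV f"
  by (induction rule: monomial_combination.induct) (auto intro!: continuous_intros continuous_on_monomial)

text \<open>By Stone--Weierstrass a continuous function on the sphere is uniformly close to a polynomial.\<close>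

lemma moments_converge_imp_sphere:
  fixes \<mu> :: "'a::euclidean_space measure" and g :: "'a \<times> real \<Rightarrow> real"
  assumes \<nu>: "\<And>n. \<nu> n \<in> borel_prob_measures" and \<mu>: "\<mu> \<in> borel_prob_measures"
    and conv: "moments_converge \<nu> \<mu>" and g: "continuous_on UNIV g"
  shows "(\<lambda>n. \<integral>x. g (stereo x) \<partial>\<nu> n) \<longlonglongrightarrow> (\<integral>x. g (stereo x) \<partial>\<mu>)"
proof -
  have comb: "(\<lambda>n. \<integral>x. f (stereo x) \<partial>\<nu> n) \<longlonglongrightarrow> (\<integral>x. f (stereo x) \<partial>\<mu>)"
    if "monomial_combination f" for f
    using that
  proof induction
    case (1 \<alpha> c)
    then show ?case using conv by (auto simp: moments_converge_def moment_def intro!: tendsto_mult_left)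
  next
    case (2 f g)
    note int = monomial_combination_continuous[OF 2(1)] monomial_combination_continuous[OF 2(2)]
    show ?case using tendsto_add[OF 2(3,4)] int
      by (simp add: integrable_continuous_stereo \<nu> \<mu>)
  qed
  show ?thesis
  proof (rule LIMSEQ_I)
    fix e :: real assume "e > 0"
    then have "e / 3 > 0" by simp
    obtain f where f: "real_polynomial_function f" "\<And>p. p \<in> sphere 0 1 \<Longrightarrow> \<bar>g p - f p\<bar> < e / 3"
      using Stone_Weierstrass_real_polynomial_function[OF compact_sphere continuous_on_subset[OF g subset_UNIV] \<open>e / 3 > 0\<close>]
      by blast
    have fc: "continuous_on UNIV f"
      using monomial_combination_continuous monomial_combination_polynomial f(1) by blast
    have close: "\<bar>(\<integral>x. g (stereo x) \<partial>\<rho>) - (\<integral>x. f (stereo x) \<partial>\<rho>)\<bar> \<le> e / 3" if "\<rho> \<in> borel_prob_measures" for \<rho>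
    proof -
      interpret prob_space \<rho> using borel_prob_measuresD[OF that] by simp
      note int = integrable_continuous_stereo[OF that g] integrable_continuous_stereo[OF that fc]
      have "\<bar>(\<integral>x. g (stereo x) \<partial>\<rho>) - (\<integral>x. f (stereo x) \<partial>\<rho>)\<bar> = \<bar>\<integral>x. g (stereo x) - f (stereo x) \<partial>\<rho>\<bar>"
        using int by simp
      also have "\<dots> \<le> (\<integral>x. \<bar>g (stereo x) - f (stereo x)\<bar> \<partial>\<rho>)" by (rule integral_abs_bound)
      also have "\<dots> \<le> e / 3" by (rule integral_le_const) (use int f(2)[THEN less_imp_le] in \<open>auto intro!: AE_I2\<close>)
      finally show ?thesis .
    qed
    obtain N where N: "\<And>n. n \<ge> N \<Longrightarrow> norm ((\<integral>x. f (stereo x) \<partial>\<nu> n) - (\<integral>x. f (stereo x) \<partial>\<mu>)) < e / 3"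
      using LIMSEQ_D[OF comb[OF monomial_combination_polynomial[OF f(1)]] \<open>e / 3 > 0\<close>] by blast
    show "\<exists>N. \<forall>n\<ge>N. norm ((\<integral>x. g (stereo x) \<partial>\<nu> n) - (\<integral>x. g (stereo x) \<partial>\<mu>)) < e"
    proof (intro exI allI impI)
      fix n assume "n \<ge> N"
      from N[OF this] close[OF \<nu>[of n]] close[OF \<mu>] 
      show "norm ((\<integral>x. g (stereo x) \<partial>\<nu> n) - (\<integral>x. g (stereo x) \<partial>\<mu>)) < e"
        unfolding real_norm_def by linarith
    qed
  qed
qed

text \<open>Vanishes near the north pole, where \<open>snd p = 1\<close>, and equals one at height at most \<open>1 - 2 \<eta>\<close>. It makes
  functions of compact support out of bounded ones.\<close>

definition cutoff :: "real \<Rightarrow> 'a::euclidean_space \<times> real \<Rightarrow> real" where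
  "cutoff \<eta> p = max 0 (min 1 ((1 - snd p) / \<eta> - 1))"

lemma continuous_on_cutoff: "continuous_on S (cutoff \<eta>)"
  unfolding cutoff_def by (cases "\<eta> = 0") (auto intro!: continuous_intros)

lemma cutoff_bounds: "0 \<le> cutoff \<eta> p" "cutoff \<eta> p \<le> 1" by (auto simp: cutoff_def)

text \<open>A bounded continuous function on the space need not extend to the north pole, so it is cut off
  there. The mass that the cutoff misses is itself the integral of a continuous function on the
  sphere; for the limit it is small because the limit is a probability measure on the space,
  hence it is eventually small along the sequence.\<close>

lemma moments_converge_imp_weakly_converges:
  fixes \<mu> :: "'a::euclidean_space measure"
  assumes \<nu>: "\<And>n. \<nu> n \<in> borel_prob_measures" and \<mu>: "\<mu> \<in> borel_prob_measures"
    and conv: "moments_converge \<nu> \<mu>"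
  shows "weakly_converges \<nu> \<mu>"
  unfolding weakly_converges_def
proof (intro allI impI, elim conjE)
  fix f :: "'a \<Rightarrow> real" assume f: "continuous_on UNIV f" and bdd: "bounded (range f)"
  obtain B where B: "B > 0" "\<And>x. \<bar>f x\<bar> \<le> B" using bdd by (auto simp: bounded_pos)
  have [measurable]: "f \<in> borel_measurable borel" by (rule borel_measurable_continuous_onI[OF f])
  have cutm [measurable]: "cutoff \<eta> \<in> borel_measurable borel" for \<eta> :: real
    by (rule borel_measurable_continuous_onI[OF continuous_on_cutoff])
  interpret M: prob_space \<mu> using borel_prob_measuresD[OF \<mu>] by simp
  note [measurable_cong] = borel_prob_measuresD(2)[OF \<mu>]
  show "(\<lambda>n. integral\<^sup>L (\<nu> n) f) \<longlonglongrightarrow> integral\<^sup>L \<mu> f"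
  proof (rule LIMSEQ_I)
    fix e :: real assume "e > 0"
    define d where "d = e / (4 * B)"
    have d: "d > 0" "B * d = e / 4" unfolding d_def using \<open>e > 0\<close> B by (auto simp: field_simps)
    have "(\<lambda>k. \<integral>x. cutoff (1 / Suc k) (stereo x) \<partial>\<mu>) \<longlonglongrightarrow> (\<integral>x. 1 \<partial>\<mu>)"
    proof (rule integral_dominated_convergence[where w = "\<lambda>_. 1"])
      show "AE x in \<mu>. (\<lambda>k. cutoff (1 / Suc k) (stereo x)) \<longlonglongrightarrow> 1"
      proof (rule AE_I2)
        fix x :: 'a
        have pos: "1 - snd (stereo x) > 0" unfolding snd_stereo using one_plus_norm_sq_pos[of x] by simp
        obtain k0 :: nat where k0: "2 / (1 - snd (stereo x)) < real k0" using reals_Archimedean2 by blast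
        have "cutoff (1 / Suc k) (stereo x) = 1" if "k \<ge> k0" for k
        proof -
          have "2 < real k0 * (1 - snd (stereo x))" using k0 pos by (simp add: divide_simps)
          also have "\<dots> \<le> real (Suc k) * (1 - snd (stereo x))"
            using pos that by (intro mult_right_mono) auto
          finally have "1 \<le> (1 - snd (stereo x)) / (1 / real (Suc k)) - 1" by (simp add: mult.commute del: of_nat_Suc)
          then show ?thesis unfolding cutoff_def by (simp del: of_nat_Suc)
        qed
        then show "(\<lambda>k. cutoff (1 / Suc k) (stereo x)) \<longlonglongrightarrow> 1"
          by (intro tendsto_eventually) (auto simp: eventually_sequentially)
      qed
    qed (auto intro!: AE_I2 simp: cutoff_bounds)
    then obtain k where "norm ((\<integral>x. cutoff (1 / Suc k) (stereo x) \<partial>\<mu>) - (\<integral>x. 1 \<partial>\<mu>)) < d"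
      using LIMSEQ_D[OF _ d(1)] by blast
    moreover define \<eta> where "\<eta> = 1 / real (Suc k)"
    ultimately have \<eta>: "\<eta> > 0" and C\<mu>: "(\<integral>x. cutoff \<eta> (stereo x) \<partial>\<mu>) > 1 - d" by (auto simp: M.prob_space)
    \<comment> \<open>Inverse stereographic coordinates, with the denominator kept above \<open>\<eta>\<close> so that they are continuous at the pole.\<close>
    define h where "h p = (1 / max (1 - snd p) \<eta>) *\<^sub>R fst p" for p :: "'a \<times> real"
    define g where "g p = f (h p) * cutoff \<eta> p" for p
    have "continuous_on UNIV h" unfolding h_def using \<eta> by (intro continuous_intros) auto
    then have g: "continuous_on UNIV g" unfolding g_def
      by (intro continuous_intros continuous_on_cutoff continuous_on_compose2[OF f]) auto
    have gx: "g (stereo x) = f x * cutoff \<eta> (stereo x)" for x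
    proof (cases "1 - snd (stereo x) \<le> \<eta>")
      case True
      then have "cutoff \<eta> (stereo x) = 0" using \<eta> unfolding cutoff_def by (simp add: divide_simps)
      then show ?thesis by (simp add: g_def)
    next
      case False
      then have "h (stereo x) = unstereo (stereo x)" unfolding h_def unstereo_def by simp
      then show ?thesis by (simp add: g_def)
    qed
    have close: "\<bar>(\<integral>x. f x \<partial>\<rho>) - (\<integral>x. g (stereo x) \<partial>\<rho>)\<bar> \<le> B * (1 - (\<integral>x. cutoff \<eta> (stereo x) \<partial>\<rho>))"
      if \<rho>: "\<rho> \<in> borel_prob_measures" for \<rho>
    proof -
      note [measurable_cong] = borel_prob_measuresD(2)[OF \<rho>]
      interpret prob_space \<rho> using borel_prob_measuresD[OF \<rho>] by simp
      have intf: "integrable \<rho> f" by (rule integrable_const_bound[where B = B]) (use B in auto)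
      note intg = integrable_continuous_stereo[OF \<rho> g]
        and intc = integrable_continuous_stereo[OF \<rho> continuous_on_cutoff[of UNIV \<eta>]]
      have "\<bar>(\<integral>x. f x \<partial>\<rho>) - (\<integral>x. g (stereo x) \<partial>\<rho>)\<bar> = \<bar>\<integral>x. f x - g (stereo x) \<partial>\<rho>\<bar>"
        using intf intg by simp
      also have "\<dots> \<le> (\<integral>x. \<bar>f x - g (stereo x)\<bar> \<partial>\<rho>)" by (rule integral_abs_bound)
      also have "\<dots> \<le> (\<integral>x. B * (1 - cutoff \<eta> (stereo x)) \<partial>\<rho>)"
      proof (rule integral_mono)
        fix x
        have "\<bar>f x - g (stereo x)\<bar> = \<bar>f x\<bar> * (1 - cutoff \<eta> (stereo x))"
        proof -
          have "f x - g (stereo x) = f x * (1 - cutoff \<eta> (stereo x))" by (simp add: gx algebra_simps)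
          then show ?thesis using cutoff_bounds(2)[of \<eta> "stereo x"] by (simp add: abs_mult)
        qed
        also have "\<dots> \<le> B * (1 - cutoff \<eta> (stereo x))"
          using B cutoff_bounds(2)[of \<eta> "stereo x"] by (intro mult_right_mono) auto
        finally show "\<bar>f x - g (stereo x)\<bar> \<le> B * (1 - cutoff \<eta> (stereo x))" .
      qed (use intf intg intc in auto)
      also have "\<dots> = B * (1 - (\<integral>x. cutoff \<eta> (stereo x) \<partial>\<rho>))" using intc by (simp add: prob_space)
      finally show ?thesis .
    qed
    have "e / 4 > 0" using \<open>e > 0\<close> by simp
    obtain N1 where N1: "\<And>n. n \<ge> N1 \<Longrightarrow> norm ((\<integral>x. g (stereo x) \<partial>\<nu> n) - (\<integral>x. g (stereo x) \<partial>\<mu>)) < e / 4"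
      using LIMSEQ_D[OF moments_converge_imp_sphere[OF \<nu> \<mu> conv g] \<open>e / 4 > 0\<close>] by blast
    obtain N2 where N2: "\<And>n. n \<ge> N2 \<Longrightarrow> (\<integral>x. cutoff \<eta> (stereo x) \<partial>\<nu> n) > 1 - d"
      using order_tendstoD(1)[OF moments_converge_imp_sphere[OF \<nu> \<mu> conv continuous_on_cutoff] C\<mu>]
      by (auto simp: eventually_sequentially)
    show "\<exists>N. \<forall>n\<ge>N. norm (integral\<^sup>L (\<nu> n) f - integral\<^sup>L \<mu> f) < e"
    proof (intro exI[of _ "max N1 N2"] allI impI)
      fix n assume n: "n \<ge> max N1 N2"
      have "B * (1 - (\<integral>x. cutoff \<eta> (stereo x) \<partial>\<nu> n)) < B * d" "B * (1 - (\<integral>x. cutoff \<eta> (stereo x) \<partial>\<mu>)) < B * d"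
        using B N2[of n] C\<mu> n by (auto intro!: mult_strict_left_mono)
      moreover have "norm ((\<integral>x. g (stereo x) \<partial>\<nu> n) - (\<integral>x. g (stereo x) \<partial>\<mu>)) < e / 4" using N1[of n] n by simp
      ultimately show "norm (integral\<^sup>L (\<nu> n) f - integral\<^sup>L \<mu> f) < e"
        using close[OF \<nu>[of n]] close[OF \<mu>] d(2) unfolding real_norm_def by linarith
    qed
  qed
qed

text \<open>The indicator of a closed set is a decreasing limit of bounded continuous functions of the
  distance to it, and the closed sets are a generator stable under intersection.\<close>

lemma measure_eqI_bounded_continuous:
  fixes \<mu> \<nu> :: "'a::euclidean_space measure"
  assumes \<mu>: "\<mu> \<in> borel_prob_measures" and \<nu>: "\<nu> \<in> borel_prob_measures"
    and eq: "\<And>f :: 'a \<Rightarrow> real. continuous_on UNIV f \<Longrightarrow> bounded (range f) \<Longrightarrow> integral\<^sup>L \<mu> f = integral\<^sup>L \<nu> f"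
  shows "\<mu> = \<nu>"
proof -
  interpret M: prob_space \<mu> using borel_prob_measuresD[OF \<mu>] by simp
  interpret N: prob_space \<nu> using borel_prob_measuresD[OF \<nu>] by simp
  have closed_eq: "measure \<mu> C = measure \<nu> C" if C: "closed C" "C \<noteq> {}" for C
  proof -
    define f where "f k x = max 0 (1 - real k * infdist x C)" for k x
    have fc: "continuous_on UNIV (f k)" for k unfolding f_def by (intro continuous_intros)
    have f01: "0 \<le> f k x" "f k x \<le> 1" for k x unfolding f_def using infdist_nonneg[of x C] by auto
    have lim: "(\<lambda>k. f k x) \<longlonglongrightarrow> indicator C x" for x
    proof (cases "x \<in> C")
      case True
      then show ?thesis by (simp add: f_def)
    next
      case False
      then have "infdist x C > 0" using C by (metis in_closed_iff_infdist_zero infdist_nonneg less_eq_real_def)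
      obtain k0 :: nat where k0: "1 / infdist x C < real k0" using reals_Archimedean2 by blast
      have "f k x = 0" if "k \<ge> k0" for k
      proof -
        have "1 < real k0 * infdist x C" using k0 \<open>infdist x C > 0\<close> by (simp add: divide_simps)
        also have "\<dots> \<le> real k * infdist x C" using that \<open>infdist x C > 0\<close> by (intro mult_right_mono) auto
        finally show ?thesis by (simp add: f_def)
      qed
      then show ?thesis using False by (intro tendsto_eventually) (auto simp: eventually_sequentially)
    qed
    have conv: "(\<lambda>k. integral\<^sup>L \<rho> (f k)) \<longlonglongrightarrow> measure \<rho> C" if \<rho>: "\<rho> \<in> borel_prob_measures" for \<rho>
    proof -
      note [measurable_cong] = borel_prob_measuresD(2)[OF \<rho>]
      interpret prob_space \<rho> using borel_prob_measuresD[OF \<rho>] by simp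
      have [measurable]: "f k \<in> borel_measurable borel" for k by (rule borel_measurable_continuous_onI[OF fc])
      have [measurable]: "C \<in> sets borel" using C by simp
      have "(\<lambda>k. integral\<^sup>L \<rho> (f k)) \<longlonglongrightarrow> integral\<^sup>L \<rho> (indicator C)"
        by (rule integral_dominated_convergence[where w = "\<lambda>_. 1"]) (use lim f01 in auto)
      then show ?thesis using sets_eq_imp_space_eq[OF borel_prob_measuresD(2)[OF \<rho>]] by simp
    qed
    have "integral\<^sup>L \<mu> (f k) = integral\<^sup>L \<nu> (f k)" for k
      by (rule eq[OF fc]) (auto simp: bounded_iff abs_le_iff intro!: exI[of _ 1] f01 order_trans[OF _ f01(1)])
    then show ?thesis using LIMSEQ_unique[OF conv[OF \<mu>]] conv[OF \<nu>] by simp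
  qed
  show ?thesis
  proof (rule measure_eqI_generator_eq[where E = "Collect closed" and \<Omega> = UNIV and A = "\<lambda>_. UNIV"])
    show "Int_stable (Collect closed :: 'a set set)" by (auto simp: Int_stable_def)
    show "sets \<mu> = sigma_sets UNIV (Collect closed)" "sets \<nu> = sigma_sets UNIV (Collect closed)"
      using borel_prob_measuresD(2)[OF \<mu>] borel_prob_measuresD(2)[OF \<nu>] by (simp_all add: borel_eq_closed)
    fix C :: "'a set" assume "C \<in> Collect closed"
    then show "emeasure \<mu> C = emeasure \<nu> C"
      using closed_eq[of C] by (cases "C = {}") (auto simp: M.emeasure_eq_measure N.emeasure_eq_measure)
  qed (auto simp: M.emeasure_eq_measure)
qed

lemma prob_measure_eqI_moments:
  fixes \<mu> \<nu> :: "'a::euclidean_space measure"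
  assumes \<mu>: "\<mu> \<in> borel_prob_measures" and \<nu>: "\<nu> \<in> borel_prob_measures"
    and eq: "\<And>\<alpha>. set \<alpha> \<subseteq> Basis \<Longrightarrow> moment \<mu> \<alpha> = moment \<nu> \<alpha>"
  shows "\<mu> = \<nu>"
proof (rule measure_eqI_bounded_continuous[OF \<mu> \<nu>])
  have "weakly_converges (\<lambda>_. \<mu>) \<nu>"
    by (rule moments_converge_imp_weakly_converges[OF \<mu> \<nu>]) (simp add: moments_converge_def eq)
  then show "integral\<^sup>L \<mu> f = integral\<^sup>L \<nu> f" if "continuous_on UNIV f" "bounded (range f)" for f :: "'a \<Rightarrow> real"
    using that unfolding weakly_converges_def by (metis LIMSEQ_const_iff)
qed

lemma moment_Nil: "\<mu> \<in> borel_prob_measures \<Longrightarrow> moment \<mu> [] = 1"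
  using prob_space.prob_space[of \<mu>] by (auto simp: moment_def monomial_def borel_prob_measures_def)

text \<open>The empty word, whose moment is not seen by the discrepancy, is the total mass.\<close>

lemma discrepancy_tendsto_0_imp_moments_converge:
  fixes \<mu> :: "'a::euclidean_space measure"
  assumes \<nu>: "\<And>n. \<nu> n \<in> borel_prob_measures" and \<mu>: "\<mu> \<in> borel_prob_measures"
    and r: "0 < r" "r < 1" and lim: "(\<lambda>n. discrepancy r (\<nu> n) \<mu>) \<longlonglongrightarrow> 0"
  shows "moments_converge \<nu> \<mu>"
  unfolding moments_converge_def
proof (intro allI impI)
  fix \<alpha> :: "('a \<times> real) list" assume \<alpha>: "set \<alpha> \<subseteq> Basis"
  show "(\<lambda>n. moment (\<nu> n) \<alpha>) \<longlonglongrightarrow> moment \<mu> \<alpha>"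
  proof (cases \<alpha>)
    case Nil
    then show ?thesis by (simp add: moment_Nil[OF \<nu>] moment_Nil[OF \<mu>])
  next
    case (Cons b \<beta>)
    define j where "j = length \<beta>"
    have "\<alpha> \<in> words (Suc j)" using \<alpha> Cons by (simp add: words_def j_def)
    note le = moment_diff_le_discrepancy[OF \<nu> \<mu> r this]
    have "(\<lambda>n. 2 * real (Suc j) / r ^ Suc j * discrepancy r (\<nu> n) \<mu>) \<longlonglongrightarrow> 0"
      by (rule tendsto_mult_right_zero[OF lim])
    then have "(\<lambda>n. (moment (\<nu> n) \<alpha> - moment \<mu> \<alpha>)\<^sup>2) \<longlonglongrightarrow> 0"
      by (rule tendsto_sandwich[OF _ _ tendsto_const, rotated 2]) (use le in auto)
    from tendsto_real_sqrt[OF this] have "(\<lambda>n. moment (\<nu> n) \<alpha> - moment \<mu> \<alpha>) \<longlonglongrightarrow> 0"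
      by (simp add: tendsto_rabs_zero_iff)
    then show ?thesis by (simp add: LIM_zero_iff)
  qed
qed

lemma discrepancy_eq_0_imp_eq:
  fixes \<mu> :: "'a::euclidean_space measure"
  assumes \<nu>: "\<nu> \<in> borel_prob_measures" and \<mu>: "\<mu> \<in> borel_prob_measures"
    and r: "0 < r" "r < 1" and "discrepancy r \<nu> \<mu> = 0"
  shows "\<nu> = \<mu>"
proof (rule prob_measure_eqI_moments[OF \<nu> \<mu>])
  have "moments_converge (\<lambda>_. \<nu>) \<mu>"
    by (rule discrepancy_tendsto_0_imp_moments_converge[OF \<nu> \<mu> r]) (use assms in simp)
  then show "moment \<nu> \<alpha> = moment \<mu> \<alpha>" if "set \<alpha> \<subseteq> Basis" for \<alpha>
    using that unfolding moments_converge_def by (metis LIMSEQ_const_iff)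
qed

section \<open>Almost sure representation of measures on a compact set\<close>

lemma geometric_tail_third:
  fixes e :: "nat \<Rightarrow> real"
  assumes "\<And>k. \<bar>e k\<bar> \<le> 2"
  shows "summable (\<lambda>k. e k / 3 ^ k)" "\<bar>\<Sum>k. e k / 3 ^ k\<bar> \<le> 3"
proof -
  have g: "(\<lambda>k. 2 * (1 / 3) ^ k) sums (2 * (1 / (1 - 1 / 3 :: real)))"
    by (intro sums_mult geometric_sums) auto
  have le: "norm (e k / 3 ^ k) \<le> 2 * (1 / 3) ^ k" for k
    using assms[of k] by (simp add: abs_divide power_divide divide_simps)
  show s: "summable (\<lambda>k. e k / 3 ^ k)"
    by (rule summable_comparison_test'[where N = 0, OF sums_summable[OF g]]) (rule le)
  have sn: "summable (\<lambda>k. norm (e k / 3 ^ k))"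
    by (rule summable_comparison_test'[where N = 0, OF sums_summable[OF g]]) (use le in auto)
  have "norm (\<Sum>k. e k / 3 ^ k) \<le> (\<Sum>k. norm (e k / 3 ^ k))" by (rule summable_norm[OF sn])
  also have "\<dots> \<le> (\<Sum>k. 2 * (1 / 3) ^ k)" by (rule suminf_le[OF le sn sums_summable[OF g]])
  also have "\<dots> = 3" using sums_unique[OF g] by simp
  finally show "\<bar>\<Sum>k. e k / 3 ^ k\<bar> \<le> 3" by simp
qed

text \<open>A first difference in digit \<open>k\<close> contributes at least \<open>2 / 3^k\<close>, and all later digits together
  change the value by at most \<open>1 / 3^k\<close>; so nearby points of the Cantor set share their first digits.\<close>

lemma ternary_digits_agree:
  fixes a b :: "nat \<Rightarrow> real"
  assumes a: "\<And>k. a k \<in> {0, 2}" and b: "\<And>k. b k \<in> {0, 2}"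
    and lt: "\<bar>(\<Sum>k. a k / 3 ^ k) - (\<Sum>k. b k / 3 ^ k)\<bar> < 1 / 3 ^ n"
  shows "k \<le> n \<Longrightarrow> a k = b k"
proof (induction k rule: less_induct)
  case (less k)
  have a2: "\<bar>a j\<bar> \<le> 2" and b2: "\<bar>b j\<bar> \<le> 2" for j using a[of j] b[of j] by auto
  define e where "e j = a j - b j" for j
  have e: "\<bar>e j\<bar> \<le> 2" for j unfolding e_def using a[of j] b[of j] by auto
  have e0: "e j = 0" if "j < k" for j unfolding e_def using less that by auto
  have "(\<Sum>j. a j / 3 ^ j) - (\<Sum>j. b j / 3 ^ j) = (\<Sum>j. e j / 3 ^ j)"
    unfolding e_def diff_divide_distrib 
    by (rule suminf_diff; rule geometric_tail_third(1)) (use a2 b2 in auto)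
  also have "\<dots> = (\<Sum>j. e (j + Suc k) / 3 ^ (j + Suc k)) + (\<Sum>j<Suc k. e j / 3 ^ j)"
    by (rule suminf_split_initial_segment) (rule geometric_tail_third(1)[OF e])
  also have "(\<Sum>j<Suc k. e j / 3 ^ j) = e k / 3 ^ k" using e0 by simp
  also have "(\<Sum>j. e (j + Suc k) / 3 ^ (j + Suc k)) = 1 / 3 ^ Suc k * (\<Sum>j. e (j + Suc k) / 3 ^ j)"
    by (subst suminf_mult[symmetric]) 
       (auto intro!: geometric_tail_third(1) e simp: power_add field_simps)
  finally have eq: "(\<Sum>j. a j / 3 ^ j) - (\<Sum>j. b j / 3 ^ j) = 
      1 / 3 ^ k * (e k + 1 / 3 * (\<Sum>j. e (j + Suc k) / 3 ^ j))"
    by (simp add: field_simps)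
  have t: "\<bar>\<Sum>j. e (j + Suc k) / 3 ^ j\<bar> \<le> 3" by (rule geometric_tail_third(2)) (rule e)
  show ?case
  proof (rule ccontr)
    assume "a k \<noteq> b k"
    then have "\<bar>e k\<bar> = 2" using a[of k] b[of k] by (auto simp: e_def)
    then have "1 \<le> \<bar>e k + 1 / 3 * (\<Sum>j. e (j + Suc k) / 3 ^ j)\<bar>" using t by linarith
    then have "1 / 3 ^ k \<le> \<bar>(\<Sum>j. a j / 3 ^ j) - (\<Sum>j. b j / 3 ^ j)\<bar>"
      unfolding eq by (simp add: abs_mult divide_right_mono)
    moreover have "1 / 3 ^ n \<le> (1 / 3 ^ k :: real)" using less.prems by (intro divide_left_mono) auto
    ultimately show False using lt by linarith
  qed
qed

text \<open>A point is coded by the ternary number whose digits record to which sets of a countable basis it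
  belongs. Compactness makes the decoding uniformly continuous: finitely many small basis sets cover
  the set, so agreement of the first digits forces two points into a common small set. Decoding therefore
  extends continuously to the closure of the codes and, by Tietze, to the whole line. This transfers
  questions about laws on a compact set to laws on the line.\<close>

lemma borel_coding_of_compact:
  fixes K :: "'b::euclidean_space set"
  assumes "compact K"
  obtains c :: "'b \<Rightarrow> real" and \<phi> :: "real \<Rightarrow> 'b"
  where "c \<in> borel_measurable borel" "\<And>p. \<bar>c p\<bar> \<le> 3"
    "continuous_on UNIV \<phi>" "\<And>p. p \<in> K \<Longrightarrow> \<phi> (c p) = p"
proof -
  obtain \<B> :: "'b set set" where \<B>: "countable \<B>" "topological_basis \<B>"
    using ex_countable_basis by blast
  have "\<B> \<noteq> {}" using \<B>(2) by (metis UNIV_I empty_iff open_UNIV topological_basisE)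
  define U where "U = from_nat_into \<B>"
  have rU: "range U = \<B>" unfolding U_def using \<open>\<B> \<noteq> {}\<close> \<B>(1) by simp
  have openU: "open (U k)" for k using rU \<B>(2) by (metis rangeI topological_basis_open)
  define d where "d p k = 2 * indicat_real (U k) p" for p k
  \<comment> \<open>Digit 2 records membership in the basis set, digit 0 the opposite.\<close>
  define c where "c p = (\<Sum>k. d p k / 3 ^ k)" for p
  have d: "d p k \<in> {0, 2}" for p k by (auto simp: d_def indicator_def)
  then have d2: "\<bar>d p k\<bar> \<le> 2" for p k by (auto simp: d_def indicator_def)
  have [measurable]: "U k \<in> sets borel" for k using openU by simp
  have meas: "c \<in> borel_measurable borel" unfolding c_def d_def by measurable
  have close: "\<exists>\<delta>>0. \<forall>p\<in>K. \<forall>q\<in>K. \<bar>c p - c q\<bar> < \<delta> \<longrightarrow> dist p q < \<epsilon>" if "\<epsilon> > 0" for \<epsilon>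
  proof -
    have "\<exists>k. p \<in> U k \<and> U k \<subseteq> ball p (\<epsilon> / 2)" for p
    proof -
      have "open (ball p (\<epsilon> / 2))" "p \<in> ball p (\<epsilon> / 2)" using that by auto
      from topological_basisE[OF \<B>(2) this]
      obtain B where "B \<in> \<B>" "p \<in> B" "B \<subseteq> ball p (\<epsilon> / 2)" .
      then show ?thesis using rU by blast
    qed
    then obtain k where k: "\<And>p. p \<in> U (k p)" "\<And>p. U (k p) \<subseteq> ball p (\<epsilon> / 2)" by metis
    obtain C where C: "C \<subseteq> K" "finite C" "K \<subseteq> (\<Union>p\<in>C. U (k p))"
      using compactE_image[OF \<open>compact K\<close>, of K "\<lambda>p. U (k p)"] openU k(1) by blast
    define n where "n = Max (k ` C)"
    show ?thesis
    proof (intro exI[of _ "1 / 3 ^ n"] conjI ballI impI)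
      fix p q assume "p \<in> K" "q \<in> K" and pq: "\<bar>c p - c q\<bar> < 1 / 3 ^ n"
      then obtain x where x: "x \<in> C" "p \<in> U (k x)" using C by blast
      have "k x \<le> n" unfolding n_def using C(2) x by auto
      then have "d p (k x) = d q (k x)"
        using ternary_digits_agree[of "d p" "d q" n "k x"] d pq unfolding c_def by blast
      with x(2) have "q \<in> U (k x)" by (auto simp: d_def indicator_def split: if_splits)
      with x k(2)[of x] have "dist x p < \<epsilon> / 2" "dist x q < \<epsilon> / 2" by auto
      then show "dist p q < \<epsilon>" by (metis dist_commute dist_triangle_half_l)
    qed auto
  qed
  have inj: "inj_on c K"
  proof (rule inj_onI, rule ccontr)
    fix p q assume pq: "p \<in> K" "q \<in> K" "c p = c q" "p \<noteq> q"
    then have "dist p q > 0" by simp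
    from close[OF this] obtain \<delta> where "\<delta> > 0"
      "\<forall>p'\<in>K. \<forall>q'\<in>K. \<bar>c p' - c q'\<bar> < \<delta> \<longrightarrow> dist p' q' < dist p q" by blast
    then have "dist p q < dist p q" using pq by (metis abs_zero diff_self)
    then show False by simp
  qed
  define \<psi> where "\<psi> = the_inv_into K c"
  have \<psi>: "\<psi> (c p) = p" if "p \<in> K" for p unfolding \<psi>_def by (rule the_inv_into_f_f[OF inj that])
  have "uniformly_continuous_on (c ` K) \<psi>"
    unfolding uniformly_continuous_on_def
  proof (intro allI impI)
    fix \<epsilon> :: real assume "\<epsilon> > 0"
    from close[OF this] show "\<exists>\<delta>>0. \<forall>x\<in>c ` K. \<forall>x'\<in>c ` K. dist x' x < \<delta> \<longrightarrow> dist (\<psi> x') (\<psi> x) < \<epsilon>"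
      by (auto simp: \<psi> dist_real_def)
  qed
  then obtain g where g: "uniformly_continuous_on (closure (c ` K)) g" "\<And>x. x \<in> c ` K \<Longrightarrow> \<psi> x = g x"
    by (rule uniformly_continuous_on_extension_on_closure) blast
  have cg: "continuous_on (closure (c ` K)) g" using g(1) by (rule uniformly_continuous_imp_continuous)
  have "bounded (c ` K)" unfolding bounded_iff c_def by (auto intro!: exI[of _ 3] geometric_tail_third(2) d2)
  then have "compact (g ` closure (c ` K))"
    by (intro compact_continuous_image cg) (simp add: compact_closure)
  then obtain B where "B > 0" "\<forall>y\<in>g ` closure (c ` K). norm y \<le> B"
    using compact_imp_bounded[THEN bounded_pos[THEN iffD1]] by blast
  then have B: "B \<ge> 0" "\<And>x. x \<in> closure (c ` K) \<Longrightarrow> norm (g x) \<le> B" by auto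
  obtain \<phi> where \<phi>: "continuous_on UNIV \<phi>" "\<And>x. x \<in> closure (c ` K) \<Longrightarrow> \<phi> x = g x"
  proof (rule Tietze[OF cg _ B])
    show "closedin (top_of_set UNIV) (closure (c ` K))" by simp
    fix h assume "continuous_on UNIV h" "\<And>x. x \<in> closure (c ` K) \<Longrightarrow> h x = g x"
    then show thesis by (rule that)
  qed
  show ?thesis
  proof (rule that[OF meas _ \<phi>(1)])
    show "\<bar>c p\<bar> \<le> 3" for p unfolding c_def by (rule geometric_tail_third(2)[OF d2])
    show "\<phi> (c p) = p" if "p \<in> K" for p
      using \<phi>(2)[of "c p"] g(2)[of "c p"] \<psi>[OF that] that closure_subset[of "c ` K"] by auto
  qed
qed

text \<open>The laws of the codes live on a bounded interval, hence are tight. Helly's theorem gives a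
  weakly convergent subsequence and Skorohod's theorem an almost sure representation of it, which
  is pushed forward by the continuous decoding map.\<close>

lemma skorohod_subsequence_compact:
  fixes \<mu> :: "nat \<Rightarrow> 'b::euclidean_space measure"
  assumes K: "compact K" and \<mu>: "\<And>n. prob_space (\<mu> n)" "\<And>n. sets (\<mu> n) = sets borel"
    and \<mu>K: "\<And>n. AE p in \<mu> n. p \<in> K"
  obtains s :: "nat \<Rightarrow> nat" and \<Omega> :: "real measure" and X :: "nat \<Rightarrow> real \<Rightarrow> 'b" and X' :: "real \<Rightarrow> 'b"
  where "strict_mono s" "prob_space \<Omega>" "\<And>n. X n \<in> borel_measurable \<Omega>" "X' \<in> borel_measurable \<Omega>"
    "\<And>n. distr \<Omega> borel (X n) = \<mu> (s n)" "\<And>\<omega>. \<omega> \<in> space \<Omega> \<Longrightarrow> (\<lambda>n. X n \<omega>) \<longlonglongrightarrow> X' \<omega>"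
proof -
  obtain c :: "'b \<Rightarrow> real" and \<phi> where c [measurable]: "c \<in> borel_measurable borel"
    and c3: "\<And>p. \<bar>c p\<bar> \<le> 3"
    and \<phi>: "continuous_on UNIV \<phi>" "\<And>p. p \<in> K \<Longrightarrow> \<phi> (c p) = p"
    using borel_coding_of_compact[OF K] by blast
  have [measurable]: "\<phi> \<in> borel_measurable borel" by (rule borel_measurable_continuous_onI[OF \<phi>(1)])
  define \<nu> where "\<nu> n = distr (\<mu> n) borel c" for n
  have rd: "real_distribution (\<nu> n)" for n
  proof -
    interpret prob_space "\<mu> n" by (rule \<mu>)
    have "prob_space (\<nu> n)" unfolding \<nu>_def by (rule prob_space_distr) (use \<mu> in measurable)
    then show ?thesis
      unfolding real_distribution_def real_distribution_axioms_def by (simp add: \<nu>_def)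
  qed
  have all: "measure (\<nu> n) {- 4<..4} = 1" for n
  proof -
    interpret M: prob_space "\<mu> n" by (rule \<mu>)
    have [measurable]: "c \<in> borel_measurable (\<mu> n)" using \<mu>(2)[of n] by (simp cong: measurable_cong_sets)
    have "c p \<in> {- 4<..4}" for p using c3[of p] by (auto simp: abs_le_iff)
    then have "c -` {- 4<..4} \<inter> space (\<mu> n) = space (\<mu> n)" by auto
    then show ?thesis
      unfolding \<nu>_def by (subst measure_distr) (simp_all add: M.prob_space)
  qed
  have "\<exists>a b::real. a < b \<and> (\<forall>n. measure (\<nu> n) {a<..b} > 1 - \<epsilon>)" if "\<epsilon> > 0" for \<epsilon>
    using all that by (intro exI[of _ "-4 :: real"] exI[of _ "4::real"]) simp
  then have "tight \<nu>" unfolding tight_def using rd by blast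
  from tight_imp_convergent_subsubsequence[OF this strict_mono_id]
  obtain s M where s: "strict_mono s" and M: "real_distribution M" "weak_conv_m (\<nu> \<circ> s) M"
    by (auto simp: comp_def)
  have rds: "real_distribution ((\<nu> \<circ> s) n)" for n using rd by simp
  from Skorohod[OF rds M]
  obtain \<Omega> :: "real measure" and Y :: "nat \<Rightarrow> real \<Rightarrow> real" and Y' :: "real \<Rightarrow> real"
    where \<Omega>: "prob_space \<Omega>"
      and Y0: "\<forall>n. Y n \<in> borel_measurable \<Omega>" and dY0: "\<forall>n. distr \<Omega> borel (Y n) = (\<nu> \<circ> s) n"
      and Y'0: "Y' \<in> measurable \<Omega> lborel"
      and lim0: "\<forall>\<omega>\<in>space \<Omega>. (\<lambda>n. Y n \<omega>) \<longlonglongrightarrow> Y' \<omega>"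
    by (elim exE conjE)
  have Y [measurable]: "Y n \<in> borel_measurable \<Omega>" and dY: "distr \<Omega> borel (Y n) = \<nu> (s n)" for n
    using Y0 dY0 by auto
  have [measurable]: "Y' \<in> borel_measurable \<Omega>" using Y'0 by simp
  have lim: "(\<lambda>n. Y n \<omega>) \<longlonglongrightarrow> Y' \<omega>" if "\<omega> \<in> space \<Omega>" for \<omega> using lim0 that by blast
  show ?thesis
  proof (rule that[OF s \<Omega>])
    show "(\<lambda>\<omega>. \<phi> (Y n \<omega>)) \<in> borel_measurable \<Omega>" "(\<lambda>\<omega>. \<phi> (Y' \<omega>)) \<in> borel_measurable \<Omega>" for n by measurable
    show "(\<lambda>n. \<phi> (Y n \<omega>)) \<longlonglongrightarrow> \<phi> (Y' \<omega>)" if "\<omega> \<in> space \<Omega>" for \<omega>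
      using \<phi>(1) lim[OF that] by (metis continuous_on_tendsto_compose UNIV_I eventually_sequentiallyI)
    fix n
    note [measurable_cong] = \<mu>(2)[of "s n"]
    have "distr \<Omega> borel (\<lambda>\<omega>. \<phi> (Y n \<omega>)) = distr (distr \<Omega> borel (Y n)) borel \<phi>"
      by (subst distr_distr) (auto simp: comp_def)
    also have "\<dots> = distr (\<mu> (s n)) borel (\<lambda>p. \<phi> (c p))"
      unfolding dY \<nu>_def by (subst distr_distr) (auto simp: comp_def)
    also have "\<dots> = distr (\<mu> (s n)) (\<mu> (s n)) (\<lambda>p. p)"
      by (rule distr_cong_AE) (use \<mu>K[of "s n"] \<phi>(2) \<mu> in auto)
    also have "\<dots> = \<mu> (s n)" by (rule distr_id2) simp
    finally show "distr \<Omega> borel (\<lambda>\<omega>. \<phi> (Y n \<omega>)) = \<mu> (s n)" .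
  qed
qed

section \<open>Removing the regularisation; midpoints\<close>

text \<open>Joint continuity in \<open>r\<close> and \<open>s\<close>, including divergence to infinity on the diagonal
  \<open>s = 1\<close>.\<close>

lemma tendsto_chord_kernel:
  assumes r: "r \<longlonglongrightarrow> 1" "\<And>n. 0 \<le> r n" "\<And>n. r n < 1"
    and s: "s \<longlonglongrightarrow> s'" "\<And>n. \<bar>s n\<bar> \<le> 1"
  shows "(\<lambda>n. chord_kernel (r n) (s n)) \<longlonglongrightarrow> chord_kernel 1 s'"
proof -
  have rs: "r n * s n < 1" for n using mult_less_one_of_le[OF r(2,3)] s(2)[of n] by auto
  have eq: "chord_kernel (r n) (s n) = ennreal (1 / 2 * ln ((1 + r n) / (1 - r n * s n)))" for n
    using rs[of n] by (simp add: chord_kernel_def)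
  have s': "s' \<le> 1" using s by (intro LIMSEQ_le_const2[OF s(1)]) (auto simp: abs_le_iff)
  have lim: "(\<lambda>n. 1 - r n * s n) \<longlonglongrightarrow> 1 - 1 * s'" by (intro tendsto_intros r s)
  show ?thesis
  proof (cases "s' = 1")
    case False
    with s' have "s' < 1" by auto
    then have "(\<lambda>n. 1 / 2 * ln ((1 + r n) / (1 - r n * s n))) \<longlonglongrightarrow> 1 / 2 * ln ((1 + 1) / (1 - 1 * s'))"
      by (intro tendsto_intros r s) auto
    then show ?thesis
      unfolding eq using False by (auto simp: chord_kernel_def intro: tendsto_ennrealI)
  next
    case True
    have "filterlim (\<lambda>n. 1 - r n * s n) (at_right 0) sequentially"
      using lim True rs rs[THEN less_imp_neq] by (auto simp: filterlim_at intro!: always_eventually)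
    then have "filterlim (\<lambda>n. (1 + r n) * inverse (1 - r n * s n)) at_top sequentially"
      using filterlim_compose[OF filterlim_inverse_at_top_right]
      by (intro filterlim_tendsto_pos_mult_at_top[of _ 2]) (auto intro!: tendsto_eq_intros r)
    then have "filterlim (\<lambda>n. ln ((1 + r n) / (1 - r n * s n))) at_top sequentially"
      using filterlim_compose[OF ln_at_top] by (simp add: divide_inverse)
    then have "filterlim (\<lambda>n. 1 / 2 * ln ((1 + r n) / (1 - r n * s n))) at_top sequentially"
      by (intro filterlim_tendsto_pos_mult_at_top[of _ "1/2"]) auto
    then have "(\<lambda>n. ennreal (1 / 2 * ln ((1 + r n) / (1 - r n * s n)))) \<longlonglongrightarrow> top"
      by (simp add: ennreal_tendsto_top_eq_at_top)
    then show ?thesis unfolding eq using True by (simp add: chord_kernel_def)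
  qed
qed

text \<open>Positive definiteness of the unregularised kernel, in a form that makes sense when energies are
  infinite: Fatou's lemma carries the nonnegativity of the discrepancy over to the limit.\<close>

lemma chord_energy_cross_le:
  fixes \<mu> \<nu> :: "'a::euclidean_space measure"
  assumes \<mu>: "\<mu> \<in> borel_prob_measures" and \<nu>: "\<nu> \<in> borel_prob_measures"
  defines "E \<equiv> (\<lambda>\<mu> \<nu> :: 'a measure. \<integral>\<^sup>+z. chord_kernel 1 (stereo (fst z) \<bullet> stereo (snd z)) \<partial>(\<mu> \<Otimes>\<^sub>M \<nu>))"
  shows "2 * E \<mu> \<nu> \<le> E \<mu> \<mu> + E \<nu> \<nu>"
proof -
  note [measurable_cong] = borel_prob_measuresD(2)[OF \<mu>] borel_prob_measuresD(2)[OF \<nu>]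
  let ?S = "\<lambda>z :: 'a \<times> 'a. stereo (fst z) \<bullet> stereo (snd z)"
  define r :: "nat \<Rightarrow> real" where "r n = 1 - 1 / (real n + 2)" for n
  have r: "r \<longlonglongrightarrow> 1" "0 \<le> r n" "r n < 1" for n
    unfolding r_def by real_asymp (auto simp: field_simps)
  have le: "ennreal (log_energy (r n) \<mu>' \<nu>') \<le> E \<mu>' \<nu>'"
    if "\<mu>' \<in> borel_prob_measures" "\<nu>' \<in> borel_prob_measures" for n \<mu>' \<nu>'
    unfolding E_def log_energy_eq_integral(1)[OF that r(2,3), symmetric]
    by (intro nn_integral_mono chord_kernel_le r abs_stereo_inner_le)
  have "E \<mu> \<nu> = (\<integral>\<^sup>+z. liminf (\<lambda>n. chord_kernel (r n) (?S z)) \<partial>(\<mu> \<Otimes>\<^sub>M \<nu>))"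
    unfolding E_def
    by (intro nn_integral_cong lim_imp_Liminf[symmetric] tendsto_chord_kernel r tendsto_const abs_stereo_inner_le) auto
  also have "\<dots> \<le> liminf (\<lambda>n. \<integral>\<^sup>+z. chord_kernel (r n) (?S z) \<partial>(\<mu> \<Otimes>\<^sub>M \<nu>))"
    by (rule nn_integral_liminf) measurable
  also have "\<dots> = liminf (\<lambda>n. ennreal (log_energy (r n) \<mu> \<nu>))"
    using log_energy_eq_integral(1)[OF \<mu> \<nu> r(2,3)] by simp
  also have "\<dots> \<le> (E \<mu> \<mu> + E \<nu> \<nu>) / 2"
  proof (rule Liminf_le, simp, rule always_eventually, rule allI)
    fix n
    have "2 * log_energy (r n) \<mu> \<nu> \<le> log_energy (r n) \<mu> \<mu> + log_energy (r n) \<nu> \<nu>"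
      using discrepancy_nonneg[OF \<mu> \<nu> r(2,3)] discrepancy_eq[OF \<mu> \<nu> r(2,3)] by simp
    then have "ennreal (log_energy (r n) \<mu> \<nu>) \<le> ennreal ((log_energy (r n) \<mu> \<mu> + log_energy (r n) \<nu> \<nu>) / 2)"
      by (intro ennreal_leI) simp
    also have "\<dots> = (ennreal (log_energy (r n) \<mu> \<mu>) + ennreal (log_energy (r n) \<nu> \<nu>)) / 2"
      using log_energy_eq_integral(2)[OF \<mu> \<mu> r(2,3)] log_energy_eq_integral(2)[OF \<nu> \<nu> r(2,3)]
      by (metis add_nonneg_nonneg divide_ennreal ennreal_numeral ennreal_plus zero_less_numeral zero_le_numeral)
    also have "\<dots> \<le> (E \<mu> \<mu> + E \<nu> \<nu>) / 2"
      by (intro divide_right_mono_ennreal add_mono le \<mu> \<nu>)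
    finally show "ennreal (log_energy (r n) \<mu> \<nu>) \<le> (E \<mu> \<mu> + E \<nu> \<nu>) / 2" .
  qed
  finally have "2 * E \<mu> \<nu> \<le> 2 * ((E \<mu> \<mu> + E \<nu> \<nu>) / 2)" by (intro mult_left_mono) auto
  also have "\<dots> = E \<mu> \<mu> + E \<nu> \<nu>"
    by (subst mult.commute, subst ennreal_divide_times) simp
  finally show ?thesis .
qed

text \<open>The mixture \<open>(\<mu> + \<nu>) / 2\<close>: a fair coin decides from which of the two measures to draw.\<close>

definition midpoint_measure :: "'a::euclidean_space measure \<Rightarrow> 'a measure \<Rightarrow> 'a measure" where
  "midpoint_measure \<mu> \<nu> = measure_pmf (bernoulli_pmf (1 / 2)) \<bind> (\<lambda>b. if b then \<mu> else \<nu>)"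

lemma
  fixes \<mu> \<nu> :: "'a::euclidean_space measure"
  assumes \<mu>: "\<mu> \<in> borel_prob_measures" and \<nu>: "\<nu> \<in> borel_prob_measures"
  shows midpoint_measure_in: "midpoint_measure \<mu> \<nu> \<in> borel_prob_measures"
    and nn_integral_midpoint: "f \<in> borel_measurable borel \<Longrightarrow>
      (\<integral>\<^sup>+x. f x \<partial>midpoint_measure \<mu> \<nu>) = ((\<integral>\<^sup>+x. f x \<partial>\<mu>) + (\<integral>\<^sup>+x. f x \<partial>\<nu>)) / 2"
    and moment_midpoint: "\<alpha> \<in> words j \<Longrightarrow> moment (midpoint_measure \<mu> \<nu>) \<alpha> = (moment \<mu> \<alpha> + moment \<nu> \<alpha>) / 2"
proof -
  have sub: "\<mu> \<in> space (subprob_algebra borel)" "\<nu> \<in> space (subprob_algebra borel)"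
    using borel_prob_measuresD[OF \<mu>] borel_prob_measuresD[OF \<nu>]
    by (auto simp: space_subprob_algebra prob_space_imp_subprob_space)
  have N: "(\<lambda>b. if b then \<mu> else \<nu>) \<in> measurable (measure_pmf (bernoulli_pmf (1 / 2))) (subprob_algebra borel)"
    using sub by auto
  have sets: "sets (midpoint_measure \<mu> \<nu>) = sets borel"
    unfolding midpoint_measure_def
    by (rule sets_bind) (use borel_prob_measuresD[OF \<mu>] borel_prob_measuresD[OF \<nu>] in auto)
  show nn: "(\<integral>\<^sup>+x. f x \<partial>midpoint_measure \<mu> \<nu>) = ((\<integral>\<^sup>+x. f x \<partial>\<mu>) + (\<integral>\<^sup>+x. f x \<partial>\<nu>)) / 2"
    if "f \<in> borel_measurable borel" for f :: "'a \<Rightarrow> ennreal"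
  proof -
    have "ennreal (1 / 2) = 1 / 2" by (metis divide_ennreal ennreal_1 ennreal_numeral zero_le_one zero_less_numeral)
    then show ?thesis
      unfolding midpoint_measure_def
      by (subst nn_integral_bind[OF that N]) (simp add: ennreal_times_divide add_divide_distrib_ennreal)
  qed
  have "emeasure (midpoint_measure \<mu> \<nu>) UNIV = 1"
  proof -
    have "emeasure (midpoint_measure \<mu> \<nu>) UNIV = (\<integral>\<^sup>+x. 1 \<partial>midpoint_measure \<mu> \<nu>)"
      using sets_eq_imp_space_eq[OF sets] by simp
    also have "\<dots> = 1"
      using prob_space.emeasure_space_1[OF borel_prob_measuresD(1)[OF \<mu>]]
        prob_space.emeasure_space_1[OF borel_prob_measuresD(1)[OF \<nu>]]
      by (subst nn) (auto simp: )
    finally show ?thesis .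
  qed
  then show in': "midpoint_measure \<mu> \<nu> \<in> borel_prob_measures"
    using sets sets_eq_imp_space_eq[OF sets] by (auto simp: borel_prob_measures_def intro!: prob_spaceI)
  show "moment (midpoint_measure \<mu> \<nu>) \<alpha> = (moment \<mu> \<alpha> + moment \<nu> \<alpha>) / 2" if \<alpha>: "\<alpha> \<in> words j" for \<alpha>
  proof -
    let ?m = "\<lambda>x. monomial \<alpha> (stereo x :: 'a \<times> real)"
    \<comment> \<open>The shift by one makes the integrand nonnegative, so that the mixture formula applies.\<close>
    have ge: "0 \<le> 1 + ?m x" for x using abs_monomial_le[OF _ \<alpha>, of "stereo x"] by simp
    have shift: "(\<integral>\<^sup>+x. ennreal (1 + ?m x) \<partial>\<rho>) = ennreal (1 + moment \<rho> \<alpha>)" "0 \<le> 1 + moment \<rho> \<alpha>"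
      if "\<rho> \<in> borel_prob_measures" for \<rho>
    proof -
      interpret prob_space \<rho> using borel_prob_measuresD[OF that] by simp
      have int: "integrable \<rho> (\<lambda>x. 1 + ?m x)" "(\<integral>x. 1 + ?m x \<partial>\<rho>) = 1 + moment \<rho> \<alpha>"
        using integrable_monomial_stereo[OF that \<alpha>] by (auto simp: moment_def prob_space)
      show "(\<integral>\<^sup>+x. ennreal (1 + ?m x) \<partial>\<rho>) = ennreal (1 + moment \<rho> \<alpha>)"
        using nn_integral_eq_integral[OF int(1)] ge int(2) by simp
      show "0 \<le> 1 + moment \<rho> \<alpha>" using int(2) ge by (metis Bochner_Integration.integral_nonneg)
    qed
    have "ennreal (1 + moment (midpoint_measure \<mu> \<nu>) \<alpha>) = (ennreal (1 + moment \<mu> \<alpha>) + ennreal (1 + moment \<nu> \<alpha>)) / 2"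
      using shift[OF in'] shift[OF \<mu>] shift[OF \<nu>] nn[of "\<lambda>x. ennreal (1 + ?m x)"] by simp
    also have "\<dots> = ennreal ((1 + moment \<mu> \<alpha> + (1 + moment \<nu> \<alpha>)) / 2)"
      using shift[OF \<mu>] shift[OF \<nu>]
      by (metis add_nonneg_nonneg divide_ennreal ennreal_numeral ennreal_plus zero_less_numeral zero_le_numeral)
    finally have "1 + moment (midpoint_measure \<mu> \<nu>) \<alpha> = (1 + moment \<mu> \<alpha> + (1 + moment \<nu> \<alpha>)) / 2"
      using shift[OF in'] shift[OF \<mu>] shift[OF \<nu>] by (subst (asm) ennreal_inj) auto
    then show ?thesis by (simp add: field_simps)
  qed
qed

text \<open>The parallelogram identity for the quadratic form given by the kernel.\<close>

lemma log_energy_midpoint: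
  fixes \<mu> \<nu> :: "'a::euclidean_space measure"
  assumes \<mu>: "\<mu> \<in> borel_prob_measures" and \<nu>: "\<nu> \<in> borel_prob_measures" and r: "0 \<le> r" "r < 1"
  shows "log_energy r (midpoint_measure \<mu> \<nu>) (midpoint_measure \<mu> \<nu>) + discrepancy r \<mu> \<nu> / 4 =
         (log_energy r \<mu> \<mu> + log_energy r \<nu> \<nu>) / 2"
proof -
  let ?m = "midpoint_measure \<mu> \<nu>"
  let ?t = "\<lambda>\<mu> \<nu> j. r ^ Suc j / Suc j * tensor_inner (Suc j) \<mu> \<nu>"
  have s: "?t \<mu>' \<nu>' sums suminf (?t \<mu>' \<nu>')" if "\<mu>' \<in> borel_prob_measures" "\<nu>' \<in> borel_prob_measures"
    for \<mu>' \<nu>' :: "'a measure"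
    by (rule summable_sums[OF summable_chord_series[OF r abs_tensor_inner_le[OF that]]])
  have tm: "tensor_inner j ?m ?m = tensor_inner j \<mu> \<mu> / 4 + tensor_inner j \<nu> \<nu> / 4 + tensor_inner j \<mu> \<nu> / 2" for j
    unfolding tensor_inner_def sum_divide_distrib sum.distrib[symmetric]
    by (intro sum.cong refl) (simp add: moment_midpoint[OF \<mu> \<nu>] field_simps)
  have "a * (x / 4 + y / 4 + z / 2) = 1 / 4 * (a * x) + 1 / 4 * (a * y) + 1 / 2 * (a * z)" for a x y z :: real
    by (simp add: field_simps)
  then have "?t ?m ?m j = 1 / 4 * ?t \<mu> \<mu> j + 1 / 4 * ?t \<nu> \<nu> j + 1 / 2 * ?t \<mu> \<nu> j" for j
    by (simp only: tm)
  then have "suminf (?t ?m ?m) = 1 / 4 * suminf (?t \<mu> \<mu>) + 1 / 4 * suminf (?t \<nu> \<nu>) + 1 / 2 * suminf (?t \<mu> \<nu>)"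
    using sums_unique[OF sums_add[OF sums_add[OF sums_mult[OF s[OF \<mu> \<mu>], of "1/4"] sums_mult[OF s[OF \<nu> \<nu>], of "1/4"]]
       sums_mult[OF s[OF \<mu> \<nu>], of "1/2"]]] by simp
  then show ?thesis
    unfolding discrepancy_eq[OF \<mu> \<nu> r] log_energy_def by (simp add: field_simps)
qed

section \<open>The energy of a logarithmic gas\<close>

text \<open>The third assumption is the growth condition in spherical coordinates; the constant \<open>c\<close> shifts the
  energy so that all integrands are nonnegative and can be integrated in \<^typ>\<open>ennreal\<close>.\<close>

locale log_gas =
  fixes \<beta> :: real and V :: "'a::euclidean_space \<Rightarrow> real" and c :: real
  assumes \<beta>_pos: "\<beta> > 0" and continuous_V: "continuous_on UNIV V"
    and confining: "\<And>x. 0 \<le> V x - \<beta> / 2 * ln (1 + (norm x)\<^sup>2) + c"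
    and c_nonneg: "0 \<le> c"
begin

definition confinement :: "'a \<Rightarrow> real" where
  "confinement x = V x - \<beta> / 2 * ln (1 + (norm x)\<^sup>2) + c"

lemma confinement_nonneg: "0 \<le> confinement x"
  unfolding confinement_def by (rule confining)

lemma continuous_confinement: "continuous_on UNIV confinement"
  unfolding confinement_def
  by (intro continuous_intros continuous_V) (use one_plus_norm_sq_pos in auto)

lemma measurable_confinement [measurable]: "confinement \<in> borel_measurable borel"
  by (rule borel_measurable_continuous_onI[OF continuous_confinement])

lemma measurable_V [measurable]: "V \<in> borel_measurable borel"
  by (rule borel_measurable_continuous_onI[OF continuous_V])

text \<open>At \<open>r = 1\<close> this is \<open>F_V + c\<close>, with value \<open>\<infinity>\<close> on the diagonal.\<close>

definition gas_kernel :: "real \<Rightarrow> 'a \<Rightarrow> 'a \<Rightarrow> ennreal" where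
  "gas_kernel r x y = ennreal (\<beta> / 2) * chord_kernel r (stereo x \<bullet> stereo y)
     + (ennreal (confinement x / 2) + ennreal (confinement y / 2))"

lemma measurable_gas_kernel [measurable (raw)]:
  assumes [measurable]: "f \<in> borel_measurable N" "g \<in> borel_measurable N"
  shows "(\<lambda>x. gas_kernel r (f x) (g x)) \<in> borel_measurable N"
  unfolding gas_kernel_def by measurable

lemma gas_kernel_diag: "gas_kernel 1 x x = \<infinity>"
  using \<beta>_pos by (simp add: gas_kernel_def chord_kernel_def dot_square_norm ennreal_mult_top)

lemma gas_kernel_eq:
  assumes "x \<noteq> y"
  shows "gas_kernel 1 x y = ennreal (\<beta> / 2 * ln (1 / norm (x - y)) + 1 / 2 * V x + 1 / 2 * V y + c)"
    and "0 \<le> \<beta> / 2 * ln (1 / norm (x - y)) + 1 / 2 * V x + 1 / 2 * V y + c"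
proof -
  define s where "s = stereo x \<bullet> stereo y"
  let ?a = "1 + (norm x)\<^sup>2" and ?b = "1 + (norm y)\<^sup>2"
  have pos: "?a > 0" "?b > 0" "norm (x - y) > 0"
    using one_plus_norm_sq_pos(1)[of x] one_plus_norm_sq_pos(1)[of y] assms by auto
  have s: "1 - s = 2 * (norm (x - y))\<^sup>2 / (?a * ?b)" unfolding s_def by (rule stereo_inner)
  then have "s < 1" using pos by (smt (verit) divide_pos_pos mult_pos_pos zero_less_power)
  have "2 / (1 - s) = ?a * ?b / (norm (x - y))\<^sup>2" unfolding s using pos by (simp add: field_simps)
  then have "ln (2 / (1 - s)) = ln ?a + ln ?b - 2 * ln (norm (x - y))"
    using pos by (simp add: ln_div ln_mult ln_realpow)
  then have eq: "\<beta> / 2 * (1 / 2 * ln (2 / (1 - s))) + (confinement x / 2 + confinement y / 2) =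
      \<beta> / 2 * ln (1 / norm (x - y)) + 1 / 2 * V x + 1 / 2 * V y + c"
  proof -
    have "ln (1 / norm (x - y)) = - ln (norm (x - y))" using pos by (simp add: ln_div)
    then show ?thesis
      unfolding confinement_def \<open>ln (2 / (1 - s)) = _\<close> by (simp add: field_simps)
  qed
  have ln0: "0 \<le> 1 / 2 * ln (2 / (1 - s))"
    using ln_chord_nonneg[of 1 s] abs_stereo_inner_le[of x y] \<open>s < 1\<close> by (simp add: s_def)
  have k: "chord_kernel 1 s = ennreal (1 / 2 * ln (2 / (1 - s)))"
    using \<open>s < 1\<close> by (simp add: chord_kernel_def)
  show "gas_kernel 1 x y = ennreal (\<beta> / 2 * ln (1 / norm (x - y)) + 1 / 2 * V x + 1 / 2 * V y + c)"
    unfolding eq[symmetric] gas_kernel_def s_def[symmetric] k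
    using ln0 \<beta>_pos confinement_nonneg[of x] confinement_nonneg[of y]
    by (simp add: ennreal_plus[symmetric] ennreal_mult[symmetric] del: ennreal_plus)
  show "0 \<le> \<beta> / 2 * ln (1 / norm (x - y)) + 1 / 2 * V x + 1 / 2 * V y + c"
    unfolding eq[symmetric]
    using ln0 \<beta>_pos confinement_nonneg[of x] confinement_nonneg[of y]
    by (intro add_nonneg_nonneg mult_nonneg_nonneg) auto
qed

definition mutual_energy :: "real \<Rightarrow> 'a measure \<Rightarrow> 'a measure \<Rightarrow> ennreal" where
  "mutual_energy r \<mu> \<nu> = (\<integral>\<^sup>+z. gas_kernel r (fst z) (snd z) \<partial>(\<mu> \<Otimes>\<^sub>M \<nu>))"

definition confinement_energy :: "'a measure \<Rightarrow> ennreal" where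
  "confinement_energy \<mu> = (\<integral>\<^sup>+x. ennreal (confinement x / 2) \<partial>\<mu>)"

text \<open>The negative part of \<open>F_V\<close> is at most \<open>c\<close>, hence integrable, so the positive and negative parts can be
  compared by integrating the identity \<open>F\<^sup>+ + c = (F + c) + F\<^sup>-\<close>.\<close>

lemma energy_eq:
  assumes \<mu>: "\<mu> \<in> borel_prob_measures"
  shows "energy \<beta> V \<mu> = enn2ereal (mutual_energy 1 \<mu> \<mu>) - ereal c"
proof -
  note [measurable_cong] = borel_prob_measuresD(2)[OF \<mu>]
  interpret \<mu>: prob_space \<mu> using borel_prob_measuresD[OF \<mu>] by simp
  interpret pair_prob_space \<mu> \<mu> ..
  define F where "F z = energy_kernel \<beta> V (fst z) (snd z)" for z
  have [measurable]: "F \<in> borel_measurable (borel \<Otimes>\<^sub>M borel)"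
    unfolding F_def energy_kernel_def by measurable
  have point: "e2ennreal (F z) + ennreal c = gas_kernel 1 (fst z) (snd z) + e2ennreal (- F z)" for z
  proof (cases "fst z = snd z")
    case True
    then show ?thesis using gas_kernel_diag by (simp add: F_def energy_kernel_def)
  next
    case False
    define v where "v = \<beta> / 2 * ln (1 / norm (fst z - snd z)) + 1 / 2 * V (fst z) + 1 / 2 * V (snd z)"
    have F: "F z = ereal v" using False by (simp add: F_def energy_kernel_def v_def)
    have G: "gas_kernel 1 (fst z) (snd z) = ennreal (v + c)" "0 \<le> v + c"
      using gas_kernel_eq[OF False] by (simp_all add: v_def)
    show ?thesis
    proof (cases "v \<ge> 0")
      case True
      then show ?thesis unfolding F G using c_nonneg
        by (simp add: e2ennreal_ereal e2ennreal_neg ennreal_neg ennreal_plus[symmetric] del: ennreal_plus)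
    next
      case False
      then show ?thesis unfolding F G using G(2)
        by (simp add: ennreal_neg ennreal_plus[symmetric] del: ennreal_plus)
    qed
  qed
  define P where "P = (\<integral>\<^sup>+z. e2ennreal (F z) \<partial>(\<mu> \<Otimes>\<^sub>M \<mu>))"
  define N where "N = (\<integral>\<^sup>+z. e2ennreal (- F z) \<partial>(\<mu> \<Otimes>\<^sub>M \<mu>))"
  have "P + ennreal c = (\<integral>\<^sup>+z. e2ennreal (F z) + ennreal c \<partial>(\<mu> \<Otimes>\<^sub>M \<mu>))"
    unfolding P_def by (subst nn_integral_add) (auto simp: P.emeasure_space_1)
  also have "\<dots> = mutual_energy 1 \<mu> \<mu> + N"
    unfolding point mutual_energy_def N_def by (rule nn_integral_add) auto
  finally have PN: "P + ennreal c = mutual_energy 1 \<mu> \<mu> + N" .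
  have "e2ennreal (- F z) \<le> ennreal c" for z
  proof (cases "fst z = snd z")
    case False
    then show ?thesis using gas_kernel_eq(2)[OF False]
      by (simp add: F_def energy_kernel_def e2ennreal_ereal) (intro ennreal_leI, linarith)
  qed (simp add: F_def energy_kernel_def e2ennreal_neg)
  then have "N \<le> (\<integral>\<^sup>+z. ennreal c \<partial>(\<mu> \<Otimes>\<^sub>M \<mu>))" unfolding N_def by (intro nn_integral_mono)
  then have "N \<le> ennreal c" by (simp add: P.emeasure_space_1)
  then have "N < \<infinity>" by (rule le_less_trans) simp
  then obtain n where n: "N = ennreal n" "n \<ge> 0" by (cases N) auto
  have "energy \<beta> V \<mu> = enn2ereal P - enn2ereal N"
    unfolding energy_def ereal_integral_def P_def N_def F_def by (simp add: case_prod_beta')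
  also have "\<dots> = enn2ereal (mutual_energy 1 \<mu> \<mu>) - ereal c"
  proof (cases "mutual_energy 1 \<mu> \<mu>")
    case (real g)
    with PN n have "P < \<infinity>" by (auto simp: top.not_eq_extremum[symmetric] ennreal_plus[symmetric] simp del: ennreal_plus)
    then obtain p where p: "P = ennreal p" "p \<ge> 0" by (cases P) auto
    have "ennreal (p + c) = ennreal (g + n)" using PN p n real c_nonneg by simp
    then have "p + c = g + n" using p n real c_nonneg by (subst (asm) ennreal_inj) auto
    then show ?thesis using p n real by (simp add: enn2ereal_ennreal)
  next
    case top
    with PN have "P = \<infinity>" by (cases P) auto
    then show ?thesis using top n by (simp add: enn2ereal_ennreal)
  qed
  finally show ?thesis .
qed

lemma mutual_energy_split:
  assumes \<mu>: "\<mu> \<in> borel_prob_measures" and \<nu>: "\<nu> \<in> borel_prob_measures"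
  shows "mutual_energy r \<mu> \<nu> =
    ennreal (\<beta> / 2) * (\<integral>\<^sup>+z. chord_kernel r (stereo (fst z) \<bullet> stereo (snd z)) \<partial>(\<mu> \<Otimes>\<^sub>M \<nu>))
      + (confinement_energy \<mu> + confinement_energy \<nu>)"
proof -
  note [measurable_cong] = borel_prob_measuresD(2)[OF \<mu>] borel_prob_measuresD(2)[OF \<nu>]
  interpret \<mu>: prob_space \<mu> using borel_prob_measuresD[OF \<mu>] by simp
  interpret \<nu>: prob_space \<nu> using borel_prob_measuresD[OF \<nu>] by simp
  interpret pair_prob_space \<mu> \<nu> ..
  have 1: "(\<integral>\<^sup>+z. ennreal (confinement (fst z) / 2) \<partial>(\<mu> \<Otimes>\<^sub>M \<nu>)) = confinement_energy \<mu>"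
    unfolding confinement_energy_def
    by (subst \<nu>.nn_integral_fst[symmetric]) (auto simp: \<nu>.emeasure_space_1)
  have 2: "(\<integral>\<^sup>+z. ennreal (confinement (snd z) / 2) \<partial>(\<mu> \<Otimes>\<^sub>M \<nu>)) = confinement_energy \<nu>"
    unfolding confinement_energy_def
    by (subst \<nu>.nn_integral_fst[symmetric]) (auto simp: \<mu>.emeasure_space_1)
  show ?thesis
    unfolding mutual_energy_def gas_kernel_def 1[symmetric] 2[symmetric]
    by (subst nn_integral_add nn_integral_cmult, measurable)+
qed

lemma mutual_energy_regular:
  assumes "\<mu> \<in> borel_prob_measures" "\<nu> \<in> borel_prob_measures" "0 \<le> r" "r < 1"
  shows "mutual_energy r \<mu> \<nu> =
    ennreal (\<beta> / 2 * log_energy r \<mu> \<nu>) + (confinement_energy \<mu> + confinement_energy \<nu>)"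
  unfolding mutual_energy_split[OF assms(1,2)] log_energy_eq_integral(1)[OF assms]
  using log_energy_eq_integral(2)[OF assms] \<beta>_pos by (subst ennreal_mult) auto

lemma mutual_energy_mono:
  assumes "0 \<le> r" "r < 1"
  shows "mutual_energy r \<mu> \<nu> \<le> mutual_energy 1 \<mu> \<nu>"
  unfolding mutual_energy_def gas_kernel_def
  by (intro nn_integral_mono add_mono mult_left_mono chord_kernel_le assms abs_stereo_inner_le) auto

lemma mutual_energy_cross_le:
  assumes \<mu>: "\<mu> \<in> borel_prob_measures" and \<nu>: "\<nu> \<in> borel_prob_measures"
  shows "2 * mutual_energy 1 \<mu> \<nu> \<le> mutual_energy 1 \<mu> \<mu> + mutual_energy 1 \<nu> \<nu>"
proof -
  let ?E = "\<lambda>\<mu> \<nu> :: 'a measure. \<integral>\<^sup>+z. chord_kernel 1 (stereo (fst z) \<bullet> stereo (snd z)) \<partial>(\<mu> \<Otimes>\<^sub>M \<nu>)"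
  have two: "2 * x = x + x" for x :: ennreal by (simp add: mult_2)
  have "2 * mutual_energy 1 \<mu> \<nu> = ennreal (\<beta> / 2) * (2 * ?E \<mu> \<nu>)
      + (confinement_energy \<mu> + confinement_energy \<mu> + (confinement_energy \<nu> + confinement_energy \<nu>))"
    unfolding mutual_energy_split[OF \<mu> \<nu>] two by (simp only: distrib_left ac_simps)
  also have "\<dots> \<le> ennreal (\<beta> / 2) * (?E \<mu> \<mu> + ?E \<nu> \<nu>)
      + (confinement_energy \<mu> + confinement_energy \<mu> + (confinement_energy \<nu> + confinement_energy \<nu>))"
    by (intro add_mono mult_left_mono chord_energy_cross_le \<mu> \<nu>) auto
  also have "\<dots> = mutual_energy 1 \<mu> \<mu> + mutual_energy 1 \<nu> \<nu>"
    unfolding mutual_energy_split[OF \<mu> \<mu>] mutual_energy_split[OF \<nu> \<nu>] by (simp only: distrib_left ac_simps)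
  finally show ?thesis .
qed

text \<open>Strict convexity in quantitative form. The confinement part is affine in the measure, so it
  contributes equally to both sides, also when it is infinite.\<close>

lemma mutual_energy_midpoint:
  assumes \<mu>: "\<mu> \<in> borel_prob_measures" and \<nu>: "\<nu> \<in> borel_prob_measures" and r: "0 \<le> r" "r < 1"
  defines "m \<equiv> midpoint_measure \<mu> \<nu>"
  shows "2 * mutual_energy r m m + ennreal (\<beta> / 4 * discrepancy r \<mu> \<nu>) =
         mutual_energy r \<mu> \<mu> + mutual_energy r \<nu> \<nu>"
proof -
  have m: "m \<in> borel_prob_measures" unfolding m_def by (rule midpoint_measure_in[OF \<mu> \<nu>])
  have two: "2 * x = x + x" for x :: ennreal by (simp add: mult_2)
  have half: "2 * (x / 2) = x" for x :: ennreal
    by (subst mult.commute, subst ennreal_divide_times) simp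
  have conf: "2 * confinement_energy m = confinement_energy \<mu> + confinement_energy \<nu>"
    unfolding confinement_energy_def m_def by (subst nn_integral_midpoint[OF \<mu> \<nu>]) (auto simp: half)
  note nn = log_energy_eq_integral(2)[OF _ _ r]
  have "\<beta> * (log_energy r m m + discrepancy r \<mu> \<nu> / 4) = \<beta> * ((log_energy r \<mu> \<mu> + log_energy r \<nu> \<nu>) / 2)"
    using log_energy_midpoint[OF \<mu> \<nu> r] unfolding m_def by simp
  then have "2 * (\<beta> / 2 * log_energy r m m) + \<beta> / 4 * discrepancy r \<mu> \<nu> =
      \<beta> / 2 * log_energy r \<mu> \<mu> + \<beta> / 2 * log_energy r \<nu> \<nu>" by (simp add: algebra_simps)
  then have "2 * ennreal (\<beta> / 2 * log_energy r m m) + ennreal (\<beta> / 4 * discrepancy r \<mu> \<nu>) =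
      ennreal (\<beta> / 2 * log_energy r \<mu> \<mu>) + ennreal (\<beta> / 2 * log_energy r \<nu> \<nu>)"
    using nn[OF m m] nn[OF \<mu> \<mu>] nn[OF \<nu> \<nu>] discrepancy_nonneg[OF \<mu> \<nu> r] \<beta>_pos
    by (simp add: two ennreal_plus[symmetric] del: ennreal_plus)
  moreover have "2 * mutual_energy r m m + ennreal (\<beta> / 4 * discrepancy r \<mu> \<nu>) =
      (2 * ennreal (\<beta> / 2 * log_energy r m m) + ennreal (\<beta> / 4 * discrepancy r \<mu> \<nu>))
      + (2 * confinement_energy m + 2 * confinement_energy m)"
    unfolding mutual_energy_regular[OF m m r] by (simp only: distrib_left ac_simps)
  ultimately show ?thesis
    unfolding conf mutual_energy_regular[OF \<mu> \<mu> r] mutual_energy_regular[OF \<nu> \<nu> r]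
    by (simp only: ac_simps)
qed

end

section \<open>Compactness of sublevel sets of the energy\<close>

lemma AE_pair_fst:
  assumes "prob_space M" "prob_space N" "AE x in M. P x"
  shows "AE z in M \<Otimes>\<^sub>M N. P (fst z)"
proof -
  have "AE x in distr (M \<Otimes>\<^sub>M N) M fst. P x"
    using assms(3) by (simp only: prob_space.distr_pair_fst[OF assms(2)])
  then show ?thesis by (rule AE_distrD[rotated]) simp
qed

lemma AE_pair_snd:
  assumes "prob_space M" "prob_space N" "AE x in N. P x"
  shows "AE z in M \<Otimes>\<^sub>M N. P (snd z)"
proof -
  interpret M: prob_space M by fact
  interpret N: prob_space N by fact
  interpret pair_sigma_finite M N ..
  interpret swap: pair_sigma_finite N M ..
  have "AE z in N \<Otimes>\<^sub>M M. P (fst z)" by (rule AE_pair_fst[OF assms(2,1,3)])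
  then have "AE z in distr (M \<Otimes>\<^sub>M N) (N \<Otimes>\<^sub>M M) (\<lambda>(x, y). (y, x)). P (fst z)"
    using swap.distr_pair_swap by metis
  from AE_distrD[OF _ this] show ?thesis by (simp add: case_prod_beta)
qed

context log_gas
begin

lemma tendsto_gas_kernel:
  assumes r: "r \<longlonglongrightarrow> 1" "\<And>n. 0 \<le> r n" "\<And>n. r n < 1"
    and x: "x \<longlonglongrightarrow> x'" and y: "y \<longlonglongrightarrow> y'"
  shows "(\<lambda>n. gas_kernel (r n) (x n) (y n)) \<longlonglongrightarrow> gas_kernel 1 x' y'"
proof -
  have st: "(\<lambda>n. stereo (z n)) \<longlonglongrightarrow> stereo z'" if "z \<longlonglongrightarrow> z'" for z :: "nat \<Rightarrow> 'a" and z'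
    using continuous_on_tendsto_compose[OF continuous_on_stereo that] by simp
  have cf: "(\<lambda>n. confinement (z n)) \<longlonglongrightarrow> confinement z'" if "z \<longlonglongrightarrow> z'" for z :: "nat \<Rightarrow> 'a" and z'
    using continuous_on_tendsto_compose[OF continuous_confinement that] by simp
  show ?thesis unfolding gas_kernel_def
    by (intro tendsto_add ennreal_tendsto_cmult tendsto_chord_kernel tendsto_ennrealI tendsto_divide
        cf x y r tendsto_const tendsto_inner st abs_stereo_inner_le) auto
qed

text \<open>The measures are realised by random points on the sphere that converge almost surely. By Fatou's
  lemma for two independent copies, the limit point equals the north pole with
  probability zero: otherwise two independent copies would meet there with positive probability, and the kernel is
  infinite on the diagonal. Hence the limit has a law on the original space, and a second
  application of Fatou's lemma bounds its energy.\<close>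

theorem energy_lsc_compactness:
  assumes \<mu>: "\<And>n. \<mu> n \<in> borel_prob_measures"
    and r: "r \<longlonglongrightarrow> 1" "\<And>n. 0 \<le> r n" "\<And>n. r n < 1"
    and bound: "\<And>n. mutual_energy (r n) (\<mu> n) (\<mu> n) \<le> M + ennreal (1 / Suc n)" and M: "M < \<infinity>"
  shows "\<exists>\<mu>'\<in>borel_prob_measures. mutual_energy 1 \<mu>' \<mu>' \<le> M"
proof -
  let ?K = "sphere (0 :: 'a \<times> real) 1"
  define law where "law n = distr (\<mu> n) borel stereo" for n
  have m_st: "stereo \<in> borel_measurable (\<mu> n)" for n
    using borel_prob_measuresD(2)[OF \<mu>[of n]] by (simp cong: measurable_cong_sets)
  have law: "prob_space (law n)" "sets (law n) = sets borel" for n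
    unfolding law_def using prob_space.prob_space_distr[OF borel_prob_measuresD(1)[OF \<mu>[of n]] m_st] by auto
  have on_K: "AE p in law n. p \<in> ?K" for n
    unfolding law_def by (subst AE_distr_iff[OF m_st]) auto
  obtain s and \<Omega> :: "real measure" and P P' where s: "strict_mono s" and \<Omega>: "prob_space \<Omega>"
    and Pm [measurable]: "\<And>n. P n \<in> borel_measurable \<Omega>" and P'm [measurable]: "P' \<in> borel_measurable \<Omega>"
    and dP: "\<And>n. distr \<Omega> borel (P n) = law (s n)"
    and lim: "\<And>\<omega>. \<omega> \<in> space \<Omega> \<Longrightarrow> (\<lambda>n. P n \<omega>) \<longlonglongrightarrow> P' \<omega>"
  proof (rule skorohod_subsequence_compact[of ?K law, OF compact_sphere law on_K])
    fix s :: "nat \<Rightarrow> nat" and \<Omega> :: "real measure" and P P'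
    assume "strict_mono s" "prob_space \<Omega>"
      and "\<And>n. P n \<in> borel_measurable \<Omega>" "P' \<in> borel_measurable \<Omega>"
      and "\<And>n. distr \<Omega> borel (P n) = law (s n)"
      and "\<And>\<omega>. \<omega> \<in> space \<Omega> \<Longrightarrow> (\<lambda>n. P n \<omega>) \<longlonglongrightarrow> P' \<omega>"
    then show thesis by (rule that)
  qed
  interpret \<Omega>: prob_space \<Omega> by fact
  interpret pair_prob_space \<Omega> \<Omega> ..
  define X where "X n \<omega> = unstereo (P n \<omega>)" for n \<omega>
  define X' where "X' \<omega> = unstereo (P' \<omega>)" for \<omega>
  have [measurable]: "X n \<in> borel_measurable \<Omega>" "X' \<in> borel_measurable \<Omega>" for n
    unfolding X_def X'_def by measurable
  have dX: "distr \<Omega> borel (X n) = \<mu> (s n)" for n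
  proof -
    note [measurable_cong] = borel_prob_measuresD(2)[OF \<mu>[of "s n"]]
    have "distr \<Omega> borel (X n) = distr (distr \<Omega> borel (P n)) borel unstereo"
      unfolding X_def by (subst distr_distr) (auto simp: comp_def)
    also have "\<dots> = distr (\<mu> (s n)) borel (\<lambda>x. x)"
      unfolding dP law_def by (subst distr_distr) (auto simp: comp_def)
    also have "\<dots> = \<mu> (s n)" by (rule distr_id2) (simp add: borel_prob_measuresD(2)[OF \<mu>])
    finally show ?thesis .
  qed
  have "AE \<omega> in \<Omega>. stereo (X n \<omega>) = P n \<omega>" for n
  proof -
    note [measurable_cong] = borel_prob_measuresD(2)[OF \<mu>[of "s n"]]
    have "AE p in law (s n). stereo (unstereo p) = p" unfolding law_def by (subst AE_distr_iff[OF m_st]) auto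
    then show ?thesis unfolding dP[symmetric] X_def by (subst (asm) AE_distr_iff) auto
  qed
  then have good: "AE \<omega> in \<Omega>. \<forall>n. stereo (X n \<omega>) = P n \<omega>" by (simp add: AE_all_countable)
  have E_n: "(\<integral>\<^sup>+z. gas_kernel (r (s n)) (X n (fst z)) (X n (snd z)) \<partial>(\<Omega> \<Otimes>\<^sub>M \<Omega>)) \<le> M + ennreal (1 / Suc n)" for n
  proof -
    have "(\<integral>\<^sup>+z. gas_kernel (r (s n)) (X n (fst z)) (X n (snd z)) \<partial>(\<Omega> \<Otimes>\<^sub>M \<Omega>)) =
      (\<integral>\<^sup>+z. gas_kernel (r (s n)) (fst z) (snd z) \<partial>(distr (\<Omega> \<Otimes>\<^sub>M \<Omega>) (borel \<Otimes>\<^sub>M borel) (\<lambda>(x, y). (X n x, X n y))))"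
      by (subst nn_integral_distr) (auto simp: case_prod_beta)
    also have "distr (\<Omega> \<Otimes>\<^sub>M \<Omega>) (borel \<Otimes>\<^sub>M borel) (\<lambda>(x, y). (X n x, X n y)) = \<mu> (s n) \<Otimes>\<^sub>M \<mu> (s n)"
      unfolding dX[symmetric]
      by (rule pair_measure_distr[symmetric])
        (auto intro!: prob_space_imp_sigma_finite \<Omega>.prob_space_distr)
    also have "(\<integral>\<^sup>+z. gas_kernel (r (s n)) (fst z) (snd z) \<partial>(\<mu> (s n) \<Otimes>\<^sub>M \<mu> (s n))) \<le> M + ennreal (1 / Suc (s n))"
      using bound[of "s n"] unfolding mutual_energy_def .
    also have "\<dots> \<le> M + ennreal (1 / Suc n)"
      using seq_suble[OF s, of n] by (intro add_left_mono ennreal_leI divide_left_mono) auto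
    finally show ?thesis .
  qed
  have limM: "liminf (\<lambda>n. M + ennreal (1 / Suc n)) = M"
  proof (rule lim_imp_Liminf)
    have "(\<lambda>n. M + ennreal (1 / Suc n)) \<longlonglongrightarrow> M + ennreal 0"
      by (intro tendsto_add tendsto_const tendsto_ennrealI) (use LIMSEQ_inverse_real_of_nat in \<open>simp add: inverse_eq_divide\<close>)
    then show "(\<lambda>n. M + ennreal (1 / Suc n)) \<longlonglongrightarrow> M" by simp
  qed simp
  have fatou: "(\<integral>\<^sup>+z. liminf (\<lambda>n. gas_kernel (r (s n)) (X n (fst z)) (X n (snd z))) \<partial>(\<Omega> \<Otimes>\<^sub>M \<Omega>)) \<le> M"
  proof -
    have "(\<integral>\<^sup>+z. liminf (\<lambda>n. gas_kernel (r (s n)) (X n (fst z)) (X n (snd z))) \<partial>(\<Omega> \<Otimes>\<^sub>M \<Omega>))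
      \<le> liminf (\<lambda>n. \<integral>\<^sup>+z. gas_kernel (r (s n)) (X n (fst z)) (X n (snd z)) \<partial>(\<Omega> \<Otimes>\<^sub>M \<Omega>))"
      by (rule nn_integral_liminf) measurable
    also have "\<dots> \<le> liminf (\<lambda>n. M + ennreal (1 / Suc n))"
      by (intro Liminf_mono always_eventually allI E_n)
    finally show ?thesis using limM by simp
  qed
  have rs: "(\<lambda>n. r (s n)) \<longlonglongrightarrow> 1" using LIMSEQ_subseq_LIMSEQ[OF r(1) s] by (simp add: comp_def)
  note good1 = AE_pair_fst[OF \<Omega> \<Omega> good] and good2 = AE_pair_snd[OF \<Omega> \<Omega> good]
  define north where "north = (0 :: 'a, 1 :: real)"
  define A where "A = {\<omega>\<in>space \<Omega>. P' \<omega> = north}"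
  have [measurable]: "A \<in> sets \<Omega>" unfolding A_def by measurable
  \<comment> \<open>No mass is lost at infinity.\<close>
  have "AE z in \<Omega> \<Otimes>\<^sub>M \<Omega>. liminf (\<lambda>n. gas_kernel (r (s n)) (X n (fst z)) (X n (snd z))) \<noteq> \<infinity>"
    by (rule nn_integral_noteq_infinite) (use fatou M in auto)
  with good1 good2 have "AE z in \<Omega> \<Otimes>\<^sub>M \<Omega>. z \<notin> A \<times> A"
  proof eventually_elim
    case (elim z)
    show ?case
    proof
      assume z: "z \<in> A \<times> A"
      then have l1: "(\<lambda>n. stereo (X n (fst z))) \<longlonglongrightarrow> north" and l2: "(\<lambda>n. stereo (X n (snd z))) \<longlonglongrightarrow> north"
        using lim[of "fst z"] lim[of "snd z"] elim(1,2) by (auto simp: A_def)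
      have "(\<lambda>n. chord_kernel (r (s n)) (stereo (X n (fst z)) \<bullet> stereo (X n (snd z)))) \<longlonglongrightarrow> chord_kernel 1 (north \<bullet> north)"
        by (intro tendsto_chord_kernel rs r tendsto_inner l1 l2 abs_stereo_inner_le)
      then have "(\<lambda>n. ennreal (\<beta> / 2) * chord_kernel (r (s n)) (stereo (X n (fst z)) \<bullet> stereo (X n (snd z)))) \<longlonglongrightarrow> ennreal (\<beta> / 2) * chord_kernel 1 (north \<bullet> north)"
        by (intro ennreal_tendsto_cmult) auto
      from lim_imp_Liminf[OF _ this] have "liminf (\<lambda>n. ennreal (\<beta> / 2) * chord_kernel (r (s n)) (stereo (X n (fst z)) \<bullet> stereo (X n (snd z)))) = \<infinity>"
        using \<beta>_pos by (simp add: chord_kernel_def north_def ennreal_mult_top)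
      moreover have "liminf (\<lambda>n. ennreal (\<beta> / 2) * chord_kernel (r (s n)) (stereo (X n (fst z)) \<bullet> stereo (X n (snd z))))
         \<le> liminf (\<lambda>n. gas_kernel (r (s n)) (X n (fst z)) (X n (snd z)))"
        unfolding gas_kernel_def by (intro Liminf_mono always_eventually allI) simp
      ultimately show False using elim(3) by (simp add: top_unique)
    qed
  qed
  then have "emeasure (\<Omega> \<Otimes>\<^sub>M \<Omega>) (A \<times> A) = 0"
    by (subst AE_iff_measurable[symmetric, where P = "\<lambda>z. z \<notin> A \<times> A" ])
       (auto dest: sets.sets_into_space simp: space_pair_measure A_def)
  then have "emeasure \<Omega> A = 0" by (subst (asm) \<Omega>.emeasure_pair_measure_Times) auto
  then have AE_A: "AE \<omega> in \<Omega>. P' \<omega> \<noteq> north"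
    by (subst AE_iff_measurable[where N = A]) (auto simp: A_def)
  from good AE_A have convX: "AE \<omega> in \<Omega>. (\<lambda>n. X n \<omega>) \<longlonglongrightarrow> X' \<omega>"
  proof (rule AE_mp[OF _ AE_mp[OF _ AE_I2]], intro impI)
    fix \<omega> assume \<omega>: "\<omega> \<in> space \<Omega>" and nn: "P' \<omega> \<noteq> north" and g: "\<forall>n. stereo (X n \<omega>) = P n \<omega>"
    have "norm (P n \<omega>) = 1" for n using g norm_stereo by metis
    then have "norm (P' \<omega>) = 1" using tendsto_norm[OF lim[OF \<omega>]] by (simp add: LIMSEQ_const_iff)
    have "snd (P' \<omega>) \<noteq> 1"
    proof
      assume 1: "snd (P' \<omega>) = 1"
      have "(norm (P' \<omega>))\<^sup>2 = (norm (fst (P' \<omega>)))\<^sup>2 + (snd (P' \<omega>))\<^sup>2"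
        by (simp add: norm_prod_def)
      then have "fst (P' \<omega>) = 0" using \<open>norm (P' \<omega>) = 1\<close> 1 by simp
      then show False using nn 1 by (simp add: north_def prod_eq_iff)
    qed
    then show "(\<lambda>n. X n \<omega>) \<longlonglongrightarrow> X' \<omega>"
      unfolding X_def X'_def unstereo_def by (intro tendsto_intros lim[OF \<omega>]) auto
  qed
  \<comment> \<open>The law of the limit point is the measure sought.\<close>
  define \<mu>' where "\<mu>' = distr \<Omega> borel X'"
  have \<mu>': "\<mu>' \<in> borel_prob_measures"
    unfolding \<mu>'_def borel_prob_measures_def by (auto intro!: \<Omega>.prob_space_distr)
  have "mutual_energy 1 \<mu>' \<mu>' = (\<integral>\<^sup>+z. gas_kernel 1 (fst z) (snd z) \<partial>(distr (\<Omega> \<Otimes>\<^sub>M \<Omega>) (borel \<Otimes>\<^sub>M borel) (\<lambda>(x, y). (X' x, X' y))))"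
    unfolding mutual_energy_def \<mu>'_def
    by (subst pair_measure_distr) (auto intro!: prob_space_imp_sigma_finite \<Omega>.prob_space_distr)
  also have "\<dots> = (\<integral>\<^sup>+z. gas_kernel 1 (X' (fst z)) (X' (snd z)) \<partial>(\<Omega> \<Otimes>\<^sub>M \<Omega>))"
    by (subst nn_integral_distr) (auto simp: case_prod_beta)
  also have "\<dots> \<le> (\<integral>\<^sup>+z. liminf (\<lambda>n. gas_kernel (r (s n)) (X n (fst z)) (X n (snd z))) \<partial>(\<Omega> \<Otimes>\<^sub>M \<Omega>))"
  proof (rule nn_integral_mono_AE)
    from AE_pair_fst[OF \<Omega> \<Omega> convX] AE_pair_snd[OF \<Omega> \<Omega> convX] show "AE z in \<Omega> \<Otimes>\<^sub>M \<Omega>. gas_kernel 1 (X' (fst z)) (X' (snd z)) \<le> liminf (\<lambda>n. gas_kernel (r (s n)) (X n (fst z)) (X n (snd z)))"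
    proof eventually_elim
      case (elim z)
      have "liminf (\<lambda>n. gas_kernel (r (s n)) (X n (fst z)) (X n (snd z))) = gas_kernel 1 (X' (fst z)) (X' (snd z))"
        by (intro lim_imp_Liminf tendsto_gas_kernel rs r elim) simp
      then show ?case by simp
    qed
  qed
  also have "\<dots> \<le> M" by (rule fatou)
  finally show ?thesis using \<mu>' by blast
qed

end

section \<open>The equilibrium measure\<close>

text \<open>A logarithmic singularity as a count of the exponentially shrinking balls that contain \<open>y\<close>, which is
  easy to integrate in every dimension. On the diagonal all balls count and both sides are infinite.\<close>

lemma chord_kernel_le_ball_count:
  fixes x y :: "'a::euclidean_space"
  assumes "norm x \<le> R" "norm y \<le> R" "R \<ge> 1"
  shows "chord_kernel 1 (stereo x \<bullet> stereo y) \<le> (\<Sum>j. indicator (ball x (2 * R\<^sup>2 * exp (- real j))) y)"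
    (is "_ \<le> ?S")
proof -
  have count: "of_nat n \<le> ?S" if "\<And>j. j < n \<Longrightarrow> dist x y < 2 * R\<^sup>2 * exp (- real j)" for n
  proof -
    have "(\<Sum>j<n. indicator (ball x (2 * R\<^sup>2 * exp (- real j))) y :: ennreal) = (\<Sum>j<n. 1)"
      by (intro sum.cong refl) (use that in auto)
    then have "of_nat n = (\<Sum>j<n. indicator (ball x (2 * R\<^sup>2 * exp (- real j))) y :: ennreal)" by simp
    also have "\<dots> \<le> ?S" by (intro sum_le_suminf) auto
    finally show ?thesis .
  qed
  have "R\<^sup>2 > 0" using assms by simp
  show ?thesis
  proof (cases "x = y")
    case True
    have "(SUP n. of_nat n) \<le> ?S"
    proof (rule SUP_least)
      fix n show "of_nat n \<le> ?S" by (rule count) (use True \<open>R\<^sup>2 > 0\<close> in simp)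
    qed
    then show ?thesis by (simp add: ennreal_SUP_of_nat_eq_top top_unique)
  next
    case False
    define d where "d = norm (x - y)"
    have d: "d > 0" using False by (simp add: d_def)
    define s where "s = stereo x \<bullet> stereo y"
    let ?a = "1 + (norm x)\<^sup>2" and ?b = "1 + (norm y)\<^sup>2"
    have pos: "?a > 0" "?b > 0" using one_plus_norm_sq_pos(1)[of x] one_plus_norm_sq_pos(1)[of y] by auto
    have s: "1 - s = 2 * d\<^sup>2 / (?a * ?b)" unfolding s_def d_def by (rule stereo_inner)
    then have s1: "s < 1" using pos d by (smt (verit) divide_pos_pos mult_pos_pos zero_less_power)
    have "(norm x)\<^sup>2 \<le> R\<^sup>2" "(norm y)\<^sup>2 \<le> R\<^sup>2" "1 \<le> R\<^sup>2"
      using assms by (auto intro!: power_mono)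
    then have ab: "?a \<le> 2 * R\<^sup>2" "?b \<le> 2 * R\<^sup>2" by linarith+
    have "2 / (1 - s) = ?a * ?b / d\<^sup>2" unfolding s using pos d by (simp add: field_simps)
    also have "\<dots> \<le> (2 * R\<^sup>2) * (2 * R\<^sup>2) / d\<^sup>2"
      using ab pos by (intro divide_right_mono mult_mono) auto
    also have "\<dots> = (2 * R\<^sup>2 / d)\<^sup>2" by (simp add: power2_eq_square)
    finally have "ln (2 / (1 - s)) \<le> ln ((2 * R\<^sup>2 / d)\<^sup>2)" using s1 by (intro ln_mono) auto
    also have "\<dots> = 2 * ln (2 * R\<^sup>2 / d)" using d \<open>R\<^sup>2 > 0\<close> by (subst ln_realpow) auto
    finally have le: "1 / 2 * ln (2 / (1 - s)) \<le> ln (2 * R\<^sup>2 / d)" by simp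
    define n where "n = nat \<lceil>ln (2 * R\<^sup>2 / d)\<rceil>"
    have "chord_kernel 1 s \<le> ennreal (ln (2 * R\<^sup>2 / d))"
      using s1 le by (auto simp: chord_kernel_def intro!: ennreal_leI)
    also have "\<dots> \<le> ennreal (real n)" unfolding n_def by (intro ennreal_leI) linarith
    also have "\<dots> = of_nat n" by (simp add: ennreal_of_nat_eq_real_of_nat)
    also have "\<dots> \<le> ?S"
    proof (rule count)
      fix j assume "j < n"
      then have "real j < ln (2 * R\<^sup>2 / d)" unfolding n_def by linarith
      then have "exp (real j) < 2 * R\<^sup>2 / d" using d \<open>R\<^sup>2 > 0\<close> by (metis divide_pos_pos exp_less_cancel_iff exp_ln zero_less_mult_iff zero_less_numeral)
      then have "d < 2 * R\<^sup>2 * exp (- real j)" using d by (simp add: exp_minus field_simps)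
      then show "dist x y < 2 * R\<^sup>2 * exp (- real j)" by (simp add: d_def dist_norm)
    qed
    finally show ?thesis by (simp add: s_def)
  qed
qed

context log_gas
begin

text \<open>The uniform distribution on the unit ball has finite energy, since the volumes of the balls
  in \<open>chord_kernel_le_ball_count\<close> are summable.\<close>

lemma finite_energy_exists: "\<exists>\<mu>\<in>borel_prob_measures. mutual_energy 1 \<mu> \<mu> < \<infinity>"
proof -
  let ?B = "cball (0 :: 'a) 1" and ?n = "DIM('a)"
  define b where "b = unit_ball_vol (real ?n)"
  have b: "b > 0" unfolding b_def by simp
  have eB: "emeasure lborel ?B = ennreal b" by (simp add: emeasure_cball b_def)
  define \<mu> where "\<mu> = uniform_measure lborel ?B"
  have \<mu>: "\<mu> \<in> borel_prob_measures"
    unfolding \<mu>_def borel_prob_measures_def using b by (auto intro!: prob_space_uniform_measure simp: eB)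
  note [measurable_cong] = borel_prob_measuresD(2)[OF \<mu>]
  interpret U: prob_space \<mu> using borel_prob_measuresD[OF \<mu>] by simp
  interpret pair_prob_space \<mu> \<mu> ..
  have AE_B: "AE x in \<mu>. x \<in> ?B" unfolding \<mu>_def by (rule AE_uniform_measureI) auto
  have "bounded (confinement ` ?B)"
    by (intro compact_imp_bounded compact_continuous_image continuous_on_subset[OF continuous_confinement]) auto
  then obtain C where "\<forall>x\<in>?B. \<bar>confinement x\<bar> \<le> C" by (auto simp: bounded_iff)
  then have C: "confinement x \<le> C" if "x \<in> ?B" for x using that by (meson abs_le_D1)
  have "confinement_energy \<mu> \<le> (\<integral>\<^sup>+x. ennreal (C / 2) \<partial>\<mu>)"
    unfolding confinement_energy_def
  proof (rule nn_integral_mono_AE, use AE_B in eventually_elim)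
    case (elim x)
    then show ?case using C[of x] by (intro ennreal_leI) simp
  qed
  then have conf: "confinement_energy \<mu> < \<infinity>" by (simp add: U.emeasure_space_1 le_less_trans[OF _ ennreal_less_top])
  have em: "emeasure \<mu> (ball x (2 * exp (- real j))) \<le> ennreal (2 ^ ?n * exp (- real j))" for x j
  proof -
    have "emeasure \<mu> (ball x (2 * exp (- real j))) \<le> emeasure lborel (ball x (2 * exp (- real j))) / ennreal b"
      unfolding \<mu>_def by (subst emeasure_uniform_measure) (auto simp: eB intro!: divide_right_mono_ennreal emeasure_mono)
    also have "\<dots> = ennreal (2 ^ ?n * exp (- real j) ^ ?n)"
      using b by (simp add: emeasure_ball b_def[symmetric] divide_ennreal power_mult_distrib)
    also have "\<dots> \<le> ennreal (2 ^ ?n * exp (- real j))"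
      by (intro ennreal_leI mult_left_mono) (use power_decreasing[of 1 ?n "exp (- real j)"] in \<open>auto simp: DIM_positive Suc_leI\<close>)
    finally show ?thesis .
  qed
  have fin: "(\<Sum>j. ennreal (2 ^ ?n * exp (- real j))) < \<infinity>"
  proof -
    have "summable (\<lambda>j. 2 ^ ?n * exp (- 1 :: real) ^ j)" by (intro summable_mult summable_geometric) simp
    then have "summable (\<lambda>j. 2 ^ ?n * exp (- real j))" by (simp add: exp_of_nat_mult[symmetric])
    then show ?thesis by (subst suminf_ennreal2) auto
  qed
  have "(\<integral>\<^sup>+z. chord_kernel 1 (stereo (fst z) \<bullet> stereo (snd z)) \<partial>(\<mu> \<Otimes>\<^sub>M \<mu>))
    = (\<integral>\<^sup>+x. \<integral>\<^sup>+y. chord_kernel 1 (stereo x \<bullet> stereo y) \<partial>\<mu> \<partial>\<mu>)"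
    by (subst U.nn_integral_fst[symmetric]) auto
  also have "\<dots> \<le> (\<integral>\<^sup>+x. (\<Sum>j. ennreal (2 ^ ?n * exp (- real j))) \<partial>\<mu>)"
  proof (rule nn_integral_mono_AE, use AE_B in eventually_elim)
    case (elim x)
    have "(\<integral>\<^sup>+y. chord_kernel 1 (stereo x \<bullet> stereo y) \<partial>\<mu>) \<le> (\<integral>\<^sup>+y. (\<Sum>j. indicator (ball x (2 * exp (- real j))) y) \<partial>\<mu>)"
      by (rule nn_integral_mono_AE, use AE_B in eventually_elim)
         (use elim chord_kernel_le_ball_count[of x 1] in auto)
    also have "\<dots> = (\<Sum>j. emeasure \<mu> (ball x (2 * exp (- real j))))"
      by (subst nn_integral_suminf)
        (auto intro!: borel_measurable_indicator suminf_cong nn_integral_indicator simp: borel_prob_measuresD(2)[OF \<mu>])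
    also have "\<dots> \<le> (\<Sum>j. ennreal (2 ^ ?n * exp (- real j)))" by (intro suminf_le em) auto
    finally show ?case .
  qed
  also have "\<dots> < \<infinity>" using fin by (simp add: U.emeasure_space_1)
  finally have "mutual_energy 1 \<mu> \<mu> < \<infinity>"
    unfolding mutual_energy_split[OF \<mu> \<mu>] using conf by (simp add: ennreal_mult_less_top)
  with \<mu> show ?thesis by blast
qed

definition min_energy :: "real \<Rightarrow> ennreal" where
  "min_energy r = (INF \<mu>\<in>borel_prob_measures. mutual_energy r \<mu> \<mu>)"

lemma min_energy_le: "\<mu> \<in> borel_prob_measures \<Longrightarrow> min_energy r \<le> mutual_energy r \<mu> \<mu>"
  unfolding min_energy_def by (rule INF_lower)

lemma min_energy_finite: "min_energy 1 < \<infinity>"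
  using finite_energy_exists min_energy_le le_less_trans by blast

lemma minimizer_exists: "\<exists>\<mu>\<in>borel_prob_measures. mutual_energy 1 \<mu> \<mu> = min_energy 1"
proof -
  define r :: "nat \<Rightarrow> real" where "r n = 1 - 1 / (real n + 2)" for n
  have r: "r \<longlonglongrightarrow> 1" "0 \<le> r n" "r n < 1" for n
    unfolding r_def by real_asymp (auto simp: field_simps)
  have "\<exists>\<mu>\<in>borel_prob_measures. mutual_energy 1 \<mu> \<mu> < min_energy 1 + ennreal (1 / Suc n)" for n
  proof -
    have "min_energy 1 < min_energy 1 + ennreal (1 / Suc n)"
      using min_energy_finite by (cases "min_energy 1") (auto simp: ennreal_plus[symmetric] ennreal_less_iff simp del: ennreal_plus)
    then show ?thesis unfolding min_energy_def by (simp add: INF_less_iff)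
  qed
  then obtain \<mu> where \<mu>: "\<And>n. \<mu> n \<in> borel_prob_measures"
    "\<And>n. mutual_energy 1 (\<mu> n) (\<mu> n) < min_energy 1 + ennreal (1 / Suc n)" by metis
  have "mutual_energy (r n) (\<mu> n) (\<mu> n) \<le> min_energy 1 + ennreal (1 / Suc n)" for n
    using mutual_energy_mono[OF r(2,3)] \<mu>(2)[of n] by (metis less_imp_le order_trans)
  from energy_lsc_compactness[OF \<mu>(1) r this min_energy_finite]
  obtain \<mu>' where "\<mu>' \<in> borel_prob_measures" "mutual_energy 1 \<mu>' \<mu>' \<le> min_energy 1" by blast
  then show ?thesis using min_energy_le by (metis antisym)
qed

text \<open>If the regularised minima stayed away from the minimum, near-minimisers of them would have a
  limit point of too small energy by \<open>energy_lsc_compactness\<close>.\<close>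

lemma min_energy_regularized:
  assumes "\<epsilon> > 0"
  shows "\<exists>r. 1 / 2 \<le> r \<and> r < 1 \<and> min_energy 1 \<le> min_energy r + ennreal \<epsilon>"
proof (rule ccontr)
  assume contra: "\<not> ?thesis"
  define r :: "nat \<Rightarrow> real" where "r n = 1 - 1 / (real n + 2)" for n
  have r: "r \<longlonglongrightarrow> 1" "1 / 2 \<le> r n" "0 \<le> r n" "r n < 1" for n
    unfolding r_def by real_asymp (auto simp: field_simps)
  obtain m where m: "min_energy 1 = ennreal m" "m \<ge> 0" using min_energy_finite by (cases "min_energy 1") auto
  have lt: "min_energy (r n) + ennreal \<epsilon> < ennreal m" for n
    using contra r(2,4)[of n] m by (metis not_le)
  have "\<exists>\<mu>\<in>borel_prob_measures. mutual_energy (r n) \<mu> \<mu> \<le> ennreal (m - \<epsilon>)" for n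
  proof -
    obtain e where e: "min_energy (r n) = ennreal e" "e \<ge> 0"
      using lt[of n] by (cases "min_energy (r n)") auto
    have "e + \<epsilon> < m" using lt[of n] e assms by (simp add: ennreal_plus[symmetric] ennreal_less_iff del: ennreal_plus)
    then have "min_energy (r n) < ennreal (m - \<epsilon>)" using e by (simp add: ennreal_less_iff)
    then show ?thesis unfolding min_energy_def by (auto simp: INF_less_iff intro: less_imp_le)
  qed
  then obtain \<mu> where \<mu>: "\<And>n. \<mu> n \<in> borel_prob_measures" "\<And>n. mutual_energy (r n) (\<mu> n) (\<mu> n) \<le> ennreal (m - \<epsilon>)"
    by metis
  have "mutual_energy (r n) (\<mu> n) (\<mu> n) \<le> ennreal (m - \<epsilon>) + ennreal (1 / Suc n)" for n
    using \<mu>(2)[of n] by (metis add_increasing2 zero_le)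
  from energy_lsc_compactness[OF \<mu>(1) r(1,3,4) this]
  obtain \<mu>' where "\<mu>' \<in> borel_prob_measures" "mutual_energy 1 \<mu>' \<mu>' \<le> ennreal (m - \<epsilon>)" by auto
  then have "ennreal m \<le> ennreal (m - \<epsilon>)" using min_energy_le m by (metis order_trans)
  moreover have "0 < m" using lt[of 0] assms by (metis add_increasing2 ennreal_eq_0_iff leD linorder_not_le m(2) not_gr_zero order_le_less zero_le)
  ultimately show False using assms by (simp add: ennreal_le_iff2)
qed

text \<open>Compare the midpoint of \<open>\<mu>\<close> and \<open>\<nu>\<close> with the regularised minimum and use the parallelogram identity.
  The regularised energy on the right-hand side is finite for empirical measures, whose
  energy is infinite; this is why the gap is needed in this form.\<close>

lemma energy_gap:
  assumes \<mu>: "\<mu> \<in> borel_prob_measures" and min: "mutual_energy 1 \<mu> \<mu> = min_energy 1"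
    and \<nu>: "\<nu> \<in> borel_prob_measures" and r: "1 / 2 \<le> r" "r < 1"
    and close: "min_energy 1 \<le> min_energy r + ennreal \<epsilon>"
  shows "min_energy 1 + ennreal (\<beta> / 4 * discrepancy (1 / 2) \<nu> \<mu>) \<le> mutual_energy r \<nu> \<nu> + 2 * ennreal \<epsilon>"
proof -
  have r0: "0 \<le> r" using r by simp
  let ?m = "midpoint_measure \<nu> \<mu>" and ?d = "ennreal (\<beta> / 4 * discrepancy r \<nu> \<mu>)"
  have two: "2 * x = x + x" for x :: ennreal by (simp add: mult_2)
  have "min_energy 1 + (min_energy 1 + ?d) \<le> (min_energy r + ennreal \<epsilon>) + ((min_energy r + ennreal \<epsilon>) + ?d)"
    by (intro add_mono close order_refl)
  also have "\<dots> = 2 * (min_energy r + ennreal \<epsilon>) + ?d" by (simp only: two add.assoc)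
  also have "\<dots> \<le> (2 * mutual_energy r ?m ?m + ?d) + 2 * ennreal \<epsilon>"
    unfolding distrib_left
    using mult_left_mono[OF min_energy_le[OF midpoint_measure_in[OF \<nu> \<mu>], of r], of 2]
    by (auto simp: ac_simps intro!: add_mono)
  also have "2 * mutual_energy r ?m ?m + ?d = mutual_energy r \<nu> \<nu> + mutual_energy r \<mu> \<mu>"
    by (rule mutual_energy_midpoint[OF \<nu> \<mu> r0 r(2)])
  also have "\<dots> + 2 * ennreal \<epsilon> \<le> min_energy 1 + (mutual_energy r \<nu> \<nu> + 2 * ennreal \<epsilon>)"
    using mutual_energy_mono[OF r0 r(2), of \<mu> \<mu>] unfolding min by (auto simp: ac_simps intro!: add_mono)
  finally have "min_energy 1 + ?d \<le> mutual_energy r \<nu> \<nu> + 2 * ennreal \<epsilon>"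
    using min_energy_finite by (auto simp: ennreal_add_left_cancel_le)
  moreover have "ennreal (\<beta> / 4 * discrepancy (1 / 2) \<nu> \<mu>) \<le> ?d"
    using discrepancy_mono[OF \<nu> \<mu> _ r] \<beta>_pos by (intro ennreal_leI mult_left_mono) auto
  ultimately show ?thesis by (meson add_left_mono order_trans)
qed

text \<open>For two minimisers \<open>energy_gap\<close> bounds their discrepancy by an arbitrarily small error.\<close>

lemma minimizer_unique:
  assumes \<mu>: "\<mu> \<in> borel_prob_measures" "mutual_energy 1 \<mu> \<mu> = min_energy 1"
    and \<nu>: "\<nu> \<in> borel_prob_measures" "mutual_energy 1 \<nu> \<nu> = min_energy 1"
  shows "\<nu> = \<mu>"
proof (rule discrepancy_eq_0_imp_eq[OF \<nu>(1) \<mu>(1), of "1 / 2"])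
  have nn: "0 \<le> discrepancy (1 / 2) \<nu> \<mu>" using \<nu> \<mu> by (intro discrepancy_nonneg) auto
  have "\<beta> / 4 * discrepancy (1 / 2) \<nu> \<mu> \<le> 0 + e" if "e > 0" for e
  proof -
    obtain r where r: "1 / 2 \<le> r" "r < 1" "min_energy 1 \<le> min_energy r + ennreal (e / 2)"
      using min_energy_regularized[of "e / 2"] \<open>e > 0\<close> by auto
    have "min_energy 1 + ennreal (\<beta> / 4 * discrepancy (1 / 2) \<nu> \<mu>) \<le> mutual_energy r \<nu> \<nu> + 2 * ennreal (e / 2)"
      by (rule energy_gap[OF \<mu> \<nu>(1) r])
    also have "\<dots> \<le> min_energy 1 + 2 * ennreal (e / 2)"
      using mutual_energy_mono[of r \<nu> \<nu>] r \<nu>(2) by (intro add_mono) auto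
    also have "2 * ennreal (e / 2) = ennreal e" using that by (simp add: mult_2 ennreal_plus[symmetric] del: ennreal_plus)
    finally have "ennreal (\<beta> / 4 * discrepancy (1 / 2) \<nu> \<mu>) \<le> ennreal e"
      using min_energy_finite by (auto simp: ennreal_add_left_cancel_le)
    then show ?thesis using that by (simp add: ennreal_le_iff)
  qed
  then have "\<beta> / 4 * discrepancy (1 / 2) \<nu> \<mu> \<le> 0" by (rule field_le_epsilon)
  then show "discrepancy (1 / 2) \<nu> \<mu> = 0"
    using nn \<beta>_pos by (smt (verit) divide_pos_pos mult_pos_pos)
qed auto

lemma energy_le_iff:
  assumes "\<mu> \<in> borel_prob_measures" "\<nu> \<in> borel_prob_measures"
  shows "energy \<beta> V \<mu> \<le> energy \<beta> V \<nu> \<longleftrightarrow> mutual_energy 1 \<mu> \<mu> \<le> mutual_energy 1 \<nu> \<nu>"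
  unfolding energy_eq[OF assms(1)] energy_eq[OF assms(2)]
  by (cases "mutual_energy 1 \<mu> \<mu>"; cases "mutual_energy 1 \<nu> \<nu>")
     (auto simp: enn2ereal_ennreal ennreal_le_iff top_unique)

lemma equilibrium_measure_minimizes:
  "equilibrium_measure \<beta> V \<in> borel_prob_measures"
  "mutual_energy 1 (equilibrium_measure \<beta> V) (equilibrium_measure \<beta> V) = min_energy 1"
proof -
  have iff: "(\<forall>\<nu>\<in>borel_prob_measures. energy \<beta> V \<mu> \<le> energy \<beta> V \<nu>) \<longleftrightarrow> mutual_energy 1 \<mu> \<mu> = min_energy 1"
    if \<mu>: "\<mu> \<in> borel_prob_measures" for \<mu>
  proof -
    have "(\<forall>\<nu>\<in>borel_prob_measures. energy \<beta> V \<mu> \<le> energy \<beta> V \<nu>) \<longleftrightarrow> mutual_energy 1 \<mu> \<mu> \<le> min_energy 1"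
      unfolding min_energy_def le_INF_iff using energy_le_iff[OF \<mu>] by blast
    then show ?thesis using min_energy_le[OF \<mu>, of 1] by auto
  qed
  have "\<exists>!\<mu>. \<mu> \<in> borel_prob_measures \<and> (\<forall>\<nu>\<in>borel_prob_measures. energy \<beta> V \<mu> \<le> energy \<beta> V \<nu>)"
    using minimizer_exists minimizer_unique iff by metis
  from theI'[OF this] have "equilibrium_measure \<beta> V \<in> borel_prob_measures \<and>
      (\<forall>\<nu>\<in>borel_prob_measures. energy \<beta> V (equilibrium_measure \<beta> V) \<le> energy \<beta> V \<nu>)"
    unfolding equilibrium_measure_def .
  then show "equilibrium_measure \<beta> V \<in> borel_prob_measures"
    "mutual_energy 1 (equilibrium_measure \<beta> V) (equilibrium_measure \<beta> V) = min_energy 1"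
    using iff by auto
qed

end

section \<open>Lower bound for the partition function: Jensen's inequality\<close>

lemma sum_symmetric_square:
  fixes g :: "nat \<Rightarrow> nat \<Rightarrow> real"
  assumes sym: "\<And>i j. g i j = g j i" and diag: "\<And>i. g i i = 0"
  shows "(\<Sum>i=1..N. \<Sum>j=1..N. g i j) = 2 * (\<Sum>i=1..N. \<Sum>j=i+1..N. g i j)"
proof (induction N)
  case (Suc N)
  have "(\<Sum>i=1..Suc N. \<Sum>j=1..Suc N. g i j) =
      (\<Sum>i=1..N. \<Sum>j=1..N. g i j) + (\<Sum>i=1..N. g i (Suc N)) + (\<Sum>j=1..N. g (Suc N) j)"
    by (simp add: sum.distrib diag)
  also have "(\<Sum>j=1..N. g (Suc N) j) = (\<Sum>i=1..N. g i (Suc N))" by (intro sum.cong refl sym)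
  also have "(\<Sum>i=1..Suc N. \<Sum>j=i+1..Suc N. g i j) =
      (\<Sum>i=1..N. \<Sum>j=i+1..N. g i j) + (\<Sum>i=1..N. g i (Suc N))"
  proof -
    have "(\<Sum>j=i+1..Suc N. g i j) = (\<Sum>j=i+1..N. g i j) + g i (Suc N)" if "i \<in> {1..N}" for i
      using that by simp
    then have "(\<Sum>i=1..N. \<Sum>j=i+1..Suc N. g i j) = (\<Sum>i=1..N. (\<Sum>j=i+1..N. g i j) + g i (Suc N))"
      by (rule sum.cong[OF refl])
    then show ?thesis by (simp add: sum.distrib)
  qed
  ultimately show ?case using Suc by simp
qed simp

lemma gibbs_weight_nonneg: "0 \<le> gibbs_weight \<beta> V N x"
  unfolding gibbs_weight_def by (intro mult_nonneg_nonneg prod_nonneg) auto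

lemma gibbs_weight_collision:
  assumes "\<not> inj_on x {1..N}"
  shows "gibbs_weight \<beta> V N x = 0"
proof -
  from assms obtain k l where "k \<in> {1..N}" "l \<in> {1..N}" "k \<noteq> l" "x k = x l" by (auto simp: inj_on_def)
  then have "\<exists>i\<in>{1..N}. \<exists>j\<in>{1..N}. i < j \<and> x i = x j" 
  proof (cases "k < l")
    case True
    then show ?thesis using \<open>k \<in> _\<close> \<open>l \<in> _\<close> \<open>x k = x l\<close> by blast
  next
    case False
    then have "l < k" using \<open>k \<noteq> l\<close> by simp
    then show ?thesis using \<open>k \<in> _\<close> \<open>l \<in> _\<close> \<open>x k = x l\<close>[symmetric] by blast
  qed
  then obtain i j where "i \<in> {1..N}" "j \<in> {1..N}" "i < j" "x i = x j" by blast
  then have "(\<Prod>j=i+1..N. norm (x i - x j) powr \<beta>) = 0" by (intro prod_zero) auto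
  then have "(\<Prod>i=1..N. \<Prod>j=i+1..N. norm (x i - x j) powr \<beta>) = 0"
    using \<open>i \<in> {1..N}\<close> by (intro prod_zero) auto
  then show ?thesis by (simp add: gibbs_weight_def)
qed

text \<open>The full double sum may be used in the exponent because \<open>ln 0 = 0\<close> makes its diagonal vanish.\<close>

lemma gibbs_weight_eq_exp:
  assumes inj: "inj_on x {1..N}"
  shows "gibbs_weight \<beta> V N x =
    exp (\<beta> / 2 * (\<Sum>i=1..N. \<Sum>j=1..N. ln (norm (x i - x j))) - real N * (\<Sum>i=1..N. V (x i)))"
proof -
  have "(\<Prod>i=1..N. \<Prod>j=i+1..N. norm (x i - x j) powr \<beta>) =
    (\<Prod>i=1..N. \<Prod>j=i+1..N. exp (\<beta> * ln (norm (x i - x j))))"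
  proof (intro prod.cong refl)
    fix i j assume "i \<in> {1..N}" "j \<in> {i+1..N}"
    then have "x i \<noteq> x j" using inj by (auto dest: inj_onD)
    then show "norm (x i - x j) powr \<beta> = exp (\<beta> * ln (norm (x i - x j)))" by (simp add: powr_def)
  qed
  also have "\<dots> = exp (\<beta> * (\<Sum>i=1..N. \<Sum>j=i+1..N. ln (norm (x i - x j))))"
    by (simp add: exp_sum sum_distrib_left)
  also have "(\<Sum>i=1..N. \<Sum>j=i+1..N. ln (norm (x i - x j))) = 1 / 2 * (\<Sum>i=1..N. \<Sum>j=1..N. ln (norm (x i - x j)))"
    by (subst sum_symmetric_square) (auto simp: norm_minus_commute)
  finally have pr: "(\<Prod>i=1..N. \<Prod>j=i+1..N. norm (x i - x j) powr \<beta>) =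
    exp (\<beta> * (1 / 2 * (\<Sum>i=1..N. \<Sum>j=1..N. ln (norm (x i - x j)))))" .
  show ?thesis
  proof -
    have "(\<Prod>i=1..N. exp (- real N * V (x i))) = exp (- real N * (\<Sum>i=1..N. V (x i)))"
      by (simp only: exp_sum[symmetric] finite_atLeastAtMost sum_distrib_left)
    then show ?thesis
      unfolding gibbs_weight_def pr by (simp only: exp_add[symmetric]) simp
  qed
qed

lemma measurable_gibbs_weight [measurable]:
  fixes V :: "'a::euclidean_space \<Rightarrow> real"
  assumes [measurable]: "V \<in> borel_measurable borel"
  shows "gibbs_weight \<beta> V N \<in> borel_measurable (PiM {1..N} (\<lambda>_. lborel))"
  unfolding gibbs_weight_def by measurable

text \<open>Domination of measures passes to finite powers, one coordinate at a time.\<close>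

lemma nn_integral_PiM_mono_const:
  assumes M: "sigma_finite_measure M" and L: "sigma_finite_measure L" and sets: "sets M = sets L"
    and le: "\<And>f. f \<in> borel_measurable L \<Longrightarrow> (\<integral>\<^sup>+x. f x \<partial>M) \<le> C * (\<integral>\<^sup>+x. f x \<partial>L)"
    and I: "finite I" and f: "f \<in> borel_measurable (PiM I (\<lambda>_. L))"
  shows "(\<integral>\<^sup>+x. f x \<partial>PiM I (\<lambda>_. M)) \<le> C ^ card I * (\<integral>\<^sup>+x. f x \<partial>PiM I (\<lambda>_. L))"
  using I f
proof (induction I arbitrary: f)
  case empty
  show ?case by (simp add: PiM_empty)
next
  case (insert i I)
  interpret M: product_sigma_finite "\<lambda>_. M" using M by (simp add: product_sigma_finite_def)
  interpret L: product_sigma_finite "\<lambda>_. L" using L by (simp add: product_sigma_finite_def)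
  interpret sL: sigma_finite_measure L by fact
  note [measurable_cong] = sets
  have sP: "sets (PiM I (\<lambda>_. M)) = sets (PiM I (\<lambda>_. L))"
      and sPi: "sets (PiM (insert i I) (\<lambda>_. M)) = sets (PiM (insert i I) (\<lambda>_. L))"
    by (intro sets_PiM_cong refl sets)+
  note [measurable] = insert.prems
  have fM: "f \<in> borel_measurable (PiM (insert i I) (\<lambda>_. M))"
    using insert.prems sPi by (simp cong: measurable_cong_sets)
  have mL: "(\<lambda>x. \<integral>\<^sup>+y. f (x(i := y)) \<partial>L) \<in> borel_measurable (PiM I (\<lambda>_. L))"
    by measurable
  have "(\<integral>\<^sup>+x. f x \<partial>PiM (insert i I) (\<lambda>_. M)) = (\<integral>\<^sup>+x. (\<integral>\<^sup>+y. f (x(i := y)) \<partial>M) \<partial>PiM I (\<lambda>_. M))"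
    by (rule M.product_nn_integral_insert[OF insert.hyps fM])
  also have "\<dots> \<le> (\<integral>\<^sup>+x. C * (\<integral>\<^sup>+y. f (x(i := y)) \<partial>L) \<partial>PiM I (\<lambda>_. M))"
  proof (intro nn_integral_mono le)
    fix x assume "x \<in> space (PiM I (\<lambda>_. M))"
    then have "x \<in> space (PiM I (\<lambda>_. L))" by (simp only: sets_eq_imp_space_eq[OF sP])
    show "(\<lambda>y. f (x(i := y))) \<in> borel_measurable L"
      using measurable_comp[OF measurable_component_update insert.prems] \<open>x \<in> space (PiM I (\<lambda>_. L))\<close> insert.hyps
      by (auto simp: comp_def)
  qed
  also have "\<dots> = C * (\<integral>\<^sup>+x. (\<integral>\<^sup>+y. f (x(i := y)) \<partial>L) \<partial>PiM I (\<lambda>_. M))"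
    by (rule nn_integral_cmult) (use mL sP in \<open>simp cong: measurable_cong_sets\<close>)
  also have "\<dots> \<le> C * (C ^ card I * (\<integral>\<^sup>+x. (\<integral>\<^sup>+y. f (x(i := y)) \<partial>L) \<partial>PiM I (\<lambda>_. L)))"
    by (intro mult_left_mono insert.IH mL) auto
  also have "\<dots> = C ^ card (insert i I) * (\<integral>\<^sup>+x. f x \<partial>PiM (insert i I) (\<lambda>_. L))"
    unfolding L.product_nn_integral_insert[OF insert.hyps insert.prems] card_insert_disjoint[OF insert.hyps]
    by (simp only: power_Suc mult.assoc)
  finally show ?case .
qed

lemma nn_integral_PiM_pair:
  assumes M: "prob_space M" and I: "finite I" "i \<in> I" "j \<in> I" "i \<noteq> j"
    and f: "(\<lambda>z. f (fst z) (snd z)) \<in> borel_measurable (M \<Otimes>\<^sub>M M)"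
  shows "(\<integral>\<^sup>+x. f (x i) (x j) \<partial>PiM I (\<lambda>_. M)) = (\<integral>\<^sup>+z. f (fst z) (snd z) \<partial>(M \<Otimes>\<^sub>M M))"
proof -
  interpret M: prob_space M by fact
  interpret product_prob_space "\<lambda>_. M" I by unfold_locales
  have [measurable]: "case_prod f \<in> borel_measurable (M \<Otimes>\<^sub>M M)" using f by (simp add: case_prod_beta')
  have m: "(\<lambda>x. f (x i) (x j)) \<in> borel_measurable (PiM {i, j} (\<lambda>_. M))" by measurable
  have "(\<integral>\<^sup>+z. f (fst z) (snd z) \<partial>(M \<Otimes>\<^sub>M M)) = (\<integral>\<^sup>+x. f (x i) (x j) \<partial>PiM {i, j} (\<lambda>_. M))"
    by (rule product_nn_integral_pair[symmetric]) (use I in auto)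
  also have "PiM {i, j} (\<lambda>_. M) = distr (PiM I (\<lambda>_. M)) (PiM {i, j} (\<lambda>_. M)) (\<lambda>x. restrict x {i, j})"
    by (rule distr_restrict) (use I in auto)
  also have "(\<integral>\<^sup>+x. f (x i) (x j) \<partial>\<dots>) = (\<integral>\<^sup>+x. f (x i) (x j) \<partial>PiM I (\<lambda>_. M))"
    using I m by (subst nn_integral_distr) (auto intro!: measurable_restrict_subset)
  finally show ?thesis ..
qed

lemma nn_integral_PiM_single:
  assumes M: "prob_space M" and I: "finite I" "i \<in> I" and f: "f \<in> borel_measurable M"
  shows "(\<integral>\<^sup>+x. f (x i) \<partial>PiM I (\<lambda>_. M)) = (\<integral>\<^sup>+y. f y \<partial>M)"
proof -
  have "(\<integral>\<^sup>+y. f y \<partial>M) = (\<integral>\<^sup>+y. f y \<partial>distr (PiM I (\<lambda>_. M)) M (\<lambda>x. x i))"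
    using distr_PiM_component[of I "\<lambda>_. M" i] M I by simp
  also have "\<dots> = (\<integral>\<^sup>+x. f (x i) \<partial>PiM I (\<lambda>_. M))"
    using I f by (subst nn_integral_distr) auto
  finally show ?thesis ..
qed

context log_gas
begin

lemma sum_kernel_eq:
  assumes inj: "inj_on x {1..N}"
  defines "\<sigma> \<equiv> - (\<beta> / 2) * (\<Sum>i=1..N. \<Sum>j=1..N. ln (norm (x i - x j)))
      + (real N - 1) * (\<Sum>i=1..N. V (x i)) + real N * (real N - 1) * c"
  shows "(\<Sum>i=1..N. \<Sum>j\<in>{1..N} - {i}. gas_kernel 1 (x i) (x j)) = ennreal \<sigma>" "0 \<le> \<sigma>"
proof -
  let ?F = "\<lambda>i j. \<beta> / 2 * ln (1 / norm (x i - x j)) + 1 / 2 * V (x i) + 1 / 2 * V (x j) + c"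
  have ne: "x i \<noteq> x j" if "i \<in> {1..N}" "j \<in> {1..N} - {i}" for i j
    using inj that by (auto dest: inj_onD)
  have eq: "gas_kernel 1 (x i) (x j) = ennreal (?F i j)" "0 \<le> ?F i j"
    if "i \<in> {1..N}" "j \<in> {1..N} - {i}" for i j
    using gas_kernel_eq[OF ne[OF that]] by auto
  have "(\<Sum>i=1..N. \<Sum>j\<in>{1..N} - {i}. gas_kernel 1 (x i) (x j)) = (\<Sum>i=1..N. \<Sum>j\<in>{1..N} - {i}. ennreal (?F i j))"
    by (intro sum.cong refl eq)
  also have "\<dots> = (\<Sum>i=1..N. ennreal (\<Sum>j\<in>{1..N} - {i}. ?F i j))"
    by (intro sum.cong refl sum_ennreal eq)
  also have "\<dots> = ennreal (\<Sum>i=1..N. \<Sum>j\<in>{1..N} - {i}. ?F i j)"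
    by (intro sum_ennreal sum_nonneg eq)
  finally have 1: "(\<Sum>i=1..N. \<Sum>j\<in>{1..N} - {i}. gas_kernel 1 (x i) (x j)) = ennreal (\<Sum>i=1..N. \<Sum>j\<in>{1..N} - {i}. ?F i j)" .
  have inner: "(\<Sum>j\<in>{1..N} - {i}. ?F i j) = - (\<beta> / 2) * (\<Sum>j=1..N. ln (norm (x i - x j)))
      + 1 / 2 * (real N - 2) * V (x i) + 1 / 2 * (\<Sum>j=1..N. V (x j)) + (real N - 1) * c"
    if i: "i \<in> {1..N}" for i
  proof -
    have N: "card ({1..N} - {i}) = N - 1" "real (N - 1) = real N - 1" using i by auto
    have "(\<Sum>j\<in>{1..N} - {i}. ?F i j) =
      (\<Sum>j\<in>{1..N} - {i}. - (\<beta> / 2) * ln (norm (x i - x j)) + 1 / 2 * V (x i) + 1 / 2 * V (x j) + c)"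
      using ne[OF i] by (intro sum.cong refl) (auto simp: ln_div)
    also have "\<dots> = - (\<beta> / 2) * (\<Sum>j\<in>{1..N} - {i}. ln (norm (x i - x j))) + (real N - 1) * (1 / 2 * V (x i))
      + 1 / 2 * (\<Sum>j\<in>{1..N} - {i}. V (x j)) + (real N - 1) * c"
      by (simp only: sum.distrib sum_distrib_left[symmetric] sum_constant N)
    also have "(\<Sum>j\<in>{1..N} - {i}. ln (norm (x i - x j))) = (\<Sum>j=1..N. ln (norm (x i - x j)))"
      using i by (subst sum_diff1) auto
    also have "(\<Sum>j\<in>{1..N} - {i}. V (x j)) = (\<Sum>j=1..N. V (x j)) - V (x i)"
      using i by (subst sum_diff1) auto
    finally show ?thesis by (simp add: field_simps)
  qed
  have "(\<Sum>i=1..N. \<Sum>j\<in>{1..N} - {i}. ?F i j) = (\<Sum>i=1..N. - (\<beta> / 2) * (\<Sum>j=1..N. ln (norm (x i - x j)))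
      + 1 / 2 * (real N - 2) * V (x i) + 1 / 2 * (\<Sum>j=1..N. V (x j)) + (real N - 1) * c)"
    by (intro sum.cong refl inner)
  also have "\<dots> = - (\<beta> / 2) * (\<Sum>i=1..N. \<Sum>j=1..N. ln (norm (x i - x j)))
      + 1 / 2 * (real N - 2) * (\<Sum>i=1..N. V (x i)) + real N * (1 / 2 * (\<Sum>j=1..N. V (x j))) + real N * ((real N - 1) * c)"
    by (simp only: sum.distrib sum_distrib_left[symmetric] sum_constant card_atLeastAtMost) simp
  also have "\<dots> = \<sigma>" unfolding \<sigma>_def by (simp add: field_simps)
  finally have 2: "(\<Sum>i=1..N. \<Sum>j\<in>{1..N} - {i}. ?F i j) = \<sigma>" .
  show "(\<Sum>i=1..N. \<Sum>j\<in>{1..N} - {i}. gas_kernel 1 (x i) (x j)) = ennreal \<sigma>" using 1 2 by simp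
  show "0 \<le> \<sigma>" unfolding 2[symmetric] by (intro sum_nonneg eq)
qed

text \<open>Up to the shift by \<open>c\<close> for each ordered pair of points, this is minus the logarithm of the
  weight, except that only the positive part of the last sum is kept.\<close>

definition total_energy :: "nat \<Rightarrow> (nat \<Rightarrow> 'a) \<Rightarrow> ennreal" where
  "total_energy N x =
     (\<Sum>i=1..N. \<Sum>j\<in>{1..N} - {i}. gas_kernel 1 (x i) (x j)) + (\<Sum>i=1..N. ennreal (V (x i)))"

text \<open>The tangent of \<open>t \<mapsto> exp (- t)\<close> at \<open>T\<close>, rearranged so that both sides are nonnegative. In this form
  Jensen's inequality follows by integration, and no integrability has to be checked: on configurations
  with a collision the right-hand side is infinite.\<close>

lemma gibbs_weight_tangent_bound:
  fixes N :: nat and x :: "nat \<Rightarrow> 'a"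
  assumes T0: "T \<ge> 0"
  defines "b \<equiv> real N * (real N - 1) * c"
  shows "ennreal (exp (- T) * (1 + T)) \<le>
    ennreal (exp (- b)) * ennreal (gibbs_weight \<beta> V N x) + ennreal (exp (- T)) * total_energy N x"
proof (cases "inj_on x {1..N}")
  case False
  then obtain i j where ij: "i \<in> {1..N}" "j \<in> {1..N} - {i}" "x i = x j" unfolding inj_on_def by blast
  have "gas_kernel 1 (x i) (x j) = top" using gas_kernel_diag ij(3) by simp
  then have "top \<le> (\<Sum>j\<in>{1..N} - {i}. gas_kernel 1 (x i) (x j))"
    using member_le_sum[of j "{1..N} - {i}" "\<lambda>j. gas_kernel 1 (x i) (x j)"] ij(2) by simp
  also have "\<dots> \<le> (\<Sum>i=1..N. \<Sum>j\<in>{1..N} - {i}. gas_kernel 1 (x i) (x j))"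
    using ij(1) by (intro member_le_sum) auto
  finally have "total_energy N x = top" unfolding total_energy_def by (simp add: top_unique)
  then show ?thesis by (simp add: ennreal_mult_top)
next
  case True
  let ?L = "\<Sum>i=1..N. \<Sum>j=1..N. ln (norm (x i - x j))"
  define \<sigma> where "\<sigma> = - (\<beta> / 2) * ?L + (real N - 1) * (\<Sum>i=1..N. V (x i)) + real N * (real N - 1) * c"
  define v where "v = (\<Sum>i=1..N. max 0 (V (x i)))"
  have Sx: "total_energy N x = ennreal (\<sigma> + v)" and s0: "0 \<le> \<sigma> + v"
  proof -
    have "(\<Sum>i=1..N. ennreal (V (x i))) = (\<Sum>i=1..N. ennreal (max 0 (V (x i))))"
      by (intro sum.cong refl) (simp add: max_def ennreal_neg)
    also have "\<dots> = ennreal v" unfolding v_def by (rule sum_ennreal) simp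
    finally show "total_energy N x = ennreal (\<sigma> + v)" "0 \<le> \<sigma> + v" unfolding total_energy_def
      using sum_kernel_eq[OF True] by (simp_all add: \<sigma>_def v_def sum_nonneg)
  qed
  have "(\<Sum>i=1..N. V (x i)) \<le> v" unfolding v_def by (intro sum_mono) auto
  then have "- (\<sigma> + v) + b \<le> \<beta> / 2 * ?L - real N * (\<Sum>i=1..N. V (x i))"
    unfolding \<sigma>_def b_def by (simp add: algebra_simps)
  then have "exp (- (\<sigma> + v) + b) \<le> gibbs_weight \<beta> V N x"
    unfolding gibbs_weight_eq_exp[OF True] by simp
  then have "exp (- b) * exp (- (\<sigma> + v) + b) \<le> exp (- b) * gibbs_weight \<beta> V N x" by (intro mult_left_mono) auto
  moreover have "exp (- b) * exp (- (\<sigma> + v) + b) = exp (- T) * exp (T - (\<sigma> + v))"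
    by (simp add: exp_add[symmetric])
  moreover have "exp (- T) * (1 + (T - (\<sigma> + v))) \<le> exp (- T) * exp (T - (\<sigma> + v))"
    by (intro mult_left_mono exp_ge_add_one_self) auto
  moreover have "exp (- T) * (1 + T) = exp (- T) * (1 + (T - (\<sigma> + v))) + exp (- T) * (\<sigma> + v)"
    by (simp add: algebra_simps)
  ultimately have "exp (- T) * (1 + T) \<le> exp (- b) * gibbs_weight \<beta> V N x + exp (- T) * (\<sigma> + v)"
    by linarith
  then have "ennreal (exp (- T) * (1 + T)) \<le> ennreal (exp (- b) * gibbs_weight \<beta> V N x + exp (- T) * (\<sigma> + v))"
    by (rule ennreal_leI)
  also have "\<dots> = ennreal (exp (- b) * gibbs_weight \<beta> V N x) + ennreal (exp (- T) * (\<sigma> + v))"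
    using gibbs_weight_nonneg[of \<beta> V N x] s0 by (intro ennreal_plus) auto
  also have "\<dots> = ennreal (exp (- b)) * ennreal (gibbs_weight \<beta> V N x) + ennreal (exp (- T)) * total_energy N x"
    unfolding Sx using gibbs_weight_nonneg[of \<beta> V N x] s0 by (intro arg_cong2[of _ _ _ _ "(+)"] ennreal_mult) auto
  finally show ?thesis .
qed

lemma expected_total_energy_le:
  assumes \<rho>: "\<rho> \<in> borel_prob_measures"
    and e: "mutual_energy 1 \<rho> \<rho> \<le> ennreal e" "e \<ge> 0"
    and K: "(\<integral>\<^sup>+x. ennreal (V x) \<partial>\<rho>) \<le> ennreal K" "K \<ge> 0"
    and N: "N \<ge> 1"
  defines "T \<equiv> real N * (real N - 1) * e + real N * K"
  shows "(\<integral>\<^sup>+x. total_energy N x \<partial>PiM {1..N} (\<lambda>_. \<rho>)) \<le> ennreal T"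
proof -
  note [measurable_cong] = borel_prob_measuresD(2)[OF \<rho>]
  interpret R: prob_space \<rho> using borel_prob_measuresD[OF \<rho>] by simp
  let ?P = "PiM {1..N} (\<lambda>_. \<rho>)"
  have "(\<integral>\<^sup>+x. total_energy N x \<partial>?P) = (\<Sum>i=1..N. \<Sum>j\<in>{1..N} - {i}. mutual_energy 1 \<rho> \<rho>) + (\<Sum>i=1..N. \<integral>\<^sup>+x. ennreal (V x) \<partial>\<rho>)"
  proof -
    have pair: "(\<integral>\<^sup>+x. gas_kernel 1 (x i) (x j) \<partial>?P) = mutual_energy 1 \<rho> \<rho>" if "i \<in> {1..N}" "j \<in> {1..N} - {i}" for i j
      unfolding mutual_energy_def by (rule nn_integral_PiM_pair[OF R.prob_space_axioms]) (use that in auto)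
    have single: "(\<integral>\<^sup>+x. ennreal (V (x i)) \<partial>?P) = (\<integral>\<^sup>+x. ennreal (V x) \<partial>\<rho>)" if "i \<in> {1..N}" for i
      by (rule nn_integral_PiM_single[OF R.prob_space_axioms]) (use that in auto)
    have "(\<integral>\<^sup>+x. (\<Sum>i=1..N. \<Sum>j\<in>{1..N} - {i}. gas_kernel 1 (x i) (x j)) \<partial>?P)
        = (\<Sum>i=1..N. \<integral>\<^sup>+x. (\<Sum>j\<in>{1..N} - {i}. gas_kernel 1 (x i) (x j)) \<partial>?P)"
      by (rule nn_integral_sum) measurable
    also have "\<dots> = (\<Sum>i=1..N. \<Sum>j\<in>{1..N} - {i}. mutual_energy 1 \<rho> \<rho>)"
    proof (rule sum.cong[OF refl])
      fix i assume i: "i \<in> {1..N}"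
      have "(\<integral>\<^sup>+x. (\<Sum>j\<in>{1..N} - {i}. gas_kernel 1 (x i) (x j)) \<partial>?P)
          = (\<Sum>j\<in>{1..N} - {i}. \<integral>\<^sup>+x. gas_kernel 1 (x i) (x j) \<partial>?P)"
        by (rule nn_integral_sum) (use i in measurable)
      also have "\<dots> = (\<Sum>j\<in>{1..N} - {i}. mutual_energy 1 \<rho> \<rho>)"
        by (rule sum.cong[OF refl]) (rule pair[OF i])
      finally show "(\<integral>\<^sup>+x. (\<Sum>j\<in>{1..N} - {i}. gas_kernel 1 (x i) (x j)) \<partial>?P) = (\<Sum>j\<in>{1..N} - {i}. mutual_energy 1 \<rho> \<rho>)" .
    qed
    finally have 1: "(\<integral>\<^sup>+x. (\<Sum>i=1..N. \<Sum>j\<in>{1..N} - {i}. gas_kernel 1 (x i) (x j)) \<partial>?P)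
        = (\<Sum>i=1..N. \<Sum>j\<in>{1..N} - {i}. mutual_energy 1 \<rho> \<rho>)" .
    have "(\<integral>\<^sup>+x. (\<Sum>i=1..N. ennreal (V (x i))) \<partial>?P) = (\<Sum>i=1..N. \<integral>\<^sup>+x. ennreal (V (x i)) \<partial>?P)"
      by (rule nn_integral_sum) measurable
    also have "\<dots> = (\<Sum>i=1..N. \<integral>\<^sup>+x. ennreal (V x) \<partial>\<rho>)" by (rule sum.cong[OF refl]) (rule single)
    finally have 2: "(\<integral>\<^sup>+x. (\<Sum>i=1..N. ennreal (V (x i))) \<partial>?P) = (\<Sum>i=1..N. \<integral>\<^sup>+x. ennreal (V x) \<partial>\<rho>)" .
    show ?thesis unfolding total_energy_def 1[symmetric] 2[symmetric] by (rule nn_integral_add) measurable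
  qed
  also have "\<dots> \<le> (\<Sum>i=1..N. \<Sum>j\<in>{1..N} - {i}. ennreal e) + (\<Sum>i=1..N. ennreal K)"
    by (intro add_mono sum_mono e K)
  also have "\<dots> = ennreal T"
  proof -
    have card: "real (card ({1..N} - {i})) = real N - 1" if "i \<in> {1..N}" for i
      using that N by (subst card_Diff_singleton) (auto simp: of_nat_diff)
    have "(\<Sum>i=1..N. \<Sum>j\<in>{1..N} - {i}. ennreal e) = ennreal (\<Sum>i=1..N. \<Sum>j\<in>{1..N} - {i}. e)"
      using e(2) by (subst sum_ennreal, force)+ (rule refl)
    also have "(\<Sum>i=1..N. \<Sum>j\<in>{1..N} - {i}. e) = (\<Sum>i=1..N. (real N - 1) * e)"
      by (rule sum.cong[OF refl]) (simp only: sum_constant card)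
    also have "\<dots> = real N * (real N - 1) * e" by simp
    finally have 1: "(\<Sum>i=1..N. \<Sum>j\<in>{1..N} - {i}. ennreal e) = ennreal (real N * (real N - 1) * e)" .
    have "(\<Sum>i=1..N. ennreal K) = ennreal (\<Sum>i=1..N. K)" using K(2) by (intro sum_ennreal)
    then have 2: "(\<Sum>i=1..N. ennreal K) = ennreal (real N * K)" by simp
    show ?thesis unfolding 1 2 T_def using e(2) N K(2) by (intro ennreal_plus[symmetric]) auto
  qed
  finally show ?thesis .
qed

lemma partition_function_ge_of_dominated:
  assumes \<rho>: "\<rho> \<in> borel_prob_measures"
    and dom: "\<And>f. f \<in> borel_measurable borel \<Longrightarrow> (\<integral>\<^sup>+x. f x \<partial>\<rho>) \<le> ennreal C * (\<integral>\<^sup>+x. f x \<partial>lborel)"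
    and C: "C > 0"
    and e: "mutual_energy 1 \<rho> \<rho> \<le> ennreal e" "e \<ge> 0"
    and K: "(\<integral>\<^sup>+x. ennreal (V x) \<partial>\<rho>) \<le> ennreal K" "K \<ge> 0"
    and N: "N \<ge> 1"
  shows "ennreal (exp (- (real N * (real N - 1) * (e - c) + real N * K))) \<le> ennreal (C ^ N) * partition_function \<beta> V N"
proof -
  note [measurable_cong] = borel_prob_measuresD(2)[OF \<rho>]
  interpret R: prob_space \<rho> using borel_prob_measuresD[OF \<rho>] by simp
  interpret P: product_prob_space "\<lambda>_. \<rho>" "{1..N}" by unfold_locales
  let ?P = "PiM {1..N} (\<lambda>_. \<rho>)"
  define b where "b = real N * (real N - 1) * c"
  define T where "T = real N * (real N - 1) * e + real N * K"
  have T0: "T \<ge> 0" unfolding T_def using e K N by auto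
  have sP: "sets ?P = sets (PiM {1..N} (\<lambda>_. lborel))"
    by (intro sets_PiM_cong refl) (simp add: borel_prob_measuresD(2)[OF \<rho>])
  have [measurable]: "gibbs_weight \<beta> V N \<in> borel_measurable ?P"
    using measurable_gibbs_weight[OF measurable_V] sP by (simp cong: measurable_cong_sets)
  have [measurable]: "total_energy N \<in> borel_measurable ?P" unfolding total_energy_def by measurable
  note point = gibbs_weight_tangent_bound[OF T0, of N, folded b_def]
  have ST: "(\<integral>\<^sup>+x. total_energy N x \<partial>?P) \<le> ennreal T"
    unfolding T_def by (rule expected_total_energy_le[OF \<rho> e K N])
  define W where "W = (\<integral>\<^sup>+x. ennreal (gibbs_weight \<beta> V N x) \<partial>?P)"
  have "ennreal (exp (- T) * (1 + T)) = (\<integral>\<^sup>+x. ennreal (exp (- T) * (1 + T)) \<partial>?P)"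
    using P.P.emeasure_space_1 by (subst nn_integral_const) (simp only: mult_1_right)
  also have "\<dots> \<le> (\<integral>\<^sup>+x. ennreal (exp (- b)) * ennreal (gibbs_weight \<beta> V N x) + ennreal (exp (- T)) * total_energy N x \<partial>?P)"
    by (intro nn_integral_mono point)
  also have "\<dots> = ennreal (exp (- b)) * W + ennreal (exp (- T)) * (\<integral>\<^sup>+x. total_energy N x \<partial>?P)"
  proof -
    have "(\<integral>\<^sup>+x. ennreal (exp (- b)) * ennreal (gibbs_weight \<beta> V N x) \<partial>?P) = ennreal (exp (- b)) * W"
      unfolding W_def by (rule nn_integral_cmult) measurable
    moreover have "(\<integral>\<^sup>+x. ennreal (exp (- T)) * total_energy N x \<partial>?P) = ennreal (exp (- T)) * (\<integral>\<^sup>+x. total_energy N x \<partial>?P)"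
      by (rule nn_integral_cmult) measurable
    moreover have "(\<integral>\<^sup>+x. ennreal (exp (- b)) * ennreal (gibbs_weight \<beta> V N x) + ennreal (exp (- T)) * total_energy N x \<partial>?P)
      = (\<integral>\<^sup>+x. ennreal (exp (- b)) * ennreal (gibbs_weight \<beta> V N x) \<partial>?P) + (\<integral>\<^sup>+x. ennreal (exp (- T)) * total_energy N x \<partial>?P)"
      by (rule nn_integral_add) measurable
    ultimately show ?thesis by (simp only:)
  qed
  also have "\<dots> \<le> ennreal (exp (- b)) * W + ennreal (exp (- T)) * ennreal T"
    by (intro add_left_mono mult_left_mono ST) auto
  also have "ennreal (exp (- T)) * ennreal T = ennreal (exp (- T) * T)" using T0 by (intro ennreal_mult[symmetric]) auto
  also have "ennreal (exp (- T) * (1 + T)) = ennreal (exp (- T) * T) + ennreal (exp (- T))"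
    using T0 by (subst ennreal_plus[symmetric]) (auto simp: algebra_simps)
  finally have "ennreal (exp (- T) * T) + ennreal (exp (- T)) \<le> ennreal (exp (- T) * T) + ennreal (exp (- b)) * W"
    by (simp only: add.commute)
  then have "ennreal (exp (- T)) \<le> ennreal (exp (- b)) * W"
    unfolding ennreal_add_left_cancel_le by simp
  also have "W \<le> ennreal C ^ card {1..N} * partition_function \<beta> V N"
    unfolding W_def partition_function_def
  proof (rule nn_integral_PiM_mono_const)
    show "sigma_finite_measure \<rho>" "sigma_finite_measure (lborel :: 'a measure)"
      by (rule R.sigma_finite_measure_axioms, rule sigma_finite_lborel)
    show "sets \<rho> = sets lborel" using borel_prob_measuresD(2)[OF \<rho>] by simp
    show "(\<integral>\<^sup>+x. f x \<partial>\<rho>) \<le> ennreal C * (\<integral>\<^sup>+x. f x \<partial>lborel)" if "f \<in> borel_measurable lborel" for f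
      using dom that by simp
    show "(\<lambda>x. ennreal (gibbs_weight \<beta> V N x)) \<in> borel_measurable (PiM {1..N} (\<lambda>_. lborel))"
      using measurable_gibbs_weight[OF measurable_V] by measurable
  qed simp
  finally have "ennreal (exp (- T)) \<le> ennreal (exp (- b)) * (ennreal (C ^ N) * partition_function \<beta> V N)"
    using C by (simp add: ennreal_power mult_left_mono)
  then have "ennreal (exp b) * ennreal (exp (- T)) \<le> ennreal (exp b) * (ennreal (exp (- b)) * (ennreal (C ^ N) * partition_function \<beta> V N))"
    by (rule mult_left_mono) simp
  also have "\<dots> = ennreal (C ^ N) * partition_function \<beta> V N"
    by (simp add: mult.assoc[symmetric] ennreal_mult[symmetric] exp_add[symmetric])
  also have "ennreal (exp b) * ennreal (exp (- T)) = ennreal (exp (- (real N * (real N - 1) * (e - c) + real N * K)))"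
    by (simp add: ennreal_mult[symmetric] exp_add[symmetric] b_def T_def algebra_simps)
  finally show ?thesis .
qed

end

section \<open>Lower bound for the partition function: smoothing the minimiser\<close>

context log_gas
begin

lemma mutual_energy_iterated:
  assumes \<mu>: "\<mu> \<in> borel_prob_measures" and \<nu>: "\<nu> \<in> borel_prob_measures"
  shows "mutual_energy r \<mu> \<nu> = (\<integral>\<^sup>+x. \<integral>\<^sup>+y. gas_kernel r x y \<partial>\<nu> \<partial>\<mu>)"
proof -
  note [measurable_cong] = borel_prob_measuresD(2)[OF \<mu>] borel_prob_measuresD(2)[OF \<nu>]
  interpret N: prob_space \<nu> using borel_prob_measuresD[OF \<nu>] by simp
  show ?thesis unfolding mutual_energy_def by (subst N.nn_integral_fst[symmetric]) auto
qed

text \<open>Conditioning on a ball of probability \<open>q\<close> multiplies the energy by at most \<open>1 / q\<^sup>2\<close>, the integrand being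
  nonnegative, and \<open>q \<rightarrow> 1\<close>.\<close>

lemma truncated_energy:
  assumes \<mu>: "\<mu> \<in> borel_prob_measures" and m: "mutual_energy 1 \<mu> \<mu> = ennreal m" "m \<ge> 0" and \<epsilon>: "\<epsilon> > 0"
  obtains R \<nu> where "\<nu> \<in> borel_prob_measures" "AE x in \<nu>. norm x \<le> R" "R > 0"
    "mutual_energy 1 \<nu> \<nu> \<le> ennreal (m + \<epsilon>)"
proof -
  note [measurable_cong] = borel_prob_measuresD(2)[OF \<mu>]
  interpret M: prob_space \<mu> using borel_prob_measuresD[OF \<mu>] by simp
  let ?B = "\<lambda>n::nat. cball (0 :: 'a) (real n)"
  have "(\<lambda>n. measure \<mu> (?B n)) \<longlonglongrightarrow> measure \<mu> (\<Union>n. ?B n)"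
    by (rule M.finite_Lim_measure_incseq) (auto simp: borel_prob_measuresD(2)[OF \<mu>] incseq_def)
  also have "(\<Union>n. ?B n) = UNIV" using real_arch_simple by (auto simp: real_arch_simple)
  also have "measure \<mu> UNIV = 1" using M.prob_space sets_eq_imp_space_eq[OF borel_prob_measuresD(2)[OF \<mu>]] by simp
  finally have p: "(\<lambda>n. measure \<mu> (?B n)) \<longlonglongrightarrow> 1" .
  then have "(\<lambda>n. m / (measure \<mu> (?B n))\<^sup>2) \<longlonglongrightarrow> m / 1\<^sup>2" by (intro tendsto_intros) auto
  then have "\<forall>\<^sub>F n in sequentially. m / (measure \<mu> (?B n))\<^sup>2 < m + \<epsilon>"
    by (rule order_tendstoD) (use \<epsilon> in simp)
  moreover have "\<forall>\<^sub>F n in sequentially. measure \<mu> (?B n) > 0" by (rule order_tendstoD(1)[OF p]) simp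
  ultimately have "\<forall>\<^sub>F n in sequentially. m / (measure \<mu> (?B n))\<^sup>2 < m + \<epsilon> \<and> measure \<mu> (?B n) > 0 \<and> n > 0"
    using eventually_gt_at_top[of "0::nat"] by eventually_elim auto
  then obtain n where n: "m / (measure \<mu> (?B n))\<^sup>2 < m + \<epsilon>" "measure \<mu> (?B n) > 0" "n > 0"
    by (auto simp: eventually_sequentially)
  define q where "q = measure \<mu> (?B n)"
  have q: "emeasure \<mu> (?B n) = ennreal q" "q > 0" using n(2) by (auto simp: q_def M.emeasure_eq_measure)
  define \<nu> where "\<nu> = uniform_measure \<mu> (?B n)"
  have B: "?B n \<in> sets \<mu>" by (simp add: borel_prob_measuresD(2)[OF \<mu>])
  have \<nu>: "\<nu> \<in> borel_prob_measures"
    unfolding \<nu>_def borel_prob_measures_def using q borel_prob_measuresD(2)[OF \<mu>]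
    by (auto intro!: prob_space_uniform_measure)
  have "AE x in \<nu>. norm x \<le> real n" unfolding \<nu>_def by (rule AE_uniform_measureI[OF B]) simp
  moreover have "mutual_energy 1 \<nu> \<nu> \<le> ennreal (m + \<epsilon>)"
  proof -
    have le: "(\<integral>\<^sup>+x. f x \<partial>\<nu>) \<le> (\<integral>\<^sup>+x. f x \<partial>\<mu>) / ennreal q" if [measurable]: "f \<in> borel_measurable borel" for f
    proof -
      have "(\<integral>\<^sup>+x. f x \<partial>\<nu>) = (\<integral>\<^sup>+x. f x * indicator (?B n) x \<partial>\<mu>) / ennreal q"
        unfolding \<nu>_def q(1)[symmetric] by (rule nn_integral_uniform_measure) (use B in auto)
      also have "\<dots> \<le> (\<integral>\<^sup>+x. f x \<partial>\<mu>) / ennreal q"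
        by (intro divide_right_mono_ennreal nn_integral_mono) (auto simp: indicator_def)
      finally show ?thesis .
    qed
    have meas: "(\<lambda>x. \<integral>\<^sup>+y. gas_kernel 1 x y \<partial>\<mu>) \<in> borel_measurable borel" by measurable
    have "mutual_energy 1 \<nu> \<nu> \<le> (\<integral>\<^sup>+x. (\<integral>\<^sup>+y. gas_kernel 1 x y \<partial>\<mu>) / ennreal q \<partial>\<nu>)"
      unfolding mutual_energy_iterated[OF \<nu> \<nu>] by (intro nn_integral_mono le) measurable
    also have "\<dots> \<le> (\<integral>\<^sup>+x. (\<integral>\<^sup>+y. gas_kernel 1 x y \<partial>\<mu>) / ennreal q \<partial>\<mu>) / ennreal q"
      by (rule le) (use meas in measurable)
    also have "(\<integral>\<^sup>+x. (\<integral>\<^sup>+y. gas_kernel 1 x y \<partial>\<mu>) / ennreal q \<partial>\<mu>) = mutual_energy 1 \<mu> \<mu> / ennreal q"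
      unfolding mutual_energy_iterated[OF \<mu> \<mu>] by (rule nn_integral_divide) (use meas in measurable)
    also have "\<dots> / ennreal q = ennreal (m / q\<^sup>2)"
      using m q(2) by (simp add: divide_ennreal power2_eq_square)
    also have "\<dots> \<le> ennreal (m + \<epsilon>)" using n(1) by (intro ennreal_leI) (simp add: q_def)
    finally show ?thesis .
  qed
  ultimately show ?thesis using that[OF \<nu>, of "real n"] n(3) by simp
qed

text \<open>A common translation leaves \<open>log |x - y|\<close> unchanged, so only \<open>V\<close> contributes. This uses the flat form of
  the kernel, whereas positive definiteness is a property of the spherical one.\<close>

lemma gas_kernel_translate_le:
  assumes "\<bar>V (x + z) - V x\<bar> \<le> \<epsilon>" "\<bar>V (y + z) - V y\<bar> \<le> \<epsilon>"
  shows "gas_kernel 1 (x + z) (y + z) \<le> gas_kernel 1 x y + ennreal \<epsilon>"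
proof (cases "x = y")
  case True
  then show ?thesis by (simp add: gas_kernel_diag)
next
  case False
  then have "x + z \<noteq> y + z" by simp
  let ?F = "\<beta> / 2 * ln (1 / norm (x - y)) + 1 / 2 * V x + 1 / 2 * V y + c"
  have "gas_kernel 1 (x + z) (y + z) \<le> ennreal (?F + \<epsilon>)"
    unfolding gas_kernel_eq(1)[OF \<open>x + z \<noteq> y + z\<close>] using assms by (intro ennreal_leI) (simp add: abs_le_iff)
  also have "\<dots> = gas_kernel 1 x y + ennreal \<epsilon>"
    unfolding gas_kernel_eq(1)[OF False] using gas_kernel_eq(2)[OF False] assms by (intro ennreal_plus) auto
  finally show ?thesis .
qed

lemma translate_in:
  fixes \<nu> :: "'a measure"
  assumes \<nu>: "\<nu> \<in> borel_prob_measures"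
  shows "distr \<nu> borel (\<lambda>y. y + z) \<in> borel_prob_measures"
proof -
  note [measurable_cong] = borel_prob_measuresD(2)[OF \<nu>]
  interpret N: prob_space \<nu> using borel_prob_measuresD[OF \<nu>] by simp
  have "(\<lambda>y :: 'a. y + z) \<in> borel_measurable borel"
    by (intro borel_measurable_continuous_onI continuous_intros)
  then have "(\<lambda>y. y + z) \<in> borel_measurable \<nu>"
    using borel_prob_measuresD(2)[OF \<nu>] by (simp cong: measurable_cong_sets)
  from N.prob_space_distr[OF this] show ?thesis by (simp add: borel_prob_measures_def)
qed

lemma mutual_energy_translate:
  assumes \<nu>: "\<nu> \<in> borel_prob_measures"
  shows "mutual_energy 1 (distr \<nu> borel (\<lambda>y. y + z)) (distr \<nu> borel (\<lambda>y. y + z')) =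
    (\<integral>\<^sup>+x. \<integral>\<^sup>+y. gas_kernel 1 (x + z) (y + z') \<partial>\<nu> \<partial>\<nu>)"
proof -
  note [measurable_cong] = borel_prob_measuresD(2)[OF \<nu>]
  interpret N: prob_space \<nu> using borel_prob_measuresD[OF \<nu>] by simp
  show ?thesis
    unfolding mutual_energy_iterated[OF translate_in[OF \<nu>] translate_in[OF \<nu>]]
    by (subst nn_integral_distr, measurable)+
qed

text \<open>Positive definiteness bounds the mutual energy of two translates by the average of their own
  energies. A translate has the same logarithmic energy as the original measure, and \<open>V\<close> changes little.\<close>

lemma translates_energy_le:
  assumes \<nu>: "\<nu> \<in> borel_prob_measures" and R: "AE x in \<nu>. norm x \<le> R"
    and V: "\<And>x z. norm x \<le> R \<Longrightarrow> norm z \<le> \<delta> \<Longrightarrow> \<bar>V (x + z) - V x\<bar> \<le> \<epsilon>"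
    and z: "norm z \<le> \<delta>" "norm z' \<le> \<delta>"
  shows "(\<integral>\<^sup>+x. \<integral>\<^sup>+y. gas_kernel 1 (x + z) (y + z') \<partial>\<nu> \<partial>\<nu>) \<le> mutual_energy 1 \<nu> \<nu> + ennreal \<epsilon>"
proof -
  note [measurable_cong] = borel_prob_measuresD(2)[OF \<nu>]
  interpret N: prob_space \<nu> using borel_prob_measuresD[OF \<nu>] by simp
  let ?T = "\<lambda>z. distr \<nu> borel (\<lambda>y. y + z)"
  have self: "mutual_energy 1 (?T z) (?T z) \<le> mutual_energy 1 \<nu> \<nu> + ennreal \<epsilon>" if z: "norm z \<le> \<delta>" for z
  proof -
    have "mutual_energy 1 (?T z) (?T z) \<le> (\<integral>\<^sup>+x. (\<integral>\<^sup>+y. gas_kernel 1 x y \<partial>\<nu>) + ennreal \<epsilon> \<partial>\<nu>)"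
      unfolding mutual_energy_translate[OF \<nu>]
    proof (rule nn_integral_mono_AE, use R in eventually_elim)
      case (elim x)
      have "(\<integral>\<^sup>+y. gas_kernel 1 (x + z) (y + z) \<partial>\<nu>) \<le> (\<integral>\<^sup>+y. gas_kernel 1 x y + ennreal \<epsilon> \<partial>\<nu>)"
        by (rule nn_integral_mono_AE, use R in eventually_elim) (intro gas_kernel_translate_le V z elim)
      also have "\<dots> = (\<integral>\<^sup>+y. gas_kernel 1 x y \<partial>\<nu>) + ennreal \<epsilon>"
        by (subst nn_integral_add) (auto simp: N.emeasure_space_1)
      finally show ?case .
    qed
    also have "\<dots> = mutual_energy 1 \<nu> \<nu> + ennreal \<epsilon>"
      unfolding mutual_energy_iterated[OF \<nu> \<nu>] by (subst nn_integral_add) (auto simp: N.emeasure_space_1)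
    finally show ?thesis .
  qed
  have "2 * mutual_energy 1 (?T z) (?T z') \<le> mutual_energy 1 (?T z) (?T z) + mutual_energy 1 (?T z') (?T z')"
    by (intro mutual_energy_cross_le translate_in \<nu>)
  also have "\<dots> \<le> 2 * (mutual_energy 1 \<nu> \<nu> + ennreal \<epsilon>)"
    unfolding mult_2 by (intro add_mono self z)
  finally have "mutual_energy 1 (?T z) (?T z') \<le> mutual_energy 1 \<nu> \<nu> + ennreal \<epsilon>"
    by (subst (asm) ennreal_mult_le_mult_iff) auto
  then show ?thesis unfolding mutual_energy_translate[OF \<nu>] .
qed

text \<open>The law of \<open>Y + Z\<close> with \<open>Y\<close> distributed by \<open>\<nu>\<close> and \<open>Z\<close> uniform in a small ball. Its energy is an
  average of mutual energies of translates of \<open>\<nu>\<close>, and its density is at most the inverse volume of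
  the ball.\<close>

lemma mollified_measure:
  assumes \<nu>: "\<nu> \<in> borel_prob_measures" and R: "AE x in \<nu>. norm x \<le> R" and \<epsilon>: "\<epsilon> > 0"
  obtains \<rho> C K where "\<rho> \<in> borel_prob_measures" "mutual_energy 1 \<rho> \<rho> \<le> mutual_energy 1 \<nu> \<nu> + ennreal \<epsilon>"
    "\<And>f. f \<in> borel_measurable borel \<Longrightarrow> (\<integral>\<^sup>+x. f x \<partial>\<rho>) \<le> ennreal C * (\<integral>\<^sup>+x. f x \<partial>lborel)" "C > 0"
    "(\<integral>\<^sup>+x. ennreal (V x) \<partial>\<rho>) \<le> ennreal K" "K \<ge> 0"
proof -
  note [measurable_cong] = borel_prob_measuresD(2)[OF \<nu>]
  interpret N: prob_space \<nu> using borel_prob_measuresD[OF \<nu>] by simp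
  have "uniformly_continuous_on (cball 0 (R + 1)) V"
    by (intro compact_uniformly_continuous continuous_on_subset[OF continuous_V]) auto
  then obtain d where d: "d > 0" "\<And>x x'. x \<in> cball 0 (R + 1) \<Longrightarrow> x' \<in> cball 0 (R + 1) \<Longrightarrow> dist x' x < d \<Longrightarrow> dist (V x') (V x) < \<epsilon>"
    using \<epsilon> unfolding uniformly_continuous_on_def by metis
  define \<delta> where "\<delta> = min 1 (d / 2)"
  have \<delta>: "\<delta> > 0" "\<delta> \<le> 1" "\<delta> < d" using d(1) by (auto simp: \<delta>_def min_def)
  have V: "\<bar>V (x + z) - V x\<bar> \<le> \<epsilon>" if "norm x \<le> R" "norm z \<le> \<delta>" for x z
  proof -
    have "norm (x + z) \<le> R + 1" using that \<delta>(2) norm_triangle_ineq[of x z] by linarith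
    then have "x + z \<in> cball 0 (R + 1)" "x \<in> cball 0 (R + 1)" using that by simp_all
    moreover have "dist (x + z) x < d" using that \<delta> by (simp add: dist_norm)
    ultimately have "dist (V (x + z)) (V x) < \<epsilon>" using d(2) by blast
    then show ?thesis by (simp add: dist_real_def)
  qed
  have "bounded (V ` cball 0 (R + 1))"
    by (intro compact_imp_bounded compact_continuous_image continuous_on_subset[OF continuous_V]) auto
  then obtain K0 where K0: "\<forall>x\<in>cball 0 (R + 1). \<bar>V x\<bar> \<le> K0" by (auto simp: bounded_iff)
  define K where "K = max 0 K0"
  have K: "K \<ge> 0" "\<And>x. norm x \<le> R + 1 \<Longrightarrow> V x \<le> K" using K0 by (auto simp: K_def abs_le_iff max.coboundedI2)
  let ?D = "cball (0 :: 'a) \<delta>"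
  define b where "b = measure lborel ?D"
  have eD: "emeasure lborel ?D = ennreal b"
    unfolding b_def using emeasure_lborel_cball_finite[of 0 \<delta>] by (intro emeasure_eq_ennreal_measure) (simp add: less_top)
  have b: "b > 0" using \<delta>(1) unfolding b_def by (simp add: content_cball_pos)
  define U where "U = uniform_measure lborel ?D"
  have U: "U \<in> borel_prob_measures"
    unfolding U_def borel_prob_measures_def using b eD by (auto intro!: prob_space_uniform_measure)
  note [measurable_cong] = borel_prob_measuresD(2)[OF U]
  interpret U: prob_space U using borel_prob_measuresD[OF U] by simp
  have AE_U: "AE z in U. norm z \<le> \<delta>" unfolding U_def by (rule AE_uniform_measureI) auto
  interpret UN: pair_prob_space U \<nu> ..
  interpret NU: pair_prob_space \<nu> U ..
  define \<rho> where "\<rho> = distr (U \<Otimes>\<^sub>M \<nu>) borel (\<lambda>(z, y). y + z)"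
  have \<rho>: "\<rho> \<in> borel_prob_measures"
    unfolding \<rho>_def borel_prob_measures_def by (auto intro!: UN.P.prob_space_distr)
  have nn: "(\<integral>\<^sup>+x. f x \<partial>\<rho>) = (\<integral>\<^sup>+z. \<integral>\<^sup>+y. f (y + z) \<partial>\<nu> \<partial>U)" if [measurable]: "f \<in> borel_measurable borel" for f
    unfolding \<rho>_def by (subst nn_integral_distr) (auto simp: N.nn_integral_fst[symmetric] case_prod_beta)
  have E: "mutual_energy 1 \<rho> \<rho> \<le> mutual_energy 1 \<nu> \<nu> + ennreal \<epsilon>"
  proof -
    have "mutual_energy 1 \<rho> \<rho> = (\<integral>\<^sup>+x. (\<integral>\<^sup>+z'. \<integral>\<^sup>+y'. gas_kernel 1 x (y' + z') \<partial>\<nu> \<partial>U) \<partial>\<rho>)"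
      unfolding mutual_energy_iterated[OF \<rho> \<rho>] by (intro nn_integral_cong nn) measurable
    also have "\<dots> = (\<integral>\<^sup>+z. \<integral>\<^sup>+y. (\<integral>\<^sup>+z'. \<integral>\<^sup>+y'. gas_kernel 1 (y + z) (y' + z') \<partial>\<nu> \<partial>U) \<partial>\<nu> \<partial>U)"
      by (rule nn) measurable
    \<comment> \<open>With the two translations outermost, the inner double integral is the mutual energy of two translates.\<close>
    also have "\<dots> = (\<integral>\<^sup>+z. \<integral>\<^sup>+z'. (\<integral>\<^sup>+y. \<integral>\<^sup>+y'. gas_kernel 1 (y + z) (y' + z') \<partial>\<nu> \<partial>\<nu>) \<partial>U \<partial>U)"
      by (intro nn_integral_cong UN.Fubini') measurable
    also have "\<dots> \<le> (\<integral>\<^sup>+z. \<integral>\<^sup>+z'. mutual_energy 1 \<nu> \<nu> + ennreal \<epsilon> \<partial>U \<partial>U)"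
    proof (rule nn_integral_mono_AE, use AE_U in eventually_elim)
      case (elim z)
      show ?case
      proof (rule nn_integral_mono_AE, use AE_U in eventually_elim)
        case (elim z')
        show ?case by (rule translates_energy_le[OF \<nu> R V]) (use elim \<open>norm z \<le> \<delta>\<close> in auto)
      qed
    qed
    also have "\<dots> = mutual_energy 1 \<nu> \<nu> + ennreal \<epsilon>" by (simp add: U.emeasure_space_1)
    finally show ?thesis .
  qed
  have dom: "(\<integral>\<^sup>+x. f x \<partial>\<rho>) \<le> ennreal (1 / b) * (\<integral>\<^sup>+x. f x \<partial>lborel)" if f [measurable]: "f \<in> borel_measurable borel" for f
  proof -
    have "(\<integral>\<^sup>+x. f x \<partial>\<rho>) = (\<integral>\<^sup>+y. \<integral>\<^sup>+z. f (y + z) \<partial>U \<partial>\<nu>)"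
      unfolding nn[OF f] by (rule UN.Fubini'[symmetric]) measurable
    also have "\<dots> \<le> (\<integral>\<^sup>+y. ennreal (1 / b) * (\<integral>\<^sup>+x. f x \<partial>lborel) \<partial>\<nu>)"
    proof (rule nn_integral_mono)
      fix y
      have "(\<integral>\<^sup>+z. f (y + z) \<partial>U) = (\<integral>\<^sup>+z. f (y + z) * indicator ?D z \<partial>lborel) / ennreal b"
        unfolding U_def eD[symmetric] by (rule nn_integral_uniform_measure) auto
      also have "\<dots> \<le> (\<integral>\<^sup>+z. f (y + z) \<partial>lborel) / ennreal b"
        by (intro divide_right_mono_ennreal nn_integral_mono) (auto simp: indicator_def)
      also have "(\<integral>\<^sup>+z. f (y + z) \<partial>lborel) = (\<integral>\<^sup>+x. f x \<partial>distr lborel borel ((+) y))"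
        by (subst nn_integral_distr) auto
      also have "distr lborel borel ((+) y) = lborel" by (rule lborel_distr_plus)
      also have "(\<integral>\<^sup>+x. f x \<partial>lborel) / ennreal b = ennreal (1 / b) * (\<integral>\<^sup>+x. f x \<partial>lborel)"
        using b by (simp add: divide_ennreal_def inverse_ennreal mult.commute inverse_eq_divide)
      finally show "(\<integral>\<^sup>+z. f (y + z) \<partial>U) \<le> ennreal (1 / b) * (\<integral>\<^sup>+x. f x \<partial>lborel)" .
    qed
    also have "\<dots> = ennreal (1 / b) * (\<integral>\<^sup>+x. f x \<partial>lborel)" by (simp add: N.emeasure_space_1)
    finally show ?thesis .
  qed
  have VK: "(\<integral>\<^sup>+x. ennreal (V x) \<partial>\<rho>) \<le> ennreal K"
  proof -
    have "(\<integral>\<^sup>+x. ennreal (V x) \<partial>\<rho>) = (\<integral>\<^sup>+z. \<integral>\<^sup>+y. ennreal (V (y + z)) \<partial>\<nu> \<partial>U)" by (rule nn) measurable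
    also have "\<dots> \<le> (\<integral>\<^sup>+z. \<integral>\<^sup>+y. ennreal K \<partial>\<nu> \<partial>U)"
    proof (rule nn_integral_mono_AE, use AE_U in eventually_elim)
      case (elim z)
      show ?case
      proof (rule nn_integral_mono_AE, use R in eventually_elim)
        case (elim y)
        have "norm (y + z) \<le> R + 1" using elim \<open>norm z \<le> \<delta>\<close> \<delta>(2) norm_triangle_ineq[of y z] by linarith
        then show ?case by (intro ennreal_leI K)
      qed
    qed
    also have "\<dots> = ennreal K" by (simp add: U.emeasure_space_1 N.emeasure_space_1)
    finally show ?thesis .
  qed
  show ?thesis by (rule that[OF \<rho> E dom _ VK K(1)]) (use b in auto)
qed

text \<open>The factor \<open>C^N\<close> from the domination by Lebesgue measure only affects the linear term in the exponent.\<close>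

lemma partition_function_lower:
  assumes m: "min_energy 1 = ennreal m" "m \<ge> 0" and \<epsilon>: "\<epsilon> > 0"
  obtains K where "\<And>N. N \<ge> 1 \<Longrightarrow>
    ennreal (exp (- (real N * (real N - 1) * (m + \<epsilon> - c) + real N * K))) \<le> partition_function \<beta> V N"
proof -
  obtain \<mu> where \<mu>: "\<mu> \<in> borel_prob_measures" "mutual_energy 1 \<mu> \<mu> = ennreal m"
    using minimizer_exists m by metis
  have \<epsilon>2: "\<epsilon> / 2 > 0" using \<epsilon> by simp
  obtain R \<nu> where \<nu>: "\<nu> \<in> borel_prob_measures" "AE x in \<nu>. norm x \<le> R"
    and E\<nu>: "mutual_energy 1 \<nu> \<nu> \<le> ennreal (m + \<epsilon> / 2)"
    using truncated_energy[OF \<mu> m(2) \<epsilon>2] by metis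
  obtain \<rho> C K where \<rho>: "\<rho> \<in> borel_prob_measures" and E\<rho>: "mutual_energy 1 \<rho> \<rho> \<le> mutual_energy 1 \<nu> \<nu> + ennreal (\<epsilon> / 2)"
    and dom: "\<And>f. f \<in> borel_measurable borel \<Longrightarrow> (\<integral>\<^sup>+x. f x \<partial>\<rho>) \<le> ennreal C * (\<integral>\<^sup>+x. f x \<partial>lborel)" and C: "C > 0"
    and K: "(\<integral>\<^sup>+x. ennreal (V x) \<partial>\<rho>) \<le> ennreal K" "K \<ge> 0"
    by (rule mollified_measure[OF \<nu> \<epsilon>2]) blast
  have "mutual_energy 1 \<rho> \<rho> \<le> ennreal (m + \<epsilon> / 2) + ennreal (\<epsilon> / 2)"
    by (rule order_trans[OF E\<rho>]) (intro add_right_mono E\<nu>)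
  also have "\<dots> = ennreal (m + \<epsilon>)" using m(2) \<epsilon> by (subst ennreal_plus[symmetric]) auto
  finally have e: "mutual_energy 1 \<rho> \<rho> \<le> ennreal (m + \<epsilon>)" "m + \<epsilon> \<ge> 0" using m(2) \<epsilon> by auto
  show ?thesis
  proof (rule that[of "K + ln C"])
    fix N :: nat assume N: "N \<ge> 1"
    let ?A = "real N * (real N - 1) * (m + \<epsilon> - c) + real N * K"
    have "ennreal (exp (- ?A)) \<le> ennreal (C ^ N) * partition_function \<beta> V N"
      by (rule partition_function_ge_of_dominated[OF \<rho> dom C e K N])
    then have "ennreal (1 / C ^ N) * ennreal (exp (- ?A)) \<le> ennreal (1 / C ^ N) * (ennreal (C ^ N) * partition_function \<beta> V N)"
      by (rule mult_left_mono) simp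
    also have "\<dots> = partition_function \<beta> V N"
      using C by (simp add: mult.assoc[symmetric] ennreal_mult[symmetric])
    also have "ennreal (1 / C ^ N) * ennreal (exp (- ?A)) = ennreal (exp (- (?A + real N * ln C)))"
    proof -
      have "C ^ N = exp (real N * ln C)" using C by (simp add: exp_of_nat_mult)
      then have "1 / C ^ N * exp (- ?A) = exp (- (?A + real N * ln C))"
        by (simp add: exp_minus exp_diff exp_add divide_inverse)
      then show ?thesis using C by (simp add: ennreal_mult[symmetric])
    qed
    finally show "ennreal (exp (- (real N * (real N - 1) * (m + \<epsilon> - c) + real N * (K + ln C)))) \<le> partition_function \<beta> V N"
      by (simp add: algebra_simps)
  qed
qed

end

section \<open>Configurations with atypical empirical measure\<close>

text \<open>The empirical measure is the law of a uniformly chosen point of the configuration, so integrals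
  against it are averages over the points.\<close>

lemma empirical_measure_eq_distr:
  fixes x :: "nat \<Rightarrow> 'a::euclidean_space"
  assumes "N \<ge> 1"
  shows "empirical_measure N x = distr (measure_pmf (pmf_of_set {1..N})) borel x"
proof (rule measure_eqI)
  show s: "sets (empirical_measure N x) = sets (distr (measure_pmf (pmf_of_set {1..N})) borel x)"
    unfolding empirical_measure_def by (simp add: sets.sigma_sets_eq[of borel, simplified])
  fix A assume "A \<in> sets (empirical_measure N x)"
  then have A: "A \<in> sets borel" using s by simp
  have "(\<Sum>i=1..N. emeasure (return borel (x i)) A) = (\<Sum>i=1..N. indicator A (x i))"
    using A by (intro sum.cong refl) (simp add: emeasure_return)
  also have "\<dots> = of_nat (card ({1..N} \<inter> x -` A))"
    by (simp add: indicator_def sum.If_cases Int_def vimage_def)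
  finally have "emeasure (empirical_measure N x) A = of_nat (card ({1..N} \<inter> x -` A)) / of_nat N"
    unfolding emeasure_empirical_measure[OF A] by simp
  also have "\<dots> = ennreal (card ({1..N} \<inter> x -` A) / card {1..N})"
    using assms by (simp add: ennreal_of_nat_eq_real_of_nat divide_ennreal)
  also have "\<dots> = emeasure (measure_pmf (pmf_of_set {1..N})) (x -` A)"
    using assms by (subst emeasure_pmf_of_set) auto
  also have "\<dots> = emeasure (distr (measure_pmf (pmf_of_set {1..N})) borel x) A"
    using A by (simp add: emeasure_distr)
  finally show "emeasure (empirical_measure N x) A = emeasure (distr (measure_pmf (pmf_of_set {1..N})) borel x) A" .
qed

lemma empirical_measure_in:
  fixes x :: "nat \<Rightarrow> 'a::euclidean_space"
  assumes "N \<ge> 1"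
  shows "empirical_measure N x \<in> borel_prob_measures"
  unfolding empirical_measure_eq_distr[OF assms] borel_prob_measures_def
  by (auto intro!: measure_pmf.prob_space_distr)

lemma integral_empirical:
  fixes f :: "'a::euclidean_space \<Rightarrow> real"
  assumes "N \<ge> 1" and [measurable]: "f \<in> borel_measurable borel"
  shows "(\<integral>y. f y \<partial>empirical_measure N x) = (\<Sum>i=1..N. f (x i)) / N"
  unfolding empirical_measure_eq_distr[OF assms(1)]
  using assms(1) by (subst integral_distr) (auto simp: integral_pmf_of_set)

lemma nn_integral_empirical:
  fixes f :: "'a::euclidean_space \<Rightarrow> ennreal"
  assumes "N \<ge> 1" and [measurable]: "f \<in> borel_measurable borel"
  shows "(\<integral>\<^sup>+y. f y \<partial>empirical_measure N x) = (\<Sum>i=1..N. f (x i)) / of_nat N"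
  unfolding empirical_measure_eq_distr[OF assms(1)]
  using assms(1) by (subst nn_integral_distr) (auto simp: nn_integral_pmf_of_set)

lemma moment_empirical:
  assumes "N \<ge> 1"
  shows "moment (empirical_measure N x) \<alpha> = (\<Sum>i=1..N. monomial \<alpha> (stereo (x i))) / N"
  unfolding moment_def by (rule integral_empirical[OF assms]) measurable

lemma measurable_moment_empirical:
  assumes "N \<ge> 1"
  shows "(\<lambda>x. moment (empirical_measure N x) \<alpha>) \<in> borel_measurable (PiM {1..N} (\<lambda>_. lborel :: 'a::euclidean_space measure))"
  unfolding moment_empirical[OF assms] by measurable

lemma measurable_discrepancy_empirical:
  assumes "N \<ge> 1"
  shows "(\<lambda>x. discrepancy r (empirical_measure N x) \<mu>) \<in> borel_measurable (PiM {1..N} (\<lambda>_. lborel :: 'a::euclidean_space measure))"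
  unfolding discrepancy_def moment_empirical[OF assms] by measurable

lemma sets_gibbs_measure [measurable_cong]:
  "sets (gibbs_measure \<beta> V N) = sets (PiM {1..N} (\<lambda>_. lborel))"
  by (simp add: gibbs_measure_def)

context log_gas
begin

text \<open>The energy of the empirical measure contains all \<open>N\<^sup>2\<close> pairs, the interaction only the \<open>N (N - 1)\<close>
  off-diagonal ones. The difference is \<open>N\<close> times the diagonal value of the regularised kernel;
  the factor \<open>N (N - 1)\<close> instead of \<open>N\<^sup>2\<close> on the left absorbs one copy of the confinement of each point, which
  is unbounded and could not be treated as an error.\<close>

lemma regularized_empirical_energy:
  fixes x :: "nat \<Rightarrow> 'a"
  assumes N: "N \<ge> 1" and r: "0 \<le> r" "r < 1" and inj: "inj_on x {1..N}"
  defines "\<nu> \<equiv> empirical_measure N x"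
    and "\<sigma> \<equiv> - (\<beta> / 2) * (\<Sum>i=1..N. \<Sum>j=1..N. ln (norm (x i - x j)))
      + (real N - 1) * (\<Sum>i=1..N. V (x i)) + real N * (real N - 1) * c"
  obtains I where "mutual_energy r \<nu> \<nu> = ennreal I" "I \<ge> 0"
    "real N * (real N - 1) * I \<le> \<sigma> + real N * (\<beta> / 4 * ln ((1 + r) / (1 - r)))"
proof -
  define k where "k i j = \<beta> / 4 * ln ((1 + r) / (1 - r * (stereo (x i) \<bullet> stereo (x j))))" for i j
  define w where "w i = confinement (x i)" for i
  have w0: "w i \<ge> 0" for i unfolding w_def by (rule confinement_nonneg)
  have rs: "r * (stereo (x i) \<bullet> stereo (x j)) < 1" for i j
    by (rule mult_less_one_of_le[OF r stereo_inner_le])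
  have k0: "k i j \<ge> 0" for i j
    unfolding k_def using ln_chord_nonneg[OF r(1) _ abs_stereo_inner_le rs] r \<beta>_pos by simp
  have gk: "gas_kernel r (x i) (x j) = ennreal (k i j + w i / 2 + w j / 2)" for i j
  proof -
    have "ennreal (\<beta> / 2) * chord_kernel r (stereo (x i) \<bullet> stereo (x j)) = ennreal (k i j)"
      using rs[of i j] \<beta>_pos ln_chord_nonneg[OF r(1) _ abs_stereo_inner_le rs, of i j] r
      unfolding chord_kernel_def k_def by (simp add: ennreal_mult[symmetric])
    then show ?thesis unfolding gas_kernel_def using k0[of i j] w0[of i] w0[of j]
      by (simp add: w_def ennreal_plus[symmetric] add.assoc del: ennreal_plus)
  qed
  define A where "A = (\<Sum>i=1..N. \<Sum>j=1..N. k i j)"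
  define B where "B = (\<Sum>i=1..N. w i)"
  have A0: "A \<ge> 0" and B0: "B \<ge> 0" unfolding A_def B_def by (auto intro!: sum_nonneg k0 w0)
  have total: "(\<Sum>i=1..N. \<Sum>j=1..N. k i j + w i / 2 + w j / 2) = A + real N * B"
  proof -
    have w_i: "(\<Sum>i=1..N. \<Sum>j=1..N. w i / 2) = real N * B / 2"
      and w_j: "(\<Sum>i=1..N. \<Sum>j=1..N. w j / 2) = real N * B / 2"
      unfolding B_def by (simp_all add: sum_divide_distrib sum_distrib_left)
    show ?thesis unfolding A_def sum.distrib w_i w_j by simp
  qed
  define I where "I = (A + real N * B) / (real N * real N)"
  have N0: "real N > 0" using N by simp
  have "mutual_energy r \<nu> \<nu> = ennreal I"
  proof -
    have meas: "(\<lambda>y. gas_kernel r z y) \<in> borel_measurable borel" for z by measurable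
    have "mutual_energy r \<nu> \<nu> = (\<integral>\<^sup>+y. (\<Sum>j=1..N. gas_kernel r y (x j)) / of_nat N \<partial>\<nu>)"
      unfolding mutual_energy_iterated[OF empirical_measure_in[OF N] empirical_measure_in[OF N], of r x x, folded \<nu>_def]
      unfolding \<nu>_def by (intro nn_integral_cong nn_integral_empirical[OF N] meas)
    also have "\<dots> = (\<Sum>i=1..N. (\<Sum>j=1..N. gas_kernel r (x i) (x j)) / of_nat N) / of_nat N"
      unfolding \<nu>_def by (rule nn_integral_empirical[OF N]) measurable
    also have "\<dots> = (\<Sum>i=1..N. ennreal ((\<Sum>j=1..N. k i j + w i / 2 + w j / 2) / real N)) / of_nat N"
    proof (intro arg_cong2[of _ _ _ _ "(/)"] sum.cong refl)
      fix i
      have "(\<Sum>j=1..N. gas_kernel r (x i) (x j)) = ennreal (\<Sum>j=1..N. k i j + w i / 2 + w j / 2)"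
        unfolding gk using k0 w0 by (intro sum_ennreal) (simp add: add_nonneg_nonneg)
      then show "(\<Sum>j=1..N. gas_kernel r (x i) (x j)) / of_nat N = ennreal ((\<Sum>j=1..N. k i j + w i / 2 + w j / 2) / real N)"
        using k0 w0 N0 by (simp add: ennreal_of_nat_eq_real_of_nat divide_ennreal sum_nonneg add_nonneg_nonneg)
    qed
    also have "(\<Sum>i=1..N. ennreal ((\<Sum>j=1..N. k i j + w i / 2 + w j / 2) / real N)) = ennreal ((A + real N * B) / real N)"
      unfolding total[symmetric] sum_divide_distrib using k0 w0
      by (intro sum_ennreal sum_nonneg divide_nonneg_nonneg add_nonneg_nonneg) auto
    also have "\<dots> / of_nat N = ennreal I"
      unfolding I_def using A0 B0 N0 by (simp add: ennreal_of_nat_eq_real_of_nat divide_ennreal)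
    finally show ?thesis .
  qed
  moreover have "I \<ge> 0" unfolding I_def using A0 B0 by simp
  moreover have "real N * (real N - 1) * I \<le> \<sigma> + real N * (\<beta> / 4 * ln ((1 + r) / (1 - r)))"
  proof -
    have diag: "k i i = \<beta> / 4 * ln ((1 + r) / (1 - r))" for i unfolding k_def by (simp add: dot_square_norm)
    have diag_sum: "(\<Sum>i=1..N. k i i + w i) = real N * (\<beta> / 4 * ln ((1 + r) / (1 - r))) + B"
      unfolding B_def diag sum.distrib by simp
    have off: "(\<Sum>j\<in>{1..N} - {i}. k i j + w i / 2 + w j / 2) = (\<Sum>j=1..N. k i j + w i / 2 + w j / 2) - (k i i + w i)"
      if "i \<in> {1..N}" for i using that by (subst sum_diff1) auto
    have "ennreal (\<Sum>i=1..N. \<Sum>j\<in>{1..N} - {i}. k i j + w i / 2 + w j / 2) =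
        (\<Sum>i=1..N. \<Sum>j\<in>{1..N} - {i}. gas_kernel r (x i) (x j))"
      unfolding gk using k0 w0 by (subst sum_ennreal, simp add: add_nonneg_nonneg sum_nonneg)+ (rule refl)
    also have "\<dots> \<le> (\<Sum>i=1..N. \<Sum>j\<in>{1..N} - {i}. gas_kernel 1 (x i) (x j))"
      unfolding gas_kernel_def by (intro sum_mono add_mono mult_left_mono chord_kernel_le r abs_stereo_inner_le) auto
    also have "\<dots> = ennreal \<sigma>" unfolding \<sigma>_def by (rule sum_kernel_eq(1)[OF inj])
    finally have "(\<Sum>i=1..N. \<Sum>j\<in>{1..N} - {i}. k i j + w i / 2 + w j / 2) \<le> \<sigma>"
      using sum_kernel_eq(2)[OF inj] by (simp add: \<sigma>_def)
    also have "(\<Sum>i=1..N. \<Sum>j\<in>{1..N} - {i}. k i j + w i / 2 + w j / 2) =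
        (\<Sum>i=1..N. (\<Sum>j=1..N. k i j + w i / 2 + w j / 2) - (k i i + w i))"
      by (rule sum.cong[OF refl off])
    also have "\<dots> = A + real N * B - (real N * (\<beta> / 4 * ln ((1 + r) / (1 - r))) + B)"
      unfolding sum_subtractf total diag_sum ..
    finally have "A + (real N - 1) * B \<le> \<sigma> + real N * (\<beta> / 4 * ln ((1 + r) / (1 - r)))"
      by (simp add: algebra_simps)
    moreover have "real N * (real N - 1) * I = (real N - 1) / real N * A + (real N - 1) * B"
      unfolding I_def using N0 by (simp add: field_simps)
    moreover have "(real N - 1) / real N * A \<le> 1 * A" using A0 N by (intro mult_right_mono) auto
    ultimately show ?thesis by linarith
  qed
  ultimately show ?thesis using that by blast
qed

end

locale finite_log_gas = log_gas +
  assumes Z_finite: "\<And>N. N \<ge> 1 \<Longrightarrow> partition_function \<beta> V N < \<infinity>"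
begin

lemma Z_pos:
  assumes "N \<ge> 1" shows "partition_function \<beta> V N \<noteq> 0"
proof -
  obtain m where "min_energy 1 = ennreal m" "m \<ge> 0" using min_energy_finite by (cases "min_energy 1") auto
  from partition_function_lower[OF this zero_less_one] obtain K where
    "\<And>N. N \<ge> 1 \<Longrightarrow> ennreal (exp (- (real N * (real N - 1) * (m + 1 - c) + real N * K))) \<le> partition_function \<beta> V N"
    by blast
  from this[OF assms] show ?thesis by (auto simp: not_le)
qed

lemma measurable_weight [measurable]:
  "gibbs_weight \<beta> V N \<in> borel_measurable (PiM {1..N} (\<lambda>_. lborel))"
  by (rule measurable_gibbs_weight[OF measurable_V])

lemma emeasure_gibbs:
  assumes [measurable]: "A \<in> sets (PiM {1..N} (\<lambda>_. lborel))"
  shows "emeasure (gibbs_measure \<beta> V N) A =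
    (\<integral>\<^sup>+x. ennreal (gibbs_weight \<beta> V N x) * indicator A x \<partial>PiM {1..N} (\<lambda>_. lborel)) / partition_function \<beta> V N"
proof -
  have "emeasure (gibbs_measure \<beta> V N) A =
    (\<integral>\<^sup>+x. ennreal (gibbs_weight \<beta> V N x) / partition_function \<beta> V N * indicator A x \<partial>PiM {1..N} (\<lambda>_. lborel))"
    unfolding gibbs_measure_def by (rule emeasure_density) (use assms in measurable)
  also have "\<dots> = (\<integral>\<^sup>+x. ennreal (gibbs_weight \<beta> V N x) * indicator A x / partition_function \<beta> V N \<partial>PiM {1..N} (\<lambda>_. lborel))"
    by (intro nn_integral_cong) (auto simp: indicator_def)
  also have "\<dots> = (\<integral>\<^sup>+x. ennreal (gibbs_weight \<beta> V N x) * indicator A x \<partial>PiM {1..N} (\<lambda>_. lborel)) / partition_function \<beta> V N"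
    by (rule nn_integral_divide) (use assms in measurable)
  finally show ?thesis .
qed

lemma prob_space_gibbs:
  assumes "N \<ge> 1" shows "prob_space (gibbs_measure \<beta> V N)"
proof
  have sp: "space (gibbs_measure \<beta> V N) = space (PiM {1..N} (\<lambda>_. lborel))" by (simp add: gibbs_measure_def)
  have "emeasure (gibbs_measure \<beta> V N) (space (PiM {1..N} (\<lambda>_. lborel))) =
    (\<integral>\<^sup>+x. ennreal (gibbs_weight \<beta> V N x) * indicator (space (PiM {1..N} (\<lambda>_. lborel))) x \<partial>PiM {1..N} (\<lambda>_. lborel)) / partition_function \<beta> V N"
    by (rule emeasure_gibbs) simp
  also have "(\<integral>\<^sup>+x. ennreal (gibbs_weight \<beta> V N x) * indicator (space (PiM {1..N} (\<lambda>_. lborel))) x \<partial>PiM {1..N} (\<lambda>_. lborel)) = partition_function \<beta> V N"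
    unfolding partition_function_def by (intro nn_integral_cong) simp
  also have "partition_function \<beta> V N / partition_function \<beta> V N = 1"
    using Z_pos[OF assms] Z_finite[OF assms] by (intro ennreal_divide_self) (auto simp: less_top)
  finally show "emeasure (gibbs_measure \<beta> V N) (space (gibbs_measure \<beta> V N)) = 1" unfolding sp .
qed

text \<open>This is the finiteness of the one-particle partition function.\<close>

lemma nn_integral_exp_V: "(\<integral>\<^sup>+x. ennreal (exp (- V x)) \<partial>lborel) < \<infinity>"
proof -
  interpret product_sigma_finite "\<lambda>_::nat. lborel :: 'a measure" by unfold_locales
  have "partition_function \<beta> V 1 = (\<integral>\<^sup>+x. ennreal (exp (- V (x (1::nat)))) \<partial>PiM {1} (\<lambda>_. lborel))"
    unfolding partition_function_def gibbs_weight_def by simp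
  also have "\<dots> = (\<integral>\<^sup>+x. ennreal (exp (- V x)) \<partial>lborel)"
    by (rule product_nn_integral_singleton) measurable
  finally show ?thesis using Z_finite[of 1] by simp
qed

text \<open>At discrepancy \<open>\<delta>\<close> the energy exceeds the minimum by \<open>(\<beta>/4) \<delta> = 8 \<eta>\<close>. Replacing the energy by
  its regularisation costs \<open>2 \<eta>\<close> and the lower bound for the partition function another \<open>\<eta>\<close>, so
  that a gain of \<open>5 \<eta>\<close> remains.\<close>

lemma large_discrepancy_bound:
  assumes \<mu>: "\<mu> \<in> borel_prob_measures" "mutual_energy 1 \<mu> \<mu> = min_energy 1" and \<delta>: "\<delta> > 0"
  obtains \<gamma> C where "\<gamma> > 0" "\<And>N. N \<ge> 1 \<Longrightarrow>
    emeasure (gibbs_measure \<beta> V N) {x\<in>space (PiM {1..N} (\<lambda>_. lborel)). \<delta> \<le> discrepancy (1 / 2) (empirical_measure N x) \<mu>}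
      \<le> ennreal (exp (- (\<gamma> * real N * (real N - 1)) + C * real N))"
proof -
  obtain m where m: "min_energy 1 = ennreal m" "m \<ge> 0" using min_energy_finite by (cases "min_energy 1") auto
  define \<eta> where "\<eta> = \<beta> * \<delta> / 32"
  have \<eta>: "\<eta> > 0" "\<beta> / 4 * \<delta> = 8 * \<eta>" unfolding \<eta>_def using \<beta>_pos \<delta> by auto
  obtain r where r: "1 / 2 \<le> r" "r < 1" and close: "min_energy 1 \<le> min_energy r + ennreal \<eta>"
    using min_energy_regularized[OF \<eta>(1)] by blast
  obtain K where K: "\<And>N. N \<ge> 1 \<Longrightarrow>
    ennreal (exp (- (real N * (real N - 1) * (m + \<eta> - c) + real N * K))) \<le> partition_function \<beta> V N"
    using partition_function_lower[OF m \<eta>(1)] by blast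
  define L where "L = \<beta> / 4 * ln ((1 + r) / (1 - r))"
  obtain z where z: "(\<integral>\<^sup>+x. ennreal (exp (- V x)) \<partial>lborel) = ennreal z" "z \<ge> 0"
    using nn_integral_exp_V by (cases "\<integral>\<^sup>+x. ennreal (exp (- V x)) \<partial>lborel") auto
  define Z where "Z = max 1 z"
  show ?thesis
  proof (rule that[of "5 * \<eta>" "L + K + ln Z"])
    show "5 * \<eta> > 0" using \<eta> by simp
    fix N :: nat assume N: "N \<ge> 1"
    let ?P = "PiM {1..N} (\<lambda>_. lborel :: 'a measure)"
    let ?NN = "real N * (real N - 1)"
    define A where "A = {x\<in>space ?P. \<delta> \<le> discrepancy (1 / 2) (empirical_measure N x) \<mu>}"
    have [measurable]: "A \<in> sets ?P"
      unfolding A_def using measurable_discrepancy_empirical[OF N] by measurable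
    define U where "U = exp (- (?NN * (m + 6 * \<eta> - c)) + real N * L)"
    have point: "ennreal (gibbs_weight \<beta> V N x) * indicator A x \<le> ennreal U * (\<Prod>i\<in>{1..N}. ennreal (exp (- V (x i))))" for x
    proof (cases "x \<in> A \<and> inj_on x {1..N}")
      case False
      then show ?thesis using gibbs_weight_collision[of x N] by (auto simp: indicator_def)
    next
      case True
      define \<sigma> where "\<sigma> = - (\<beta> / 2) * (\<Sum>i=1..N. \<Sum>j=1..N. ln (norm (x i - x j)))
        + (real N - 1) * (\<Sum>i=1..N. V (x i)) + real N * (real N - 1) * c"
      from True have inj: "inj_on x {1..N}" and disc: "\<delta> \<le> discrepancy (1 / 2) (empirical_measure N x) \<mu>"
        by (auto simp: A_def)
      have r0: "0 \<le> r" using r by simp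
      from regularized_empirical_energy[OF N r0 r(2) inj]
      obtain I where I: "mutual_energy r (empirical_measure N x) (empirical_measure N x) = ennreal I" "I \<ge> 0"
        and le: "?NN * I \<le> \<sigma> + real N * L" unfolding \<sigma>_def L_def by blast
      have "min_energy 1 + ennreal (\<beta> / 4 * discrepancy (1 / 2) (empirical_measure N x) \<mu>) \<le> ennreal I + 2 * ennreal \<eta>"
        unfolding I(1)[symmetric] by (rule energy_gap[OF \<mu> empirical_measure_in[OF N] r close])
      moreover have "ennreal (8 * \<eta>) \<le> ennreal (\<beta> / 4 * discrepancy (1 / 2) (empirical_measure N x) \<mu>)"
        unfolding \<eta>(2)[symmetric] using disc \<beta>_pos by (intro ennreal_leI mult_left_mono) auto
      ultimately have "ennreal m + ennreal (8 * \<eta>) \<le> ennreal I + 2 * ennreal \<eta>"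
        unfolding m(1) by (meson add_left_mono order_trans)
      also have "2 * ennreal \<eta> = ennreal (2 * \<eta>)" using \<eta>(1) by (simp add: ennreal_mult)
      finally have "m + 8 * \<eta> \<le> I + 2 * \<eta>" using m(2) I(2) \<eta>(1)
        by (simp add: ennreal_plus[symmetric] del: ennreal_plus)
      then have "?NN * (m + 6 * \<eta>) \<le> ?NN * I" using N by (intro mult_left_mono) auto
      with le have "?NN * (m + 6 * \<eta>) \<le> \<sigma> + real N * L" by linarith
      then have "\<beta> / 2 * (\<Sum>i=1..N. \<Sum>j=1..N. ln (norm (x i - x j))) - real N * (\<Sum>i=1..N. V (x i))
        \<le> (- (?NN * (m + 6 * \<eta> - c)) + real N * L) + (\<Sum>i=1..N. - V (x i))"
        unfolding \<sigma>_def by (simp add: algebra_simps sum_negf)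
      then have "gibbs_weight \<beta> V N x \<le> exp ((- (?NN * (m + 6 * \<eta> - c)) + real N * L) + (\<Sum>i=1..N. - V (x i)))"
        unfolding gibbs_weight_eq_exp[OF inj] by simp
      also have "\<dots> = U * (\<Prod>i\<in>{1..N}. exp (- V (x i)))"
        unfolding U_def exp_add[of _ "\<Sum>i=1..N. - V (x i)"] by (simp only: exp_sum finite_atLeastAtMost)
      finally have "ennreal (gibbs_weight \<beta> V N x) \<le> ennreal (U * (\<Prod>i\<in>{1..N}. exp (- V (x i))))" by (rule ennreal_leI)
      also have "\<dots> = ennreal U * (\<Prod>i\<in>{1..N}. ennreal (exp (- V (x i))))"
        by (subst prod_ennreal) (auto simp: U_def ennreal_mult prod_nonneg)
      finally show ?thesis using True by (simp add: indicator_def)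
    qed
    interpret product_sigma_finite "\<lambda>_::nat. lborel :: 'a measure" by unfold_locales
    have "(\<integral>\<^sup>+x. ennreal (gibbs_weight \<beta> V N x) * indicator A x \<partial>?P) \<le> (\<integral>\<^sup>+x. ennreal U * (\<Prod>i\<in>{1..N}. ennreal (exp (- V (x i)))) \<partial>?P)"
      by (intro nn_integral_mono point)
    also have "\<dots> = ennreal U * (\<integral>\<^sup>+x. (\<Prod>i\<in>{1..N}. ennreal (exp (- V (x i)))) \<partial>?P)"
      by (rule nn_integral_cmult) measurable
    also have "(\<integral>\<^sup>+x. (\<Prod>i\<in>{1..N}. ennreal (exp (- V (x i)))) \<partial>?P) = (\<Prod>i\<in>{1..N}. ennreal z)"
      unfolding z(1)[symmetric] by (rule product_nn_integral_prod) (simp, measurable)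
    also have "ennreal U * (\<Prod>i\<in>{1..N}. ennreal z) \<le> ennreal (U * Z ^ N)"
    proof -
      have "(\<Prod>i\<in>{1..N}. ennreal z) = ennreal (z ^ N)" using z(2) by (simp add: ennreal_power)
      moreover have "z ^ N \<le> Z ^ N" using z(2) by (intro power_mono) (auto simp: Z_def)
      ultimately show ?thesis using z(2)
        by (auto simp: U_def ennreal_mult[symmetric] intro!: ennreal_leI mult_left_mono)
    qed
    finally have up: "(\<integral>\<^sup>+x. ennreal (gibbs_weight \<beta> V N x) * indicator A x \<partial>?P) \<le> ennreal (U * Z ^ N)" .
    \<comment> \<open>The lower bound for the partition function.\<close>
    define D where "D = exp (- (?NN * (m + \<eta> - c) + real N * K))"
    have D: "D > 0" "ennreal D \<le> partition_function \<beta> V N" unfolding D_def using K[OF N] by auto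
    have "emeasure (gibbs_measure \<beta> V N) A \<le> ennreal (U * Z ^ N) / partition_function \<beta> V N"
      unfolding emeasure_gibbs[OF \<open>A \<in> sets ?P\<close>] by (intro divide_right_mono_ennreal up)
    also have "\<dots> \<le> ennreal (U * Z ^ N) / ennreal D"
      using D by (cases "partition_function \<beta> V N")
        (auto simp: divide_ennreal divide_ennreal_def intro!: mult_left_mono ennreal_leI le_imp_inverse_le simp: inverse_ennreal)
    also have "\<dots> = ennreal (U * Z ^ N / D)"
      using D(1) by (intro divide_ennreal) (auto simp: U_def Z_def)
    also have "U * Z ^ N / D = exp (- (5 * \<eta> * real N * (real N - 1)) + (L + K + ln Z) * real N)"
    proof -
      have "Z ^ N = exp (real N * ln Z)" by (simp add: Z_def exp_of_nat_mult max_def)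
      then have "U * Z ^ N / D = exp ((- (?NN * (m + 6 * \<eta> - c)) + real N * L) + real N * ln Z - (- (?NN * (m + \<eta> - c) + real N * K)))"
        unfolding U_def D_def by (simp only: exp_add exp_diff)
      then show ?thesis by (simp add: algebra_simps)
    qed
    finally show "emeasure (gibbs_measure \<beta> V N) {x\<in>space ?P. \<delta> \<le> discrepancy (1 / 2) (empirical_measure N x) \<mu>}
      \<le> ennreal (exp (- (5 * \<eta> * real N * (real N - 1)) + (L + K + ln Z) * real N))"
      unfolding A_def .
  qed
qed

end

section \<open>Almost sure convergence\<close>

lemma sets_Collect_LIMSEQ:
  fixes X :: "nat \<Rightarrow> 'b \<Rightarrow> real"
  assumes [measurable]: "\<And>n. X n \<in> borel_measurable M"
  shows "{\<omega>\<in>space M. (\<lambda>n. X n \<omega>) \<longlonglongrightarrow> L} \<in> sets M"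
proof -
  have "x \<longlonglongrightarrow> L \<longleftrightarrow> (\<forall>k::nat. \<exists>n0. \<forall>n. n \<ge> n0 \<longrightarrow> \<bar>x n - L\<bar> < 1 / Suc k)" for x :: "nat \<Rightarrow> real"
  proof
    assume lim: "x \<longlonglongrightarrow> L"
    show "\<forall>k::nat. \<exists>n0. \<forall>n. n \<ge> n0 \<longrightarrow> \<bar>x n - L\<bar> < 1 / Suc k"
    proof
      fix k :: nat
      show "\<exists>n0. \<forall>n. n \<ge> n0 \<longrightarrow> \<bar>x n - L\<bar> < 1 / Suc k"
        using LIMSEQ_D[OF lim, of "1 / Suc k"] by simp
    qed
  next
    assume r: "\<forall>k::nat. \<exists>n0. \<forall>n. n \<ge> n0 \<longrightarrow> \<bar>x n - L\<bar> < 1 / Suc k"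
    show "x \<longlonglongrightarrow> L"
    proof (rule LIMSEQ_I)
      fix e :: real assume "0 < e"
      then obtain k :: nat where k: "1 / Suc k < e" using nat_approx_posE by blast
      from r obtain n0 where "\<forall>n. n \<ge> n0 \<longrightarrow> \<bar>x n - L\<bar> < 1 / Suc k" by blast
      then have "norm (x n - L) < e" if "n \<ge> n0" for n
        using that k unfolding real_norm_def by (meson less_trans)
      then show "\<exists>n0. \<forall>n\<ge>n0. norm (x n - L) < e" by blast
    qed
  qed
  then have "{\<omega>\<in>space M. (\<lambda>n. X n \<omega>) \<longlonglongrightarrow> L} =
      {\<omega>\<in>space M. \<forall>k::nat. \<exists>n0. \<forall>n. n \<ge> n0 \<longrightarrow> \<bar>X n \<omega> - L\<bar> < 1 / Suc k}" by simp
  also have "\<dots> \<in> sets M" by measurable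
  finally show ?thesis .
qed

text \<open>The quadratic exponent eventually beats the linear one by more than \<open>n\<close>, so a geometric series dominates.\<close>

lemma summable_gaussian_tail:
  fixes \<gamma> C :: real
  assumes "\<gamma> > 0"
  shows "summable (\<lambda>n. exp (- (\<gamma> * real (Suc n) * (real (Suc n) - 1)) + C * real (Suc n)))"
proof -
  obtain n0 :: nat where n0: "(C + 1) / \<gamma> < real n0" using reals_Archimedean2 by blast
  show ?thesis
  proof (rule summable_comparison_test'[where N = n0 and g = "\<lambda>n. exp (- 1) * exp (- 1) ^ n"])
    show "summable (\<lambda>n. exp (- 1 :: real) * exp (- 1) ^ n)" by (intro summable_mult summable_geometric) simp
    fix n assume "n \<ge> n0"
    then have "(C + 1) / \<gamma> \<le> real n" using n0 by linarith
    then have "C + 1 \<le> \<gamma> * real n" using assms by (simp add: pos_divide_le_eq mult.commute)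
    then have "(C + 1) * real (Suc n) \<le> \<gamma> * real n * real (Suc n)" by (intro mult_right_mono) auto
    then have "- (\<gamma> * real (Suc n) * (real (Suc n) - 1)) + C * real (Suc n) \<le> - 1 + real n * (- 1)"
      by (simp add: algebra_simps)
    then have "exp (- (\<gamma> * real (Suc n) * (real (Suc n) - 1)) + C * real (Suc n)) \<le> exp (- 1 + real n * (- 1))"
      by simp
    also have "\<dots> = exp (- 1) * exp (- 1) ^ n" by (simp only: exp_add exp_of_nat_mult)
    finally show "norm (exp (- (\<gamma> * real (Suc n) * (real (Suc n) - 1)) + C * real (Suc n))) \<le> exp (- 1) * exp (- 1) ^ n"
      by simp
  qed
qed

lemma weakly_converges_Suc:
  fixes \<mu> :: "nat \<Rightarrow> 'a::topological_space measure"
  shows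
  "weakly_converges (\<lambda>n. \<mu> (Suc n)) \<nu> \<longleftrightarrow> weakly_converges \<mu> \<nu>"
proof -
  have "((\<lambda>n. integral\<^sup>L (\<mu> (Suc n)) f) \<longlonglongrightarrow> L) = ((\<lambda>n. integral\<^sup>L (\<mu> n) f) \<longlonglongrightarrow> L)"
    for f :: "'a \<Rightarrow> real" and L
    by (rule filterlim_sequentially_Suc)
  then show ?thesis unfolding weakly_converges_def by simp
qed

text \<open>Reduces weak convergence, which quantifies over uncountably many test functions, to countably many
  of them; in particular it becomes a measurable event.\<close>

lemma weakly_converges_iff_moments_converge:
  fixes \<mu> :: "'a::euclidean_space measure"
  assumes "\<And>n. \<nu> n \<in> borel_prob_measures" "\<mu> \<in> borel_prob_measures"
  shows "weakly_converges \<nu> \<mu> \<longleftrightarrow> moments_converge \<nu> \<mu>"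
proof
  assume w: "weakly_converges \<nu> \<mu>"
  show "moments_converge \<nu> \<mu>"
    unfolding moments_converge_def moment_def
  proof (intro allI impI)
    fix \<alpha> :: "('a \<times> real) list" assume \<alpha>: "set \<alpha> \<subseteq> Basis"
    then have "\<alpha> \<in> words (length \<alpha>)" by (simp add: words_def)
    then have "\<bar>monomial \<alpha> (stereo x :: 'a \<times> real)\<bar> \<le> 1" for x by (intro abs_monomial_le) auto
    then have "bounded (range (\<lambda>x::'a. monomial \<alpha> (stereo x)))" by (auto simp: bounded_iff)
    moreover have "continuous_on UNIV (\<lambda>x::'a. monomial \<alpha> (stereo x))"
      by (rule continuous_on_compose2[OF continuous_on_monomial continuous_on_stereo]) auto
    ultimately show "(\<lambda>n. \<integral>x. monomial \<alpha> (stereo x) \<partial>\<nu> n) \<longlonglongrightarrow> (\<integral>x. monomial \<alpha> (stereo x) \<partial>\<mu>)"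
      using w unfolding weakly_converges_def by blast
  qed
qed (rule moments_converge_imp_weakly_converges[OF assms])

context finite_log_gas
begin

lemma prob_space_product: "prob_space (product_gibbs_measure \<beta> V)"
  unfolding product_gibbs_measure_def by (rule prob_space_PiM) (simp add: prob_space_gibbs)

lemma distr_component:
  assumes "N \<ge> 1"
  shows "distr (product_gibbs_measure \<beta> V) (gibbs_measure \<beta> V N) (\<lambda>\<omega>. \<omega> N) = gibbs_measure \<beta> V N"
  unfolding product_gibbs_measure_def by (rule distr_PiM_component) (use assms prob_space_gibbs in auto)

lemma measurable_configuration:
  assumes "N \<ge> 1"
  shows "(\<lambda>\<omega>. \<omega> N) \<in> measurable (product_gibbs_measure \<beta> V) (PiM {1..N} (\<lambda>_. lborel))"
proof -
  have "(\<lambda>\<omega>. \<omega> N) \<in> measurable (product_gibbs_measure \<beta> V) (gibbs_measure \<beta> V N)"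
    unfolding product_gibbs_measure_def by (rule measurable_component_singleton) (use assms in simp)
  then show ?thesis by (simp add: measurable_cong_sets[OF refl sets_gibbs_measure])
qed

lemma AE_discrepancy_eventually_small:
  assumes \<mu>: "\<mu> \<in> borel_prob_measures" "mutual_energy 1 \<mu> \<mu> = min_energy 1" and \<delta>: "\<delta> > 0"
  shows "AE \<omega> in product_gibbs_measure \<beta> V.
    \<forall>\<^sub>F n in sequentially. discrepancy (1 / 2) (empirical_measure (Suc n) (\<omega> (Suc n))) \<mu> < \<delta>"
proof -
  let ?P = "product_gibbs_measure \<beta> V"
  interpret P: prob_space ?P by (rule prob_space_product)
  obtain \<gamma> C where \<gamma>: "\<gamma> > 0" and bound: "\<And>N. N \<ge> 1 \<Longrightarrow>
    emeasure (gibbs_measure \<beta> V N) {x\<in>space (PiM {1..N} (\<lambda>_. lborel)). \<delta> \<le> discrepancy (1 / 2) (empirical_measure N x) \<mu>}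
      \<le> ennreal (exp (- (\<gamma> * real N * (real N - 1)) + C * real N))"
    using large_discrepancy_bound[OF \<mu> \<delta>] by blast
  define A where "A n = {\<omega>\<in>space ?P. \<delta> \<le> discrepancy (1 / 2) (empirical_measure (Suc n) (\<omega> (Suc n))) \<mu>}" for n
  have meas [measurable]: "A n \<in> sets ?P" for n
  proof -
    have [measurable]: "(\<lambda>\<omega>. discrepancy (1 / 2) (empirical_measure (Suc n) (\<omega> (Suc n))) \<mu>) \<in> borel_measurable ?P"
      using measurable_compose[OF measurable_configuration[of "Suc n"] measurable_discrepancy_empirical[of "Suc n" "1 / 2" \<mu>]] by simp
    show ?thesis unfolding A_def by measurable
  qed
  have le: "measure ?P (A n) \<le> exp (- (\<gamma> * real (Suc n) * (real (Suc n) - 1)) + C * real (Suc n))" for n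
  proof -
    let ?G = "gibbs_measure \<beta> V (Suc n)"
    let ?B = "{x\<in>space (PiM {1..Suc n} (\<lambda>_. lborel)). \<delta> \<le> discrepancy (1 / 2) (empirical_measure (Suc n) x) \<mu>}"
    have N: "Suc n \<ge> 1" by simp
    have B: "?B \<in> sets ?G"
      unfolding sets_gibbs_measure using measurable_discrepancy_empirical[OF N] by measurable
    have mG: "(\<lambda>\<omega>. \<omega> (Suc n)) \<in> measurable ?P ?G"
      using measurable_configuration[OF N] by (simp add: measurable_cong_sets[OF refl sets_gibbs_measure])
    have "emeasure ?P (A n) = emeasure ?P ((\<lambda>\<omega>. \<omega> (Suc n)) -` ?B \<inter> space ?P)"
      using measurable_space[OF measurable_configuration[OF N]] by (intro arg_cong[of _ _ "emeasure ?P"]) (auto simp: A_def)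
    also have "\<dots> = emeasure (distr ?P ?G (\<lambda>\<omega>. \<omega> (Suc n))) ?B" by (rule emeasure_distr[OF mG B, symmetric])
    also have "\<dots> = emeasure ?G ?B" unfolding distr_component[OF N] ..
    also have "\<dots> \<le> ennreal (exp (- (\<gamma> * real (Suc n) * (real (Suc n) - 1)) + C * real (Suc n)))" by (rule bound[OF N])
    finally show ?thesis unfolding P.emeasure_eq_measure by simp
  qed
  have "summable (\<lambda>n. measure ?P (A n))"
    by (rule summable_comparison_test'[where N = 0, OF summable_gaussian_tail[OF \<gamma>]]) (use le in simp)
  from borel_cantelli_AE1[OF meas _ this]
  have "AE \<omega> in ?P. \<forall>\<^sub>F n in sequentially. \<omega> \<in> space ?P - A n" by (simp add: P.emeasure_eq_measure)
  then show ?thesis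
  proof eventually_elim
    case (elim \<omega>)
    then show ?case by (rule eventually_mono) (simp add: A_def not_le)
  qed
qed

theorem prob_weakly_converges:
  "\<P>(\<omega> in product_gibbs_measure \<beta> V.
      weakly_converges (\<lambda>N. empirical_measure N (\<omega> N)) (equilibrium_measure \<beta> V)) = 1"
proof -
  let ?P = "product_gibbs_measure \<beta> V" and ?\<mu> = "equilibrium_measure \<beta> V"
  interpret P: prob_space ?P by (rule prob_space_product)
  note \<mu> = equilibrium_measure_minimizes
  define \<nu> where "\<nu> \<omega> n = empirical_measure (Suc n) (\<omega> (Suc n))" for \<omega> :: "nat \<Rightarrow> nat \<Rightarrow> 'a" and n
  have \<nu>: "\<nu> \<omega> n \<in> borel_prob_measures" for \<omega> n unfolding \<nu>_def by (rule empirical_measure_in) simp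
  have iff: "weakly_converges (\<lambda>N. empirical_measure N (\<omega> N)) ?\<mu> \<longleftrightarrow> moments_converge (\<nu> \<omega>) ?\<mu>" for \<omega>
  proof -
    have "\<nu> \<omega> = (\<lambda>n. empirical_measure (Suc n) (\<omega> (Suc n)))" by (simp add: \<nu>_def fun_eq_iff)
    then show ?thesis
      using weakly_converges_Suc[of "\<lambda>N. empirical_measure N (\<omega> N)" ?\<mu>]
        weakly_converges_iff_moments_converge[of "\<nu> \<omega>", OF \<nu> \<mu>(1)] by (simp only:)
  qed
  have "AE \<omega> in ?P. \<forall>k. \<forall>\<^sub>F n in sequentially. discrepancy (1 / 2) (\<nu> \<omega> n) ?\<mu> < 1 / Suc k"
    unfolding AE_all_countable \<nu>_def by (intro allI AE_discrepancy_eventually_small \<mu>) simp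
  then have AE: "AE \<omega> in ?P. moments_converge (\<nu> \<omega>) ?\<mu>"
  proof eventually_elim
    case (elim \<omega>)
    have "(\<lambda>n. discrepancy (1 / 2) (\<nu> \<omega> n) ?\<mu>) \<longlonglongrightarrow> 0"
    proof (rule order_tendstoI)
      fix a :: real assume "a < 0"
      then show "\<forall>\<^sub>F n in sequentially. a < discrepancy (1 / 2) (\<nu> \<omega> n) ?\<mu>"
        by (intro always_eventually allI less_le_trans[OF _ discrepancy_nonneg[OF \<nu> \<mu>(1)]]) auto
    next
      fix a :: real assume "0 < a"
      then obtain k :: nat where k: "1 / Suc k < a" using nat_approx_posE by blast
      from elim have "\<forall>\<^sub>F n in sequentially. discrepancy (1 / 2) (\<nu> \<omega> n) ?\<mu> < 1 / Suc k" by blast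
      then show "\<forall>\<^sub>F n in sequentially. discrepancy (1 / 2) (\<nu> \<omega> n) ?\<mu> < a"
        by eventually_elim (use k in linarith)
    qed
    then show ?case by (intro discrepancy_tendsto_0_imp_moments_converge[of "\<nu> \<omega>" ?\<mu> "1 / 2", OF \<nu> \<mu>(1)]) auto
  qed
  have "{\<omega>\<in>space ?P. moments_converge (\<nu> \<omega>) ?\<mu>} \<in> sets ?P"
  proof -
    have eq: "moments_converge (\<nu> \<omega>) ?\<mu> \<longleftrightarrow>
       (\<forall>\<alpha>\<in>lists Basis. (\<lambda>n. moment (\<nu> \<omega> n) \<alpha>) \<longlonglongrightarrow> moment ?\<mu> \<alpha>)" for \<omega>
      unfolding moments_converge_def lists_eq_set by simp
    have m: "(\<lambda>\<omega>. moment (\<nu> \<omega> n) \<alpha>) \<in> borel_measurable ?P" for n \<alpha>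
      unfolding \<nu>_def
      using measurable_compose[OF measurable_configuration[of "Suc n"] measurable_moment_empirical[of "Suc n" \<alpha>]] by simp
    have cnt: "countable (lists (Basis :: ('a \<times> real) set))" by (intro countable_lists countable_finite) simp
    show ?thesis unfolding eq
      by (rule sets.sets_Collect_countable_All'[OF sets_Collect_LIMSEQ[OF m] cnt])
  qed
  then show ?thesis unfolding iff using P.prob_Collect_eq_1 AE by simp
qed

end

text \<open>Outside a ball the growth condition applies, with \<open>log (1 + |x|\<^sup>2) \<le> log 2 + 2 log |x|\<close>; inside, the
  function is continuous on a compact set.\<close>

lemma confining_constant_exists:
  fixes V :: "'a::euclidean_space \<Rightarrow> real"
  assumes V: "continuous_on UNIV V" and \<beta>: "\<beta> > 0" "\<beta>' \<ge> \<beta>"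
    and growth: "Liminf at_infinity (\<lambda>x. ereal (V x - \<beta>' * ln (norm x))) > -\<infinity>"
  obtains c where "0 \<le> c" "\<And>x. 0 \<le> V x - \<beta> / 2 * ln (1 + (norm x)\<^sup>2) + c"
proof -
  obtain K where "ereal K < Liminf at_infinity (\<lambda>x. ereal (V x - \<beta>' * ln (norm x)))"
    using ereal_dense2[OF growth] by auto
  then have "\<forall>\<^sub>F x in at_infinity. ereal K < ereal (V x - \<beta>' * ln (norm x))" by (rule less_LiminfD)
  then obtain b where b: "\<And>x. norm x \<ge> b \<Longrightarrow> K < V x - \<beta>' * ln (norm x)"
    by (auto simp: eventually_at_infinity)
  define R where "R = max b 1"
  define W where "W x = V x - \<beta> / 2 * ln (1 + (norm x)\<^sup>2)" for x
  have "continuous_on UNIV W"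
    unfolding W_def by (intro continuous_intros V) (use one_plus_norm_sq_pos in auto)
  then have "bounded (W ` cball 0 R)"
    by (intro compact_imp_bounded compact_continuous_image) (auto intro: continuous_on_subset)
  then obtain B where B: "\<forall>x\<in>cball 0 R. \<bar>W x\<bar> \<le> B" by (auto simp: bounded_iff)
  define c where "c = max 0 (max B (\<beta> / 2 * ln 2 - K))"
  show ?thesis
  proof (rule that[of c])
    show "0 \<le> c" by (simp add: c_def)
    fix x
    show "0 \<le> V x - \<beta> / 2 * ln (1 + (norm x)\<^sup>2) + c"
    proof (cases "norm x \<le> R")
      case True
      then have "\<bar>W x\<bar> \<le> B" using B by simp
      then show ?thesis by (simp add: W_def c_def)
    next
      case False
      then have n: "norm x \<ge> b" "norm x \<ge> 1" by (auto simp: R_def)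
      have "1 \<le> (norm x)\<^sup>2" using n(2) by (simp add: one_le_power)
      then have "ln (1 + (norm x)\<^sup>2) \<le> ln (2 * (norm x)\<^sup>2)" by (intro ln_mono) auto
      also have "\<dots> = ln 2 + 2 * ln (norm x)" using n(2) by (subst ln_mult) (auto simp: ln_realpow)
      finally have "\<beta> / 2 * ln (1 + (norm x)\<^sup>2) \<le> \<beta> / 2 * (ln 2 + 2 * ln (norm x))"
        using \<beta>(1) by (intro mult_left_mono) auto
      moreover have "\<beta> * ln (norm x) \<le> \<beta>' * ln (norm x)" using \<beta>(2) n(2) by (intro mult_right_mono) auto
      moreover have "K < V x - \<beta>' * ln (norm x)" by (rule b[OF n(1)])
      moreover have "\<beta> / 2 * ln 2 - K \<le> c" by (simp add: c_def)
      ultimately show ?thesis by (simp add: algebra_simps)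
    qed
  qed
qed

lemma empirical_measures_converge:
  fixes V :: "'a::euclidean_space \<Rightarrow> real"
  assumes "\<beta> > 0" "continuous_on UNIV V" "\<forall>N\<ge>1. partition_function \<beta> V N < \<infinity>"
    and "\<exists>\<beta>'>1. \<beta>' \<ge> \<beta> \<and> Liminf at_infinity (\<lambda>x. ereal (V x - \<beta>' * ln (norm x))) > -\<infinity>"
  shows "\<P>(\<omega> in product_gibbs_measure \<beta> V.
            weakly_converges (\<lambda>N. empirical_measure N (\<omega> N)) (equilibrium_measure \<beta> V)) = 1"
proof -
  obtain \<beta>' where "\<beta>' \<ge> \<beta>" "Liminf at_infinity (\<lambda>x. ereal (V x - \<beta>' * ln (norm x))) > -\<infinity>"
    using assms(4) by blast
  then show ?thesis
  proof (rule confining_constant_exists[OF assms(2,1)])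
    fix c assume c: "0 \<le> c" "\<And>x. 0 \<le> V x - \<beta> / 2 * ln (1 + (norm x)\<^sup>2) + c"
    interpret finite_log_gas \<beta> V c
      by unfold_locales (use assms c in auto)
    show ?thesis by (rule prob_weakly_converges)
  qed
qed

theorem corollary1p2:
  fixes \<beta> :: real
  assumes "\<beta> > 0"
  shows
    "(\<forall>V :: real \<Rightarrow> real.
        continuous_on UNIV V \<and>
        (\<forall>N\<ge>1. partition_function \<beta> V N < \<infinity>) \<and>
        (\<exists>\<beta>'>1. \<beta>' \<ge> \<beta> \<and> Liminf at_infinity (\<lambda>x. ereal (V x - \<beta>' * ln (norm x))) > -\<infinity>) \<longrightarrow>
        \<P>(\<omega> in product_gibbs_measure \<beta> V.
            weakly_converges (\<lambda>N. empirical_measure N (\<omega> N)) (equilibrium_measure \<beta> V)) = 1) \<and>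
     (\<forall>V :: complex \<Rightarrow> real.
        continuous_on UNIV V \<and>
        (\<forall>N\<ge>1. partition_function \<beta> V N < \<infinity>) \<and>
        (\<exists>\<beta>'>1. \<beta>' \<ge> \<beta> \<and> Liminf at_infinity (\<lambda>x. ereal (V x - \<beta>' * ln (norm x))) > -\<infinity>) \<longrightarrow>
        \<P>(\<omega> in product_gibbs_measure \<beta> V.
            weakly_converges (\<lambda>N. empirical_measure N (\<omega> N)) (equilibrium_measure \<beta> V)) = 1)"
  by (intro conjI allI impI; elim conjE) (rule empirical_measures_converge[OF assms]; assumption)+

end
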